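(* Let $X,Y\in \mathrm{Sym}^+(3)$, $(U,D)\in\mathcal E_X$, $(V,\Lambda)\in\mathcal E_Y$. If $X\in\mathcal S_{\rm mid}$ assume $D\in\mathcal D_{\mathsf J_1}$; if $Y\in\mathcal S_{\rm mid}$ assume $\Lambda\in\mathcal D_{\mathsf J_1}$. Let $k>0$ be the parameter in the metric on $M$. The scaling-rotation distance $d_{\mathcal{SR}}(X,Y)$ is given as follows. (i) If $X,Y\in\mathcal S_{\rm top}$, then $$d_{\mathcal{SR}}(X,Y)^2=\min_{g\in\tilde S_3^+}\left\{\frac k2\left\|\log(U^{-1}VP_g^{-1})\right\|^2+\left\|\log\left(D^{-1}(\pi_g\cdot\Lambda)\right)\right\|^2\right\}.$$ (ii) If $X\in\mathcal S_{\rm mid}$ and $Y\in\mathcal S_{\rm top}$, then $d_{\mathcal{SR}}(X,Y)=\min\{\ell_{\rm id},\ell_{(13)},\ell_{(12)}\}$, where $$\ell_{\rm id}=\sqrt{4k\varphi^2+\|\log(\Lambda D^{-1})\|^2},\quad \ell_{(13)}=\sqrt{4k\beta^2+\|\log((\pi_{13}\cdot\Lambda)D^{-1})\|^2},\quad \ell_{(12)}=\sqrt{4k(\beta')^2+\|\log((\pi_{12}\cdot\Lambda)D^{-1})\|^2},$$ and $\varphi,\beta,\beta'\in[0,\frac\pi4]$ are $$\varphi=\cos^{-1}(\max\{|z|,|w|\}),\quad \beta=\tfrac12\cos^{-1}(2|\mathrm{Re}(\bar zw)|),\quad\beta'=\tfrac12\cos^{-1}(2|\mathrm{Im}(\bar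 zw)|),$$ with $(z,w)$ determined up to overall sign by $q_{U^{-1}V}=z+wj$. Writing $D=\mathrm{diag}(d_1,d_2,d_2)$ and $\Lambda=\mathrm{diag}(\lambda_1,\lambda_2,\lambda_3)$, we also have $$\ell_{\rm id}^2-\ell_{(13)}^2=4k(\varphi^2-\beta^2)-2\log\left(\tfrac{d_1}{d_2}\right)\log\left(\tfrac{\lambda_1}{\lambda_3}\right),$$ $$\ell_{\rm id}^2-\ell_{(12)}^2=4k(\varphi^2-(\beta')^2)-2\log\left(\tfrac{d_1}{d_2}\right)\log\left(\tfrac{\lambda_1}{\lambda_2}\right),$$ $$\ell_{(13)}^2-\ell_{(12)}^2=4k(\beta^2-(\beta')^2)+2\log\left(\tfrac{d_1}{d_2}\right)\log\left(\tfrac{\lambda_2}{\lambda_3}\right).$$ (iii) If $X,Y\in\mathcal S_{\rm mid}$, then $d_{\mathcal{SR}}(X,Y)=\min\{\ell_{\rm id},\ell_{(13)}\}$, where, with $\varphi$ as defined in (ii), $$\ell_{\rm id}=\sqrt{4k\varphi^2+\|\log(\Lambda D^{-1})\|^2},\qquad \ell_{(13)}=\sqrt{4k(\tfrac\pi4-\varphi)^2+\|\log((\pi_{13}\cdot\Lambda)D^{-1})\|^2}.$$ Writing $D=\mathrm{diag}(d_1,d_2,d_2)$ and $\Lambda=\mathrm{diag}(\lambda_1,\lambda_2,\lambda_2)$, we also have $$\ell_{\rm id}^2-\ell_{(13)}^2=2k\pi\left(\varphi-\tfrac\pi8\right)-2\log\left(\tfrac{d_1}{d_2}\right)\log\left(\tfrac{\lambda_1}{\lambda_2}\right).$$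 (iv) If $X\in\mathcal S_{\rm bot}$, then $d_{\mathcal{SR}}(X,Y)=\|\log(D^{-1}\Lambda)\|$, regardless of which of $\mathcal S_{\rm top},\mathcal S_{\rm mid},\mathcal S_{\rm bot}$ contains $Y$.
   Context: $\mathrm{Sym}^+(p)$ is the set of real symmetric positive-definite $p\times p$ matrices, $\mathrm{Diag}^+(p)$ the set of diagonal matrices with positive diagonal entries, $M=SO(p)\times\mathrm{Diag}^+(p)$, $F:M\to\mathrm{Sym}^+(p)$, $F(U,D)=UDU^T$, $\mathcal E_X=F^{-1}(X)$. Here $p=3$. $M$ carries the product Riemannian metric $g_M((A_1,L_1),(A_2,L_2))|_{(U,D)}=-\frac{k}{2}\mathrm{tr}(A_1U^{-1}A_2U^{-1})+\mathrm{tr}(D^{-1}L_1D^{-1}L_2)$ for $A_i\in T_USO(p)$, $L_i\in\mathrm{Diag}(p)=T_D\mathrm{Diag}^+(p)$, with $k>0$ a fixed parameter; its geodesic distance is $d_M((U,D),(V,\Lambda))^2=\frac k2\|\log(U^{-1}V)\|^2+\|\log(D^{-1}\Lambda)\|^2$. Here $\|\cdot\|$ is the Frobenius norm, and for $R\in SO(p)$, $\log R$ is an antisymmetric matrix $A$ of smallest norm with $\exp A=R$ (its norm is well defined even when $A$ is not unique). The scaling-rotation distance is $d_{\mathcal{SR}}(X,Y)=\inf\{d_M((U,D),(V,\Lambda)):(U,D)\in\mathcal E_X,(V,\Lambda)\in\mathcal E_Y\}$. $\mathcal S_{\rm top},\mathcal S_{\rm mid},\mathcal S_{\rm bot}\subset\mathrm{Sym}^+(3)$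 are the sets of matrices with exactly three, two, one distinct eigenvalues, respectively. $\mathcal D_{\mathsf J_1}=\{\mathrm{diag}(d_1,d_2,d_2): d_1,d_2>0,\ d_1\ne d_2\}$. $\tilde S_3^+$ is the 24-element group of even signed-permutation matrices: $3\times3$ matrices $P_g$ of determinant $1$ with entries $(P_g)_{ij}=\pm\delta_{i,\pi(j)}$ for some permutation $\pi=:\pi_g\in S_3$. $S_3$ acts on diagonal matrices by $\pi\cdot\mathrm{diag}(d_1,d_2,d_3)=\mathrm{diag}(d_{\pi^{-1}(1)},d_{\pi^{-1}(2)},d_{\pi^{-1}(3)})$. $\pi_{ab}$ denotes the transposition $(ab)$. Quaternions: $\mathbf H$ has real basis $1,i,j,k$ and $S^3_{\mathbf H}$ is its unit sphere. $\phi:S^3_{\mathbf H}\to SO(3)$ is the two-to-one homomorphism $\phi(q)(x)=qx\bar q$, $x\in\mathrm{Im}(\mathbf H)\cong\mathbf R^3$ (basis $i,j,k$). For $R\in SO(3)$, $q_R$ is either of the two elements of $\phi^{-1}(R)$. $\mathbf C=\{a+bi\}\subset\mathbf H$, and every unit quaternion is uniquely $z+wj$ with $z,w\in\mathbf C$, $|z|^2+|w|^2=1$. *)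

theory Defs
  imports "HOL-Analysis.Analysis" "HOL-Combinatorics.Permutations"
begin

text \<open>Square matrices have type \<open>real^'n^'n\<close>; the library's \<open>norm\<close> on this type is the
  Frobenius norm, and \<open>*\<close> would be the componentwise product (the matrix product is \<open>**\<close>).\<close>

section \<open>The bundle $M \to \mathrm{Sym}^+(p)$\<close>

definition Sym_pos :: "(real^'n^'n) set" where
  "Sym_pos = {X. Finite_Cartesian_Product.transpose X = X \<and> (\<forall>v. v \<noteq> 0 \<longrightarrow> v \<bullet> (X *v v) > 0)}"

definition diag :: "real^'n \<Rightarrow> real^'n^'n" where
  "diag d = (\<chi> i j. if i = j then d $ i else 0)"

definition Diag_pos :: "(real^'n^'n) set" where
  "Diag_pos = {diag d | d. \<forall>i. d $ i > 0}"

definition SO :: "(real^'n^'n) set" where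
  "SO = {U. rotation_matrix U}"

definition SR_M :: "((real^'n^'n) \<times> (real^'n^'n)) set" where
  "SR_M = SO \<times> Diag_pos"

fun eigen_comp :: "(real^'n^'n) \<times> (real^'n^'n) \<Rightarrow> real^'n^'n" where
  "eigen_comp (U, D) = U ** D ** Finite_Cartesian_Product.transpose U"

definition fiber :: "real^'n^'n \<Rightarrow> ((real^'n^'n) \<times> (real^'n^'n)) set" where
  "fiber X = {x \<in> SR_M. eigen_comp x = X}"

section \<open>The Riemannian metric, its geodesic distance, and the scaling-rotation distance\<close>

fun g_M :: "real \<Rightarrow> (real^'n^'n) \<times> (real^'n^'n) \<Rightarrow> (real^'n^'n) \<times> (real^'n^'n)
             \<Rightarrow> (real^'n^'n) \<times> (real^'n^'n) \<Rightarrow> real" where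
  "g_M k (U, D) (A1, L1) (A2, L2) =
     - (k / 2) * trace (A1 ** matrix_inv U ** A2 ** matrix_inv U)
     + trace (matrix_inv D ** L1 ** matrix_inv D ** L2)"

text \<open>Riemannian distance: the infimum of the lengths of piecewise \<open>C\<^sup>1\<close> paths inside \<open>SR_M\<close>.
  Velocities are computed in the ambient matrix space, so they are automatically tangent to \<open>SR_M\<close>
  at all but finitely many times. The closed form
  \<open>d_M k (U, D) (V, \<Lambda>)\<^sup>2 = k/2 \<parallel>log (U\<inverse> V)\<parallel>\<^sup>2 + \<parallel>log (D\<inverse> \<Lambda>)\<parallel>\<^sup>2\<close> is a consequence, not the definition.\<close>

definition d_M :: "real \<Rightarrow> (real^'n^'n) \<times> (real^'n^'n) \<Rightarrow> (real^'n^'n) \<times> (real^'n^'n) \<Rightarrow> real" where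
  "d_M k x y = Inf {L. \<exists>\<gamma>. \<gamma> piecewise_C1_differentiable_on {0..1} \<and> path_image \<gamma> \<subseteq> SR_M \<and>
      pathstart \<gamma> = x \<and> pathfinish \<gamma> = y \<and>
      ((\<lambda>t. sqrt (g_M k (\<gamma> t) (vector_derivative \<gamma> (at t)) (vector_derivative \<gamma> (at t))))
         has_integral L) {0..1}}"

definition d_SR :: "real \<Rightarrow> real^'n^'n \<Rightarrow> real^'n^'n \<Rightarrow> real" where
  "d_SR k X Y = Inf {d_M k x y | x y. x \<in> fiber X \<and> y \<in> fiber Y}"

section \<open>Logarithms\<close>

definition mat_exp :: "real^'n^'n \<Rightarrow> real^'n^'n" where
  "mat_exp A = (\<Sum>n. (1 / fact n) *\<^sub>R (((**) A) ^^ n) (mat 1))"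

text \<open>For rotations with eigenvalue \<open>-1\<close> the minimizer is not unique, but its norm is.\<close>

definition log_SO :: "real^'n^'n \<Rightarrow> real^'n^'n" where
  "log_SO R = arg_min norm (\<lambda>A. Finite_Cartesian_Product.transpose A = - A \<and> mat_exp A = R)"

definition log_Diag :: "real^'n^'n \<Rightarrow> real^'n^'n" where
  "log_Diag D = diag (\<chi> i. ln (D $ i $ i))"

section \<open>Strata of $\mathrm{Sym}^+(3)$\<close>

text \<open>The matrices below are symmetric, so all eigenvalues are real.\<close>

definition eigenvalues :: "real^'n^'n \<Rightarrow> real set" where
  "eigenvalues X = {c. \<exists>v. v \<noteq> 0 \<and> X *v v = c *s v}"

definition S_top :: "(real^3^3) set" where
  "S_top = {X \<in> Sym_pos. card (eigenvalues X) = 3}"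

definition S_mid :: "(real^3^3) set" where
  "S_mid = {X \<in> Sym_pos. card (eigenvalues X) = 2}"

definition S_bot :: "(real^3^3) set" where
  "S_bot = {X \<in> Sym_pos. card (eigenvalues X) = 1}"

definition D_J1 :: "(real^3^3) set" where
  "D_J1 = {diag (vector [d1, d2, d2]) | d1 d2. d1 > 0 \<and> d2 > 0 \<and> d1 \<noteq> d2}"

section \<open>Signed permutation matrices\<close>

text \<open>Indices have type \<open>3\<close>, whose elements are \<open>1\<close>, \<open>2\<close>, \<open>3\<close> (with \<open>3 = 0\<close>).
  A group element \<open>g\<close> is represented by its matrix \<open>P\<^sub>g\<close>, which determines the permutation \<open>\<pi>\<^sub>g\<close>.\<close>

definition signed_perm :: "real^3^3 \<Rightarrow> (3 \<Rightarrow> 3) \<Rightarrow> bool" where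
  "signed_perm P \<pi> \<longleftrightarrow> \<pi> permutes UNIV \<and>
     (\<forall>i j. P $ i $ j = (if i = \<pi> j then 1 else 0) \<or> P $ i $ j = - (if i = \<pi> j then 1 else 0))"

definition S3_even :: "(real^3^3) set" where
  "S3_even = {P. det P = 1 \<and> (\<exists>\<pi>. signed_perm P \<pi>)}"

definition perm_of :: "real^3^3 \<Rightarrow> 3 \<Rightarrow> 3" where
  "perm_of P = (THE \<pi>. signed_perm P \<pi>)"

definition perm_act :: "(3 \<Rightarrow> 3) \<Rightarrow> real^3^3 \<Rightarrow> real^3^3" where
  "perm_act \<pi> D = diag (\<chi> i. D $ (inv \<pi> i) $ (inv \<pi> i))"

section \<open>Quaternions\<close>

text \<open>Coordinates with respect to the real basis \<open>1, i, j, k\<close>.\<close>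

datatype quat = Quat (q1: real) (qi: real) (qj: real) (qk: real)

fun qmult :: "quat \<Rightarrow> quat \<Rightarrow> quat" where
  "qmult (Quat a b c d) (Quat a' b' c' d') =
     Quat (a * a' - b * b' - c * c' - d * d')
          (a * b' + b * a' + c * d' - d * c')
          (a * c' - b * d' + c * a' + d * b')
          (a * d' + b * c' - c * b' + d * a')"

fun qcnj :: "quat \<Rightarrow> quat" where
  "qcnj (Quat a b c d) = Quat a (- b) (- c) (- d)"

definition unit_quats :: "quat set" where
  "unit_quats = {q. (q1 q)\<^sup>2 + (qi q)\<^sup>2 + (qj q)\<^sup>2 + (qk q)\<^sup>2 = 1}"

text \<open>The double cover $\phi$, as the matrix of $x \mapsto q x \bar q$ on
  $\mathrm{Im}(\mathbf H) \cong \mathbf R^3$ in the basis \<open>i, j, k\<close>.\<close>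

definition im_quat :: "real^3 \<Rightarrow> quat" where
  "im_quat x = Quat 0 (x $ 1) (x $ 2) (x $ 3)"

definition im_part :: "quat \<Rightarrow> real^3" where
  "im_part q = vector [qi q, qj q, qk q]"

definition rot :: "quat \<Rightarrow> real^3^3" where
  "rot q = matrix (\<lambda>x. im_part (qmult (qmult q (im_quat x)) (qcnj q)))"

text \<open>The quaternion \<open>z + w j\<close>; note that \<open>(c + d i) j = c j + d k\<close>.\<close>

definition quat_of :: "complex \<Rightarrow> complex \<Rightarrow> quat" where
  "quat_of z w = Quat (Re z) (Im z) (Re w) (Im w)"

end

theory Submission
  imports Defs
begin

text \<open>
  The theorem reduces an infimum over pairs of eigen-decompositions to a minimum over a few
  representatives. Two independent ingredients make this work.

  \<^bold>\<open>Closed form of the geodesic distance.\<close> On the product \<open>SO \<times> Diag_pos\<close> one has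
  \<open>d_M k (U, D) (V, \<Lambda>) = sqrt (k * \<theta>\<^sup>2 + \<parallel>log (D\<inverse> \<Lambda>)\<parallel>\<^sup>2)\<close>, where \<open>\<theta>\<close> is the rotation
  angle of \<open>U\<^sup>T V\<close> (theorem \<open>d_M_eq\<close>). A one-parameter rotation combined with a logarithmic
  interpolation of eigenvalues is a path of this length (\<open>geodesic_length\<close>). That no path is shorter
  (\<open>SR_length_ge\<close>) follows by calibration: along any path the angle from the starting point changes
  at most at the rotational speed, so a fixed linear combination of this angle and of the logarithms of
  the eigenvalues has derivative bounded by a constant times the speed, by Cauchy-Schwarz, and
  integrating gives the bound. The angle \<open>arccos c\<close> is not differentiable at \<open>c = 1\<close> and
  \<open>c = -1\<close>; using \<open>arccos (r * c)\<close> with \<open>r < 1\<close> and letting \<open>r\<close> tend to \<open>1\<close> avoids this. Also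
  \<open>\<parallel>log R\<parallel> = sqrt 2 * \<theta>\<close> by Rodrigues' formula (\<open>norm_log_SO\<close>).

  \<^bold>\<open>Structure of the fibers.\<close> Two elements of one fiber differ by a rotation \<open>G\<close> commuting with \<open>D\<close>
  and an even signed permutation (\<open>fiber_param\<close>). Hence the scaling-rotation distance is the
  infimum of \<open>SR_cost k D \<Lambda> (G\<^sup>T U\<^sup>T V H) S\<close> over \<open>G\<close>, \<open>H\<close> in the stabilizers of \<open>D\<close>, \<open>\<Lambda>\<close> and over even
  signed permutations \<open>S\<close> (\<open>d_SR_eq_MinI\<close>). Signed permutations inside the stabilizers can be
  moved from \<open>S\<close> into \<open>G\<close> and \<open>H\<close> (\<open>SR_cost_shift\<close>), so \<open>S\<close> matters only up to double cosets.

  If the eigenvalues of \<open>D\<close> and of \<open>\<Lambda>\<close> are simple, the stabilizers consist of signed permutations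
  and only the minimum over \<open>S\<close> remains. If \<open>D = diag (d\<^sub>1, d\<^sub>2, d\<^sub>2)\<close>, its stabilizer is the
  image under the double cover of the unit quaternions \<open>u + v j\<close> with \<open>u = 0\<close> or \<open>v = 0\<close>. As the
  rotation angle of \<open>q\<close> is \<open>2 arccos \<bar>Re q\<bar>\<close>, the least angle of \<open>G\<^sup>T R\<close> for \<open>R\<close> given by
  \<open>z + w j\<close> is \<open>2 arccos (max \<bar>z\<bar> \<bar>w\<bar>)\<close>, and evaluating this at \<open>R S\<^sup>T\<close> for the quarter turns
  \<open>S\<close> representing the transpositions (13) and (12) produces \<open>\<beta>\<close> and \<open>\<beta>'\<close>. If \<open>\<Lambda>\<close> also has a
  double eigenvalue, its stabilizer changes the phase of \<open>cnj z * w\<close> arbitrarily, which turns the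
  angle for (13) into \<open>\<pi>/4 - \<phi>\<close> and makes (12) equivalent to (13). If \<open>D\<close> is scalar, \<open>G\<close> is arbitrary
  and the angle can be made zero.
\<close>

section \<open>Rotation matrices\<close>

notation Finite_Cartesian_Product.transpose ("_\<^sup>T" [1000] 999)

lemmas mat3_simps =
  vec_eq_iff forall_3 matrix_matrix_mult_def sum_3 Finite_Cartesian_Product.transpose_def vector_3 mat_def

lemma SO_iff: "R \<in> SO \<longleftrightarrow> R ** R\<^sup>T = mat 1 \<and> R\<^sup>T ** R = mat 1 \<and> det R = 1"
  by (auto simp: SO_def rotation_matrix_def orthogonal_matrix_def)

lemma SO_mult: "R \<in> SO \<Longrightarrow> Q \<in> SO \<Longrightarrow> R ** Q \<in> SO"
  by (auto simp: SO_def rotation_matrix_def orthogonal_matrix_mul det_mul)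

lemma SO_transpose: "R \<in> SO \<Longrightarrow> R\<^sup>T \<in> SO"
  by (auto simp: SO_iff)

lemma scaleR_matrix_mult:
  fixes A B :: "real^'n^'n"
  shows "(r *\<^sub>R A) ** B = r *\<^sub>R (A ** B)" "A ** (r *\<^sub>R B) = r *\<^sub>R (A ** B)"
  by (simp_all add: vec_eq_iff matrix_matrix_mult_def sum_distrib_left ac_simps)

lemma matrix_inv_eqI:
  fixes A B :: "real^'n^'n"
  assumes "A ** B = mat 1"
  shows "matrix_inv A = B"
proof -
  have BA: "B ** A = mat 1"
    using assms matrix_left_right_inverse by blast
  show ?thesis
    unfolding matrix_inv_def
  proof (rule some_equality)
    show "A ** B = mat 1 \<and> B ** A = mat 1" using assms BA by simp
    show "C = B" if "A ** C = mat 1 \<and> C ** A = mat 1" for C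
      by (metis BA matrix_mul_assoc matrix_mul_lid matrix_mul_rid that)
  qed
qed

lemma matrix_inv_SO: "R \<in> SO \<Longrightarrow> matrix_inv R = R\<^sup>T"
  by (simp add: SO_iff matrix_inv_eqI)

section \<open>Unit quaternions and rotations\<close>

lemma rot_Quat:
  "rot (Quat a b c d) = vector
     [vector [a\<^sup>2 + b\<^sup>2 - c\<^sup>2 - d\<^sup>2, 2 * (b * c - a * d), 2 * (b * d + a * c)],
      vector [2 * (b * c + a * d), a\<^sup>2 - b\<^sup>2 + c\<^sup>2 - d\<^sup>2, 2 * (c * d - a * b)],
      vector [2 * (b * d - a * c), 2 * (c * d + a * b), a\<^sup>2 - b\<^sup>2 - c\<^sup>2 + d\<^sup>2]]"
  by (simp add: rot_def matrix_def im_part_def im_quat_def mat3_simps axis_def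
        power2_eq_square algebra_simps)

lemma rot_qmult: "rot (qmult p q) = rot p ** rot q"
proof (cases p; cases q)
  fix a b c d a' b' c' d'
  assume "p = Quat a b c d" "q = Quat a' b' c' d'"
  then show ?thesis
    by (simp add: rot_Quat mat3_simps) (intro conjI; simp add: power2_eq_square algebra_simps)
qed

lemma rot_qcnj: "rot (qcnj q) = (rot q)\<^sup>T"
  by (cases q) (simp add: rot_Quat mat3_simps)

lemma unit_quats_Quat: "Quat a b c d \<in> unit_quats \<longleftrightarrow> a\<^sup>2 + b\<^sup>2 + c\<^sup>2 + d\<^sup>2 = 1"
  by (simp add: unit_quats_def)

lemma rot_in_SO:
  assumes "q \<in> unit_quats"
  shows "rot q \<in> SO"
proof -
  obtain a b c d where q: "q = Quat a b c d" by (cases q)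
  have u: "a\<^sup>2 + b\<^sup>2 + c\<^sup>2 + d\<^sup>2 = 1"
    using assms by (simp add: q unit_quats_Quat)
  have "rot q ** (rot q)\<^sup>T = rot (Quat (a\<^sup>2 + b\<^sup>2 + c\<^sup>2 + d\<^sup>2) 0 0 0)"
    by (simp add: rot_qmult[symmetric] rot_qcnj[symmetric] q power2_eq_square algebra_simps)
  then have 1: "rot q ** (rot q)\<^sup>T = mat 1"
    by (simp add: u rot_Quat mat3_simps)
  have "det (rot q) = (a\<^sup>2 + b\<^sup>2 + c\<^sup>2 + d\<^sup>2) ^ 3"
    by (simp add: q rot_Quat det_3 vector_3; algebra)
  with 1 u show ?thesis
    by (simp add: SO_iff matrix_left_right_inverse)
qed

text \<open>A rotation preserves cross products, so each of its rows is the cross product of the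
  other two.\<close>

lemma SO3_cofactor_entries:
  fixes R :: "real^3^3"
  assumes "R \<in> SO"
  shows "R$1$1 = R$2$2 * R$3$3 - R$2$3 * R$3$2" "R$1$2 = R$2$3 * R$3$1 - R$2$1 * R$3$3"
        "R$1$3 = R$2$1 * R$3$2 - R$2$2 * R$3$1" "R$2$1 = R$3$2 * R$1$3 - R$3$3 * R$1$2"
        "R$2$2 = R$3$3 * R$1$1 - R$3$1 * R$1$3" "R$2$3 = R$3$1 * R$1$2 - R$3$2 * R$1$1"
        "R$3$1 = R$1$2 * R$2$3 - R$1$3 * R$2$2" "R$3$2 = R$1$3 * R$2$1 - R$1$1 * R$2$3"
        "R$3$3 = R$1$1 * R$2$2 - R$1$2 * R$2$1"
proof -
  have x: "cross3 (R *v x) (R *v y) = R *v (cross3 x y)" for x y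
    using assms by (simp add: SO_def cross_rotation_matrix)
  have "cross3 (R *v axis 1 1) (R *v axis 2 1) = R *v axis 3 1"
       "cross3 (R *v axis 2 1) (R *v axis 3 1) = R *v axis 1 1"
       "cross3 (R *v axis 3 1) (R *v axis 1 1) = R *v axis 2 1"
    unfolding x by (simp_all add: cross_basis)
  then show "R$1$1 = R$2$2 * R$3$3 - R$2$3 * R$3$2" "R$1$2 = R$2$3 * R$3$1 - R$2$1 * R$3$3"
        "R$1$3 = R$2$1 * R$3$2 - R$2$2 * R$3$1" "R$2$1 = R$3$2 * R$1$3 - R$3$3 * R$1$2"
        "R$2$2 = R$3$3 * R$1$1 - R$3$1 * R$1$3" "R$2$3 = R$3$1 * R$1$2 - R$3$2 * R$1$1"
        "R$3$1 = R$1$2 * R$2$3 - R$1$3 * R$2$2" "R$3$2 = R$1$3 * R$2$1 - R$1$1 * R$2$3"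
        "R$3$3 = R$1$1 * R$2$2 - R$1$2 * R$2$1"
    by (simp_all add: cross3_def matrix_vector_mul_component inner_vec_def sum_3 axis_def vec_eq_iff
         forall_3 vector_3 algebra_simps)
qed

lemma SO3_unit_rows_cols:
  fixes R :: "real^3^3"
  assumes "R \<in> SO"
  shows "(R$i$1)\<^sup>2 + (R$i$2)\<^sup>2 + (R$i$3)\<^sup>2 = 1" "(R$1$i)\<^sup>2 + (R$2$i)\<^sup>2 + (R$3$i)\<^sup>2 = 1"
proof -
  have "(R ** R\<^sup>T) $ i $ i = 1" "(R\<^sup>T ** R) $ i $ i = 1"
    using assms by (simp_all add: SO_iff mat_def)
  then show "(R$i$1)\<^sup>2 + (R$i$2)\<^sup>2 + (R$i$3)\<^sup>2 = 1" "(R$1$i)\<^sup>2 + (R$2$i)\<^sup>2 + (R$3$i)\<^sup>2 = 1"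
    by (simp_all add: matrix_matrix_mult_def Finite_Cartesian_Product.transpose_def sum_3 power2_eq_square)
qed

text \<open>The entries of \<open>rot q\<close> are linear in the products of the coordinates of
  \<open>q\<close>; solving for these products gives the ten hypotheses, so they suffice to
  recognise \<open>R\<close>.\<close>

lemma quat_products_imp_rot:
  fixes R :: "real^3^3"
  assumes
    "4 * a\<^sup>2 = 1 + R$1$1 + R$2$2 + R$3$3" "4 * b\<^sup>2 = 1 + R$1$1 - R$2$2 - R$3$3"
    "4 * c\<^sup>2 = 1 - R$1$1 + R$2$2 - R$3$3" "4 * d\<^sup>2 = 1 - R$1$1 - R$2$2 + R$3$3"
    "4 * (a * b) = R$3$2 - R$2$3" "4 * (a * c) = R$1$3 - R$3$1" "4 * (a * d) = R$2$1 - R$1$2"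
    "4 * (b * c) = R$1$2 + R$2$1" "4 * (b * d) = R$1$3 + R$3$1" "4 * (c * d) = R$2$3 + R$3$2"
  shows "\<exists>q\<in>unit_quats. rot q = R"
proof
  show "Quat a b c d \<in> unit_quats"
    using assms by (simp add: unit_quats_Quat)
  show "rot (Quat a b c d) = R"
    using assms by (simp add: rot_Quat mat3_simps)
qed

lemma scaled_square_root:
  fixes x :: real
  assumes "x > 0"
  obtains s where "s \<noteq> 0" "4 * x * (s * s) = 1"
proof
  show "1 / (2 * sqrt x) \<noteq> 0" "4 * x * (1 / (2 * sqrt x) * (1 / (2 * sqrt x))) = 1"
    using assms by (simp_all add: field_simps)
qed

text \<open>Surjectivity of the double cover. If \<open>R = rot q\<close>, then \<open>4 q
  q\<^sup>T\<close> is a \<open>4 \<times> 4\<close> matrix \<open>K\<close> whose entries are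
  linear in \<open>R\<close>. For arbitrary \<open>R\<close> in \<open>SO(3)\<close> the same matrix
  \<open>K\<close> has rank one and trace \<open>4\<close>, so a column with positive diagonal
  entry, suitably scaled, is the required quaternion.\<close>

lemma rot_surj:
  fixes R :: "real^3^3"
  assumes "R \<in> SO"
  obtains q where "q \<in> unit_quats" "rot q = R"
proof -
  note e = SO3_cofactor_entries[OF assms] SO3_unit_rows_cols[OF assms, of 1] SO3_unit_rows_cols[OF assms, of 2]
    SO3_unit_rows_cols[OF assms, of 3]
  define r11 where "r11 = R$1$1"
  define r12 where "r12 = R$1$2"
  define r13 where "r13 = R$1$3"
  define r21 where "r21 = R$2$1"
  define r22 where "r22 = R$2$2"
  define r23 where "r23 = R$2$3"
  define r31 where "r31 = R$3$1"
  define r32 where "r32 = R$3$2"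
  define r33 where "r33 = R$3$3"
  note defs = r11_def[symmetric] r12_def[symmetric] r13_def[symmetric] r21_def[symmetric] r22_def[symmetric]
     r23_def[symmetric] r31_def[symmetric] r32_def[symmetric] r33_def[symmetric]
  note e' = e[unfolded defs]
  define K where "K = (\<lambda>i j. [
    [1 + r11 + r22 + r33, r32 - r23, r13 - r31, r21 - r12],
    [r32 - r23, 1 + r11 - r22 - r33, r12 + r21, r13 + r31],
    [r13 - r31, r12 + r21, 1 - r11 + r22 - r33, r23 + r32],
    [r21 - r12, r13 + r31, r23 + r32, 1 - r11 - r22 + r33]] ! i ! (j::nat))"
  \<comment> \<open>The vanishing of the \<open>2 \<times> 2\<close> minors is a consequence of the cofactor and unit-length relations.\<close>
  have rank1: "\<forall>n\<in>{0,1,2,3}. \<forall>i\<in>{0,1,2,3}. \<forall>j\<in>{0,1,2,3}. K n i * K n j = K n n * K i j"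
    unfolding K_def
    apply (simp add: numeral_2_eq_2 numeral_3_eq_3)
    using e' by algebra
  have "K 0 0 + K 1 1 + K 2 2 + K 3 3 = 4"
    by (simp add: K_def)
  then obtain n where n: "n \<in> {0,1,2,3}" "K n n > 0"
    by (metis add_nonpos_nonpos insert_iff not_less zero_less_numeral)
  obtain s where s: "s \<noteq> 0" "4 * K n n * (s * s) = 1"
    using scaled_square_root[OF n(2)] by blast
  have q: "4 * ((s * K n i) * (s * K n j)) = K i j" if "i \<in> {0,1,2,3}" "j \<in> {0,1,2,3}" for i j
  proof -
    have "4 * ((s * K n i) * (s * K n j)) = 4 * (s * s) * (K n i * K n j)" by (simp add: algebra_simps)
    also have "\<dots> = 4 * (s * s) * (K n n * K i j)"
      using rank1 n(1) that by metis
    also have "\<dots> = (4 * K n n * (s * s)) * K i j" by (simp add: algebra_simps)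
    finally show ?thesis using s by simp
  qed
  have "\<exists>q\<in>unit_quats. rot q = R"
    by (rule quat_products_imp_rot[of "s * K n 0" _ "s * K n 1" "s * K n 2" "s * K n 3"];
        simp only: power2_eq_square q insert_iff simp_thms; simp add: K_def defs)
  then show ?thesis using that by blast
qed

section \<open>Rotation angle, Rodrigues' formula and the logarithm\<close>

definition rot_angle :: "real^3^3 \<Rightarrow> real" where
  "rot_angle R = arccos ((trace R - 1) / 2)"

lemma trace_rot:
  assumes "q \<in> unit_quats"
  shows "trace (rot q) = 4 * (q1 q)\<^sup>2 - 1"
  using assms by (cases q) (simp add: unit_quats_Quat trace_def sum_3 rot_Quat vector_3)

lemma abs_q1_le_1: "q \<in> unit_quats \<Longrightarrow> \<bar>q1 q\<bar> \<le> 1"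
  by (cases q) (simp add: unit_quats_Quat abs_square_le_1[symmetric],
     smt (verit) zero_le_power2)

text \<open>The trace of \<open>rot q\<close> is \<open>4 (Re q)\<^sup>2 - 1\<close>, and \<open>2
  x\<^sup>2 - 1\<close> is the cosine of \<open>2 arccos x\<close>.\<close>

lemma rot_angle_rot:
  assumes "q \<in> unit_quats"
  shows "rot_angle (rot q) = 2 * arccos \<bar>q1 q\<bar>"
proof -
  have a: "\<bar>q1 q\<bar> \<le> 1" by (rule abs_q1_le_1[OF assms])
  have "(trace (rot q) - 1) / 2 = cos (2 * arccos \<bar>q1 q\<bar>)"
    using a by (simp add: trace_rot[OF assms] cos_double_cos cos_arccos_abs field_simps)
  moreover have "arccos \<bar>q1 q\<bar> \<le> pi / 2"
    using a arccos_le_pi2 by simp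
  ultimately show ?thesis
    unfolding rot_angle_def using a by (simp add: arccos_cos arccos_lbound)
qed

lemma trace_SO_bounds:
  fixes R :: "real^3^3"
  assumes "R \<in> SO"
  shows "-1 \<le> (trace R - 1) / 2" "(trace R - 1) / 2 \<le> 1"
proof -
  obtain q where q: "q \<in> unit_quats" "rot q = R" by (rule rot_surj[OF assms])
  have "(q1 q)\<^sup>2 \<le> 1" using abs_q1_le_1[OF q(1)] by (simp add: abs_square_le_1)
  then show "-1 \<le> (trace R - 1) / 2" "(trace R - 1) / 2 \<le> 1"
    using trace_rot[OF q(1)] q(2) by auto
qed

lemma rot_angle_bounds: "R \<in> SO \<Longrightarrow> 0 \<le> rot_angle R" "R \<in> SO \<Longrightarrow> rot_angle R \<le> pi"
  and cos_rot_angle: "R \<in> SO \<Longrightarrow> cos (rot_angle R) = (trace R - 1) / 2"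
  using trace_SO_bounds[of R] by (auto simp: rot_angle_def arccos_lbound arccos_ubound cos_arccos)

lemma rot_angle_mult_commute: "rot_angle (A ** B) = rot_angle (B ** A)"
  unfolding rot_angle_def by (subst trace_mul_sym) simp

text \<open>This is the matrix of \<open>x \<mapsto> n \<times> x\<close>.\<close>

definition skew :: "real^3 \<Rightarrow> real^3^3" where
  "skew n = vector [vector [0, - n$3, n$2], vector [n$3, 0, - n$1], vector [- n$2, n$1, 0]]"

lemma skew_transpose: "(skew n)\<^sup>T = - skew n"
  by (simp add: skew_def mat3_simps)

lemma skew_scaleR: "skew (t *\<^sub>R n) = t *\<^sub>R skew n"
  by (simp add: skew_def mat3_simps)

lemma norm_skew: "norm (skew n) = sqrt 2 * norm n"
  by (simp add: norm_eq_sqrt_inner inner_vec_def sum_3 skew_def vector_3 real_sqrt_mult[symmetric])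

lemma norm_3_eq_1: "norm (n :: real^3) = 1 \<longleftrightarrow> (n$1)\<^sup>2 + (n$2)\<^sup>2 + (n$3)\<^sup>2 = 1"
  by (simp add: norm_eq_1 inner_vec_def sum_3 power2_eq_square)

lemma antisymmetric_imp_skew:
  fixes A :: "real^3^3"
  assumes "A\<^sup>T = - A"
  shows "\<exists>a. A = skew a"
proof
  have anti: "A $ j $ i = - A $ i $ j" for i j
    using arg_cong[OF assms, of "\<lambda>B. B $ i $ j"] by (simp add: Finite_Cartesian_Product.transpose_def)
  show "A = skew (vector [A$3$2, A$1$3, A$2$1])"
    using anti[of 1 1] anti[of 2 2] anti[of 3 3] anti[of 2 1] anti[of 3 2] anti[of 1 3]
    by (simp add: skew_def vec_eq_iff forall_3 vector_3)
qed

lemma antisymmetric_axis_angle: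
  fixes A :: "real^3^3"
  assumes "A\<^sup>T = - A"
  obtains n t where "norm n = 1" "t \<ge> 0" "A = t *\<^sub>R skew n"
proof -
  obtain a where a: "A = skew a" using antisymmetric_imp_skew[OF assms] by blast
  show ?thesis
  proof (cases "a = 0")
    case True
    show ?thesis
      by (rule that[of "axis 1 1" 0]) (use True a skew_scaleR[of 0 a] in auto)
  next
    case False
    show ?thesis
      by (rule that[of "a /\<^sub>R norm a" "norm a"]) (use False a in \<open>auto simp: skew_scaleR\<close>)
  qed
qed

definition rodrigues :: "real^3 \<Rightarrow> real \<Rightarrow> real^3^3" where
  "rodrigues n t = mat 1 + sin t *\<^sub>R skew n + (1 - cos t) *\<^sub>R (skew n ** skew n)"

lemma skew_cube:
  assumes "norm n = 1"
  shows "skew n ** (skew n ** skew n) = - skew n"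
proof -
  have "skew n ** (skew n ** skew n) = - (n \<bullet> n) *\<^sub>R skew n"
    by (simp add: skew_def mat3_simps inner_vec_def algebra_simps)
  then show ?thesis using assms by (simp add: norm_eq_1)
qed

text \<open>Half angles pass to quaternions: the rotation by \<open>t\<close> about \<open>n\<close>
  is covered by \<open>cos (t/2) + sin (t/2) n\<close>.\<close>

lemma rodrigues_eq_rot:
  assumes "norm n = 1"
  shows "rodrigues n t = rot (Quat (cos (t/2)) (sin (t/2) * n$1) (sin (t/2) * n$2) (sin (t/2) * n$3))"
proof -
  have n: "(n$1)\<^sup>2 + (n$2)\<^sup>2 + (n$3)\<^sup>2 = 1" using assms norm_3_eq_1 by blast
  define c where "c = cos (t/2)"
  define s where "s = sin (t/2)"
  have cs: "c\<^sup>2 + s\<^sup>2 = 1" by (simp add: c_def s_def)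
  have t: "sin t = 2 * s * c" "cos t = c\<^sup>2 - s\<^sup>2"
    using sin_double[of "t/2"] cos_double[of "t/2"] by (simp_all add: c_def s_def)
  \<comment> \<open>Writing \<open>1\<close> as the squared norm of the quaternion makes both sides homogeneous.\<close>
  have one: "(mat 1 :: real^3^3) = mat (c\<^sup>2 + s\<^sup>2 * ((n$1)\<^sup>2 + (n$2)\<^sup>2 + (n$3)\<^sup>2))"
    and s2: "1 - (c\<^sup>2 - s\<^sup>2) = 2 * s\<^sup>2"
    using n cs by simp_all
  show ?thesis
    unfolding rodrigues_def t c_def[symmetric] s_def[symmetric] one s2
    by (simp add: skew_def rot_Quat mat3_simps power2_eq_square algebra_simps)
qed

lemma unit_quats_axis_angle:
  assumes "norm (n :: real^3) = 1"
  shows "Quat (cos t) (sin t * n$1) (sin t * n$2) (sin t * n$3) \<in> unit_quats"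
proof -
  have "(n$1)\<^sup>2 + (n$2)\<^sup>2 + (n$3)\<^sup>2 = 1" using assms norm_3_eq_1 by blast
  moreover have "(cos t)\<^sup>2 + (sin t)\<^sup>2 = 1" by simp
  ultimately show ?thesis unfolding unit_quats_Quat by algebra
qed

lemma rodrigues_in_SO: "norm n = 1 \<Longrightarrow> rodrigues n t \<in> SO"
  by (simp add: rodrigues_eq_rot rot_in_SO unit_quats_axis_angle)

lemma cos_rot_angle_rodrigues:
  assumes "norm n = 1"
  shows "cos (rot_angle (rodrigues n t)) = cos t"
proof -
  have "trace (rodrigues n t) = 4 * (cos (t/2))\<^sup>2 - 1"
    by (simp add: rodrigues_eq_rot[OF assms] trace_rot unit_quats_axis_angle[OF assms])
  moreover have "cos t = 2 * (cos (t/2))\<^sup>2 - 1"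
    using cos_double_cos[of "t/2"] by simp
  ultimately show ?thesis
    by (simp add: cos_rot_angle[OF rodrigues_in_SO[OF assms]])
qed

text \<open>Of the two quaternions over \<open>R\<close> the one with nonnegative real part
  \<open>a\<close> is \<open>cos (t/2) + sin (t/2) n\<close> with \<open>t = 2 arccos a\<close> in
  \<open>[0, \<pi>]\<close>; the axis is its normalized imaginary part, or any unit vector when this
  part vanishes.\<close>

lemma SO3_axis_angle:
  fixes R :: "real^3^3"
  assumes "R \<in> SO"
  obtains n where "norm n = 1" "R = rodrigues n (rot_angle R)"
proof -
  obtain q where q: "q \<in> unit_quats" "rot q = R" by (rule rot_surj[OF assms])
  obtain a b c d where abcd: "a \<ge> 0" "Quat a b c d \<in> unit_quats" "rot (Quat a b c d) = R"
  proof (cases q)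
    case (Quat a b c d)
    show ?thesis
    proof (cases "a \<ge> 0")
      case True then show ?thesis using that Quat q by blast
    next
      case False
      then show ?thesis using that[of "-a" "-b" "-c" "-d"] Quat q
        by (simp add: rot_Quat unit_quats_Quat)
    qed
  qed
  have u: "a\<^sup>2 + b\<^sup>2 + c\<^sup>2 + d\<^sup>2 = 1" and a1: "a \<le> 1"
    using abcd abs_q1_le_1[OF abcd(2)] by (auto simp: unit_quats_Quat)
  have half: "rot_angle R / 2 = arccos a"
    using rot_angle_rot[OF abcd(2)] abcd by simp
  define v :: "real^3" where "v = vector [b, c, d]"
  have vv: "norm v = sqrt (1 - a\<^sup>2)"
    using u by (simp add: norm_eq_sqrt_inner inner_vec_def sum_3 v_def vector_3 power2_eq_square)
  obtain n where n: "norm n = 1" "v = norm v *\<^sub>R n"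
  proof (cases "v = 0")
    case True then show ?thesis using that[of "axis 1 1"] by simp
  next
    case False then show ?thesis using that[of "v /\<^sub>R norm v"] by simp
  qed
  have "b = norm v * n$1" "c = norm v * n$2" "d = norm v * n$3"
    using n(2) unfolding v_def vec_eq_iff forall_3 by (simp_all add: vector_3)
  moreover have "sin (arccos a) = norm v" "cos (arccos a) = a"
    using abcd(1) a1 by (simp_all add: sin_arccos vv)
  ultimately have "R = rodrigues n (rot_angle R)"
    using abcd(3) by (simp add: rodrigues_eq_rot[OF n(1)] half)
  then show ?thesis using that n(1) by blast
qed

text \<open>The relation \<open>N\<^sup>3 = -N\<close> makes the powers of \<open>N = skew n\<close>
  alternate between multiples of \<open>N\<close> and of \<open>N\<^sup>2\<close>, so the
  exponential series splits into the sine and the cosine series. The zeroth term does not follow the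
  pattern and is corrected separately.\<close>

lemma funpow_mult_skew:
  assumes "norm n = 1"
  shows "(1 / fact m) *\<^sub>R (((**) (t *\<^sub>R skew n)) ^^ m) (mat 1)
       = (sin_coeff m * t ^ m) *\<^sub>R skew n - (cos_coeff m * t ^ m) *\<^sub>R (skew n ** skew n)
         + (if m = 0 then mat 1 + skew n ** skew n else 0)"
proof -
  let ?N = "skew n"
  note smul = scaleR_matrix_mult
  have cube: "?N ** (?N ** ?N) = - ?N" by (rule skew_cube[OF assms])
  have neg: "?N ** (- B) = - (?N ** B)" for B :: "real^3^3"
    using smul(2)[of ?N "-1" B] by simp
  have pow: "(((**) (t *\<^sub>R ?N)) ^^ m) (mat 1) = t ^ m *\<^sub>R (((**) ?N) ^^ m) (mat 1)" for m
    by (induction m) (simp_all add: smul mult.commute)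
  have "(((**) ?N) ^^ (2 * j + 1)) (mat 1) = (-1) ^ j *\<^sub>R ?N
      \<and> (((**) ?N) ^^ (2 * j + 2)) (mat 1) = (-1) ^ j *\<^sub>R (?N ** ?N)" for j
    by (induction j) (simp_all add: smul cube neg)
  then have odd: "(((**) ?N) ^^ (2 * j + 1)) (mat 1) = (-1) ^ j *\<^sub>R ?N"
    and even: "(((**) ?N) ^^ (2 * j + 2)) (mat 1) = (-1) ^ j *\<^sub>R (?N ** ?N)" for j
    by blast+
  consider "m = 0" | j where "m = 2 * j + 1" | j where "m = 2 * j + 2"
    by (metis add.commute add_2_eq_Suc' even_Suc evenE not0_implies_Suc oddE plus_1_eq_Suc mult_Suc_right)
  then show ?thesis
  proof cases
    case 1 then show ?thesis by (simp add: sin_coeff_def cos_coeff_def)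
  next
    case (2 j)
    have "sin_coeff m = (-1) ^ j / fact m" "cos_coeff m = 0"
      using 2 by (simp_all add: sin_coeff_def cos_coeff_def)
    then show ?thesis unfolding pow using odd[of j] 2 by simp
  next
    case (3 j)
    have "sin_coeff m = 0" "cos_coeff m = - ((-1) ^ j / fact m)"
      using 3 by (simp_all add: sin_coeff_def cos_coeff_def)
    then show ?thesis unfolding pow using even[of j] 3 by simp
  qed
qed

lemma mat_exp_skew:
  assumes "norm n = 1"
  shows "mat_exp (t *\<^sub>R skew n) = rodrigues n t"
proof -
  let ?N = "skew n"
  have s: "(\<lambda>m. (sin_coeff m * t ^ m) *\<^sub>R ?N) sums (sin t *\<^sub>R ?N)"
    using sums_scaleR_left[OF sin_converges[of t]] by simp
  have c: "(\<lambda>m. (cos_coeff m * t ^ m) *\<^sub>R (?N ** ?N)) sums (cos t *\<^sub>R (?N ** ?N))"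
    using sums_scaleR_left[OF cos_converges[of t]] by simp
  have "(\<lambda>m. (1 / fact m) *\<^sub>R (((**) (t *\<^sub>R ?N)) ^^ m) (mat 1)) sums
      (sin t *\<^sub>R ?N - cos t *\<^sub>R (?N ** ?N) + (mat 1 + ?N ** ?N))"
    unfolding funpow_mult_skew[OF assms]
    using sums_add[OF sums_diff[OF s c] sums_single[of 0 "\<lambda>_. mat 1 + ?N ** ?N"]] by simp
  then show ?thesis
    unfolding mat_exp_def by (simp add: sums_unique[symmetric] rodrigues_def algebra_simps)
qed

text \<open>The rotation angle lies in \<open>[0, \<pi>]\<close>, so it gives a logarithm; any other
  logarithm \<open>t *\<^sub>R skew m\<close> with \<open>t \<ge> 0\<close> has the same value of
  \<open>cos t\<close> by comparison of traces, hence \<open>t\<close> is at least as large.\<close>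

lemma norm_log_SO:
  fixes R :: "real^3^3"
  assumes "R \<in> SO"
  shows "norm (log_SO R) = sqrt 2 * rot_angle R"
proof -
  let ?P = "\<lambda>A. A\<^sup>T = - A \<and> mat_exp A = R"
  obtain n where n: "norm n = 1" "R = rodrigues n (rot_angle R)"
    by (rule SO3_axis_angle[OF assms])
  let ?A = "rot_angle R *\<^sub>R skew n"
  have A: "?P ?A"
    using n mat_exp_skew[OF n(1), of "rot_angle R"]
    by (simp add: skew_scaleR[symmetric] skew_transpose)
  have normA: "norm ?A = sqrt 2 * rot_angle R"
    using n rot_angle_bounds[OF assms] by (simp add: norm_skew)
  have least: "norm ?A \<le> norm B" if "?P B" for B
  proof -
    obtain m t where B: "norm m = 1" "t \<ge> 0" "B = t *\<^sub>R skew m"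
      using antisymmetric_axis_angle \<open>?P B\<close> by blast
    have R: "R = rodrigues m t" using \<open>?P B\<close> B mat_exp_skew by blast
    have "cos (rot_angle R) = cos t"
      unfolding R by (rule cos_rot_angle_rodrigues[OF B(1)])
    then have "rot_angle R \<le> t"
      using rot_angle_bounds[OF assms] B(2)
      by (metis arccos_cos linorder_le_cases order_trans)
    then show ?thesis
      unfolding normA using B by (simp add: norm_skew)
  qed
  have "is_arg_min norm ?P ?A"
    unfolding is_arg_min_linorder using A least by blast
  then have "is_arg_min norm ?P (log_SO R)"
    unfolding log_SO_def arg_min_def by (rule someI)
  then have "?P (log_SO R)" "norm (log_SO R) \<le> norm ?A"
    unfolding is_arg_min_linorder using A by blast+
  then show ?thesis using least normA by force
qed

section \<open>Diagonal matrices\<close>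

lemma diag_nth: "diag d $ i $ j = (if i = j then d $ i else 0)"
  by (simp add: diag_def)

lemma diag_inject [simp]: "diag a = diag b \<longleftrightarrow> a = b"
  by (metis diag_nth vec_eq_iff)

lemma matrix_mult_diag_nth: "(A ** diag d) $ i $ j = A $ i $ j * d $ j"
  by (simp add: matrix_matrix_mult_def diag_nth if_distrib cong: if_cong)

lemma diag_mult_matrix_nth: "(diag d ** A) $ i $ j = d $ i * A $ i $ j"
  by (simp add: matrix_matrix_mult_def diag_nth if_distrib if_distribR sum.delta cong: if_cong)

lemma diag_mult_diag: "diag a ** diag b = diag (\<chi> i. a $ i * b $ i)"
  by (simp add: vec_eq_iff diag_mult_matrix_nth) (simp add: diag_nth)

lemma matrix_inv_diag: "(\<And>i. d $ i \<noteq> 0) \<Longrightarrow> matrix_inv (diag d) = diag (\<chi> i. inverse (d $ i))"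
  by (rule matrix_inv_eqI) (simp add: diag_mult_diag, simp add: diag_def mat_def vec_eq_iff)

lemma norm_diag: "norm (diag d) = norm d"
  by (simp add: norm_eq_sqrt_inner inner_vec_def diag_nth if_distrib if_distribR cong: if_cong)

lemma Diag_pos_iff: "D \<in> Diag_pos \<longleftrightarrow> (\<exists>d. D = diag d \<and> (\<forall>i. d $ i > 0))"
  by (auto simp: Diag_pos_def)

definition ln_vec :: "real^'n \<Rightarrow> real^'n" where
  "ln_vec d = (\<chi> i. ln (d $ i))"

lemma log_Diag_diag: "log_Diag (diag d) = diag (ln_vec d)"
  by (simp add: log_Diag_def ln_vec_def diag_nth)

lemma log_Diag_quotient:
  assumes "\<And>i. d $ i > 0" "\<And>i. l $ i > 0"
  shows "log_Diag (matrix_inv (diag d) ** diag l) = diag (ln_vec l - ln_vec d)"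
proof -
  have "d $ i \<noteq> 0" "l $ i \<noteq> 0" for i using assms(1)[of i] assms(2)[of i] by simp_all
  then show ?thesis
    using assms
    by (simp add: matrix_inv_diag diag_mult_diag log_Diag_diag)
       (simp add: ln_vec_def vec_eq_iff ln_mult ln_inverse)
qed

lemma matrix_inv_diag_mult_in_Diag:
  assumes "D \<in> Diag_pos" "L \<in> Diag_pos"
  shows "\<exists>a. matrix_inv D ** L = diag a"
proof -
  obtain d l where dl: "D = diag d" "\<forall>i. d $ i > 0" "L = diag l"
    using assms by (auto simp: Diag_pos_iff)
  then have "d $ i \<noteq> 0" for i by (metis less_irrefl)
  then show ?thesis using dl by (auto simp: matrix_inv_diag diag_mult_diag)
qed

section \<open>The Riemannian distance\<close>

lemma trace_transpose_mult: "trace (A\<^sup>T ** B) = A \<bullet> (B :: real^'n^'n)"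
  unfolding trace_def matrix_matrix_mult_def inner_vec_def Finite_Cartesian_Product.transpose_def
  by simp (rule sum.swap)

text \<open>For \<open>A = skew b ** U\<close> the derivative of the cosine \<open>c\<close> of the
  angle is \<open>trace (skew b ** R) / 2\<close>, so this says that \<open>c\<close> moves at most
  at rate \<open>\<bar>b\<bar> * sqrt (1 - c\<^sup>2)\<close>. For \<open>R\<close> covered by
  \<open>x + p\<close>, with \<open>x\<close> real and \<open>p\<close> imaginary, the trace is
  \<open>-4 x (b \<bullet> p)\<close>, while \<open>1 - c\<^sup>2 = 4 x\<^sup>2
  \<bar>p\<bar>\<^sup>2\<close>; it is therefore an instance of Cauchy-Schwarz.\<close>

lemma trace_skew_rotation:
  assumes "R \<in> SO"
  shows "(trace (skew b ** R) / 2)\<^sup>2 \<le> (norm b)\<^sup>2 * (1 - ((trace R - 1) / 2)\<^sup>2)"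
proof -
  obtain q where q: "q \<in> unit_quats" "rot q = R" by (rule rot_surj[OF assms])
  obtain x u v w where Q: "q = Quat x u v w" by (cases q)
  define p :: "real^3" where "p = vector [u, v, w]"
  have unit: "x\<^sup>2 + u\<^sup>2 + v\<^sup>2 + w\<^sup>2 = 1" using q(1) by (simp add: Q unit_quats_Quat)
  have np: "(norm p)\<^sup>2 = 1 - x\<^sup>2"
    using unit unfolding power2_norm_eq_inner by (simp add: p_def inner_vec_def sum_3 vector_3 power2_eq_square)
  have "trace (skew b ** R) / 2 = - 2 * x * (b \<bullet> p)"
    by (simp add: q(2)[symmetric] Q rot_Quat skew_def trace_def matrix_matrix_mult_def sum_3 vector_3
         inner_vec_def p_def; simp add: field_simps)
  then have "(trace (skew b ** R) / 2)\<^sup>2 = (2 * x)\<^sup>2 * (b \<bullet> p)\<^sup>2"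
    by (simp add: power_mult_distrib)
  also have "\<dots> \<le> (2 * x)\<^sup>2 * ((norm b)\<^sup>2 * (norm p)\<^sup>2)"
    using Cauchy_Schwarz_ineq[of b p] by (intro mult_left_mono) (simp_all add: power2_norm_eq_inner)
  also have "\<dots> = (norm b)\<^sup>2 * (1 - ((trace R - 1) / 2)\<^sup>2)"
  proof -
    have tr: "(trace R - 1) / 2 = 2 * x\<^sup>2 - 1" using trace_rot[OF q(1)] unfolding q(2) by (simp add: Q)
    show ?thesis unfolding np tr by (simp add: power2_eq_square algebra_simps)
  qed
  finally show ?thesis .
qed

lemma trace_scaleR: "trace (r *\<^sub>R A) = r * trace A"
  by (simp add: trace_def sum_distrib_left)

lemma trace_skew_square: "trace (skew b ** skew b) = - 2 * (norm b)\<^sup>2"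
  unfolding power2_norm_eq_inner
  by (simp add: skew_def trace_def matrix_matrix_mult_def sum_3 vector_3 inner_vec_def)

text \<open>For a tangent vector with rotational velocity \<open>skew b\<close> the squared speed is
  that of a Euclidean product: \<open>k \<bar>b\<bar>\<^sup>2\<close> plus the squared velocity of
  the logarithms of the eigenvalues.\<close>

lemma g_M_skew_diag:
  assumes "U \<in> SO" "\<And>i. d $ i > 0" "A ** U\<^sup>T = skew b"
  shows "g_M k (U, diag d) (A, diag m) (A, diag m) = k * (norm b)\<^sup>2 + (norm (\<chi> i. m $ i / d $ i))\<^sup>2"
proof -
  have "d $ i \<noteq> 0" for i using assms(2)[of i] by simp
  then have D: "matrix_inv (diag d) ** diag m ** matrix_inv (diag d) ** diag m = diag (\<chi> i. (m $ i / d $ i)\<^sup>2)"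
    by (simp add: matrix_inv_diag diag_mult_diag field_simps power2_eq_square)
  have U: "A ** matrix_inv U ** A ** matrix_inv U = skew b ** skew b"
    using assms by (simp add: matrix_inv_SO) (metis matrix_mul_assoc)
  have "trace (diag (\<chi> i. (m $ i / d $ i)\<^sup>2)) = (norm (\<chi> i. m $ i / d $ i))\<^sup>2"
    unfolding power2_norm_eq_inner by (simp add: trace_def diag_nth inner_vec_def power2_eq_square)
  then show ?thesis by (simp add: D U trace_skew_square)
qed

lemma vec_vec_has_real_derivative:
  fixes u :: "real \<Rightarrow> real^'n^'m"
  assumes "(u has_vector_derivative a) (at t)"
  shows "((\<lambda>s. u s $ i $ j) has_real_derivative a $ i $ j) (at t)"
proof -
  have "bounded_linear (\<lambda>x::real^'n^'m. x $ i $ j)"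
    by (rule bounded_linear_compose[OF bounded_linear_vec_nth bounded_linear_vec_nth])
  from bounded_linear.has_vector_derivative[OF this assms]
  show ?thesis by (simp add: has_real_derivative_iff_has_vector_derivative)
qed

lemma DERIV_locally_const:
  fixes f :: "real \<Rightarrow> real"
  assumes "(f has_real_derivative f') (at t)" "0 < t" "t < 1" "\<And>s. 0 < s \<Longrightarrow> s < 1 \<Longrightarrow> f s = c"
  shows "f' = 0"
proof -
  have "(f has_real_derivative 0) (at t)"
    by (rule has_field_derivative_transform_within_open[of "\<lambda>_. c" _ _ "{0<..<1}"])
       (use assms in auto)
  then show ?thesis using DERIV_unique assms(1) by blast
qed

text \<open>Differentiating \<open>U ** U\<^sup>T = mat 1\<close> and the vanishing of the
  off-diagonal entries of \<open>D\<close> along the curve shows that its velocity is tangent to the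
  bundle.\<close>

lemma SR_M_velocity:
  fixes \<gamma> :: "real \<Rightarrow> (real^3^3) \<times> (real^3^3)"
  assumes der: "(\<gamma> has_vector_derivative (A, L)) (at t)"
    and t: "0 < t" "t < 1"
    and M: "\<And>s. 0 < s \<Longrightarrow> s < 1 \<Longrightarrow> \<gamma> s \<in> SR_M"
  obtains b m where "A ** (fst (\<gamma> t))\<^sup>T = skew b" "L = diag m"
proof -
  have u: "((\<lambda>s. fst (\<gamma> s)) has_vector_derivative A) (at t)"
    and e: "((\<lambda>s. snd (\<gamma> s)) has_vector_derivative L) (at t)"
    using bounded_linear.has_vector_derivative[OF bounded_linear_fst der]
          bounded_linear.has_vector_derivative[OF bounded_linear_snd der] by simp_all
  have "L $ i $ j = 0" if "i \<noteq> j" for i j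
  proof (rule DERIV_locally_const[OF vec_vec_has_real_derivative[OF e] t])
    show "snd (\<gamma> s) $ i $ j = 0" if "0 < s" "s < 1" for s
      using M[OF that] \<open>i \<noteq> j\<close> by (cases "\<gamma> s") (auto simp: SR_M_def Diag_pos_iff diag_nth)
  qed
  then have L: "L = diag (\<chi> i. L $ i $ i)"
    by (simp add: vec_eq_iff diag_nth)
  let ?u = "fst (\<gamma> t)"
  have "(\<Sum>k\<in>UNIV. A $ i $ k * ?u $ j $ k + A $ j $ k * ?u $ i $ k) = 0" for i j
  proof (rule DERIV_locally_const[OF _ t])
    show "((\<lambda>s. \<Sum>k\<in>UNIV. fst (\<gamma> s) $ i $ k * fst (\<gamma> s) $ j $ k) has_real_derivative
        (\<Sum>k\<in>UNIV. A $ i $ k * ?u $ j $ k + A $ j $ k * ?u $ i $ k)) (at t)"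
      by (intro DERIV_sum DERIV_mult vec_vec_has_real_derivative u)
    fix s :: real assume "0 < s" "s < 1"
    then have "fst (\<gamma> s) \<in> SO" using M[of s] by (cases "\<gamma> s") (auto simp: SR_M_def)
    then have "(fst (\<gamma> s) ** (fst (\<gamma> s))\<^sup>T) $ i $ j = mat 1 $ i $ j" by (simp add: SO_iff)
    then show "(\<Sum>k\<in>UNIV. fst (\<gamma> s) $ i $ k * fst (\<gamma> s) $ j $ k) = mat 1 $ i $ j"
      by (simp add: matrix_matrix_mult_def Finite_Cartesian_Product.transpose_def)
  qed
  then have "(A ** ?u\<^sup>T)\<^sup>T = - (A ** ?u\<^sup>T)"
    by (simp add: vec_eq_iff matrix_matrix_mult_def Finite_Cartesian_Product.transpose_def sum.distrib
         eq_neg_iff_add_eq_0 add.commute)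
  then show ?thesis using antisymmetric_imp_skew L that by blast
qed

text \<open>The derivative of \<open>arccos (r * c)\<close>. As \<open>r\<^sup>2 (1 - c\<^sup>2)
  \<le> 1 - (r c)\<^sup>2\<close>, shrinking the argument by \<open>r < 1\<close> does not increase
  the rate of change of the angle, and it keeps the argument away from the endpoints, where
  \<open>arccos\<close> has infinite slope.\<close>

lemma shrunk_arccos_speed:
  fixes c c' r w :: real
  assumes "0 < r" "r < 1" "\<bar>c\<bar> \<le> 1" "w \<ge> 0" "c'\<^sup>2 \<le> w\<^sup>2 * (1 - c\<^sup>2)"
  shows "(r * c') * inverse (- sqrt (1 - (r * c)\<^sup>2)) \<le> w"
proof -
  have c2: "c\<^sup>2 \<le> 1" using assms(3) by (simp add: abs_square_le_1)
  have r2: "0 < r\<^sup>2" "r\<^sup>2 < 1" using assms by (simp_all add: power_less_one_iff)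
  have "r\<^sup>2 * c\<^sup>2 \<le> r\<^sup>2 * 1" using c2 r2 by (intro mult_left_mono) auto
  then have rc: "(r * c)\<^sup>2 < 1" using r2 unfolding power_mult_distrib by linarith
  define q where "q = sqrt (1 - (r * c)\<^sup>2)"
  have q: "q > 0" "q\<^sup>2 = 1 - (r * c)\<^sup>2" using rc by (simp_all add: q_def)
  have "(r * c')\<^sup>2 \<le> (w * q)\<^sup>2"
  proof -
    have "r\<^sup>2 * c'\<^sup>2 \<le> r\<^sup>2 * (w\<^sup>2 * (1 - c\<^sup>2))" using assms r2 by (intro mult_left_mono) auto
    also have "\<dots> = w\<^sup>2 * (r\<^sup>2 - r\<^sup>2 * c\<^sup>2)" by (simp add: algebra_simps)
    also have "\<dots> \<le> w\<^sup>2 * (1 - r\<^sup>2 * c\<^sup>2)" using r2 by (intro mult_left_mono) auto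
    finally show ?thesis by (simp add: power_mult_distrib q)
  qed
  then have "\<bar>r * c'\<bar> \<le> w * q"
    using q(1) assms(4) by (simp add: abs_le_square_iff[symmetric])
  then have "- (r * c') \<le> w * q" by linarith
  then show ?thesis
    unfolding q_def[symmetric] using q(1) by (simp add: field_simps)
qed

lemma weighted_Cauchy_Schwarz:
  fixes v w :: "'a::real_inner"
  assumes "k \<ge> 0"
  shows "k * x * y + v \<bullet> w \<le> sqrt (k * x\<^sup>2 + (norm v)\<^sup>2) * sqrt (k * y\<^sup>2 + (norm w)\<^sup>2)"
proof -
  let ?a = "norm v" and ?b = "norm w"
  have "k * x * y + v \<bullet> w \<le> k * x * y + ?a * ?b"
    using norm_cauchy_schwarz by simp
  also have "\<dots> \<le> sqrt ((k * x * y + ?a * ?b)\<^sup>2)" by simp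
  also have "\<dots> \<le> sqrt ((k * x\<^sup>2 + ?a\<^sup>2) * (k * y\<^sup>2 + ?b\<^sup>2))"
  proof (rule real_sqrt_le_mono)
    have "0 \<le> k * (x * ?b - y * ?a)\<^sup>2" using assms by simp
    then show "(k * x * y + ?a * ?b)\<^sup>2 \<le> (k * x\<^sup>2 + ?a\<^sup>2) * (k * y\<^sup>2 + ?b\<^sup>2)"
      by (simp add: power2_eq_square algebra_simps)
  qed
  finally show ?thesis by (simp add: real_sqrt_mult)
qed

definition SR_length :: "real \<Rightarrow> (real \<Rightarrow> (real^3^3) \<times> (real^3^3)) \<Rightarrow> real \<Rightarrow> bool" where
  "SR_length k \<gamma> L \<longleftrightarrow> \<gamma> piecewise_C1_differentiable_on {0..1} \<and> path_image \<gamma> \<subseteq> SR_M \<and>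
     ((\<lambda>t. sqrt (g_M k (\<gamma> t) (vector_derivative \<gamma> (at t)) (vector_derivative \<gamma> (at t))))
         has_integral L) {0..1}"

text \<open>With \<open>\<theta>\<close> and \<open>\<delta>\<close> the total change of angle and
  of log-eigenvalues and \<open>T = sqrt (k \<theta>\<^sup>2 +
  \<bar>\<delta>\<bar>\<^sup>2)\<close>, the function \<open>\<Phi> = k \<theta> arccos (r c) +
  \<delta> \<bullet> ln e\<close> grows at most at \<open>T\<close> times the speed. Its total
  growth tends to \<open>T\<^sup>2\<close> as \<open>r\<close> tends to \<open>1\<close>, so the
  length is at least \<open>T\<close>.\<close>

lemma SR_length_ge:
  fixes \<gamma> :: "real \<Rightarrow> (real^3^3) \<times> (real^3^3)"
  assumes k: "k > 0" and len: "SR_length k \<gamma> L"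
    and start: "\<gamma> 0 = (U, diag d)" and fin: "\<gamma> 1 = (V, diag l)"
  shows "sqrt (k * (rot_angle (U\<^sup>T ** V))\<^sup>2 + (norm (ln_vec l - ln_vec d))\<^sup>2) \<le> L"
proof -
  define sp where "sp = (\<lambda>t. sqrt (g_M k (\<gamma> t) (vector_derivative \<gamma> (at t)) (vector_derivative \<gamma> (at t))))"
  obtain S0 where S0: "finite S0" "\<gamma> C1_differentiable_on {0..1} - S0" and cont: "continuous_on {0..1} \<gamma>"
    using len by (auto simp: SR_length_def piecewise_C1_differentiable_on_def)
  \<comment> \<open>The endpoints are excluded because the curve need not stay in \<open>SR_M\<close> outside the unit interval.\<close>
  define S where "S = S0 \<union> {0, 1}"
  have finS: "finite S" using S0 by (simp add: S_def)
  have der: "(\<gamma> has_vector_derivative vector_derivative \<gamma> (at t)) (at t)" if "t \<in> {0..1} - S" for t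
    using S0(2) that by (auto simp: C1_differentiable_on_eq vector_derivative_works S_def)
  have mem: "\<gamma> s \<in> SR_M" if "0 \<le> s" "s \<le> 1" for s
    using len that by (auto simp: SR_length_def path_image_def)
  define u where "u = (\<lambda>s. fst (\<gamma> s))"
  define e where "e = (\<lambda>s. \<chi> i. snd (\<gamma> s) $ i $ i)"
  have u_SO: "u s \<in> SO" and e_pos: "e s $ i > 0" and split: "\<gamma> s = (u s, diag (e s))"
    if "0 \<le> s" "s \<le> 1" for s i
    using mem[OF that] by (cases "\<gamma> s"; force simp: SR_M_def u_def e_def Diag_pos_iff diag_nth)+
  have U: "U = u 0" and V: "V = u 1" and d: "d = e 0" and l: "l = e 1"
    using start fin split[of 0] split[of 1] by auto
  define c where "c = (\<lambda>s. (trace (U\<^sup>T ** u s) - 1) / 2)"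
  have c_bounds: "\<bar>c s\<bar> \<le> 1" if "0 \<le> s" "s \<le> 1" for s
    using trace_SO_bounds[OF SO_mult[OF SO_transpose[OF u_SO[of 0]] u_SO[OF that]]]
    by (simp add: c_def U abs_le_iff)
  define \<theta> where "\<theta> = rot_angle (U\<^sup>T ** V)"
  define \<delta> where "\<delta> = ln_vec l - ln_vec d"
  define T where "T = sqrt (k * \<theta>\<^sup>2 + (norm \<delta>)\<^sup>2)"
  have T2: "T\<^sup>2 = k * \<theta>\<^sup>2 + (norm \<delta>)\<^sup>2" and T0: "T \<ge> 0"
    using k by (simp_all add: T_def)
  have UV: "U\<^sup>T ** V \<in> SO" using u_SO U V by (simp add: SO_mult SO_transpose)
  have \<theta>: "\<theta> \<ge> 0" "\<theta> = arccos (c 1)"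
    using rot_angle_bounds[OF UV] by (simp_all add: \<theta>_def c_def V rot_angle_def)
  have c0: "c 0 = 1"
    using u_SO[of 0] by (simp add: c_def U SO_iff trace_def mat_def sum_3)
  \<comment> \<open>At the exceptional times the integrand may even be negative, as \<open>g_M\<close> is evaluated there at an
    arbitrary matrix.\<close>
  define sp0 where "sp0 = (\<lambda>t. if t \<in> S then 0 else sp t)"
  have int_sp: "(sp0 has_integral L) {0..1}"
    using len unfolding SR_length_def sp_def[symmetric]
    by (auto intro: has_integral_spike_finite[OF finS] simp: sp0_def)
  \<comment> \<open>Here \<open>w\<close> is the rotational speed, \<open>w'\<close> the derivative of the cosine \<open>c\<close>, and \<open>m\<close> the logarithmic
    velocity of the eigenvalues.\<close>
  have vel: "\<exists>w w' m. w \<ge> 0 \<and> w'\<^sup>2 \<le> w\<^sup>2 * (1 - (c t)\<^sup>2) \<and> (c has_real_derivative w') (at t)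
      \<and> (\<forall>i. ((\<lambda>s. e s $ i) has_real_derivative (m $ i * e t $ i)) (at t))
      \<and> sp t = sqrt (k * w\<^sup>2 + (norm m)\<^sup>2)" if t: "t \<in> {0..1} - S" for t
  proof -
    have t01: "0 < t" "t < 1" using t by (auto simp: S_def less_le)
    obtain A N where AN: "vector_derivative \<gamma> (at t) = (A, N)" by (cases "vector_derivative \<gamma> (at t)")
    have dAN: "(\<gamma> has_vector_derivative (A, N)) (at t)" using der[OF t] AN by simp
    obtain b m where bm: "A ** (u t)\<^sup>T = skew b" "N = diag m"
      using SR_M_velocity[OF dAN t01] mem unfolding u_def by (metis less_imp_le)
    have du: "(u has_vector_derivative A) (at t)" and de: "((\<lambda>s. snd (\<gamma> s)) has_vector_derivative N) (at t)"
      using bounded_linear.has_vector_derivative[OF bounded_linear_fst dAN]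
            bounded_linear.has_vector_derivative[OF bounded_linear_snd dAN] by (simp_all add: u_def)
    let ?R = "u t ** U\<^sup>T"
    have R: "?R \<in> SO" using u_SO t01 U by (simp add: SO_mult SO_transpose)
    have ut: "(u t)\<^sup>T ** u t = mat 1" using u_SO[of t] t01 by (simp add: SO_iff)
    have "A = skew b ** u t" by (metis bm(1) ut matrix_mul_assoc matrix_mul_rid)
    then have "U\<^sup>T ** A = (U\<^sup>T ** skew b) ** u t" by (simp add: matrix_mul_assoc)
    then have "trace (U\<^sup>T ** A) = trace (u t ** (U\<^sup>T ** skew b))" by (metis trace_mul_sym)
    also have "\<dots> = trace (skew b ** ?R)" by (metis trace_mul_sym matrix_mul_assoc)
    finally have trA: "U \<bullet> A = trace (skew b ** ?R)" by (simp add: trace_transpose_mult)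
    have trR: "c t = (trace ?R - 1) / 2" unfolding c_def by (metis trace_mul_sym)
    have c_inner: "c = (\<lambda>s. (U \<bullet> u s - 1) / 2)" by (simp add: c_def trace_transpose_mult)
    have "((\<lambda>s. U \<bullet> u s) has_real_derivative U \<bullet> A) (at t)"
      using bounded_linear.has_vector_derivative[OF bounded_linear_inner_right du]
      by (simp add: has_real_derivative_iff_has_vector_derivative)
    then have dc: "(c has_real_derivative (U \<bullet> A) / 2) (at t)"
      unfolding c_inner by (auto intro!: derivative_eq_intros)
    have ep: "e t $ i > 0" for i using e_pos t01 by simp
    define m' where "m' = (\<chi> i. m $ i / e t $ i)"
    have de': "((\<lambda>s. e s $ i) has_real_derivative (m' $ i * e t $ i)) (at t)" for i
      using vec_vec_has_real_derivative[OF de, of i i] ep[of i]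
      by (simp add: e_def m'_def bm diag_nth)
    have "sp t = sqrt (k * (norm b)\<^sup>2 + (norm m')\<^sup>2)"
      unfolding sp_def AN bm(2) m'_def using split[of t] t01
      by (simp add: g_M_skew_diag[OF u_SO e_pos bm(1)] del: g_M.simps)
    moreover have "((U \<bullet> A) / 2)\<^sup>2 \<le> (norm b)\<^sup>2 * (1 - (c t)\<^sup>2)"
      unfolding trA trR by (rule trace_skew_rotation[OF R])
    ultimately show ?thesis using dc de' norm_ge_zero by blast
  qed
  then obtain w w' m where
    w0: "\<And>t. t \<in> {0..1} - S \<Longrightarrow> w t \<ge> 0" and
    w': "\<And>t. t \<in> {0..1} - S \<Longrightarrow> (w' t)\<^sup>2 \<le> (w t)\<^sup>2 * (1 - (c t)\<^sup>2)" and
    dc: "\<And>t. t \<in> {0..1} - S \<Longrightarrow> (c has_real_derivative w' t) (at t)" and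
    de: "\<And>t i. t \<in> {0..1} - S \<Longrightarrow> ((\<lambda>s. e s $ i) has_real_derivative (m t $ i * e t $ i)) (at t)" and
    speed: "\<And>t. t \<in> {0..1} - S \<Longrightarrow> sp t = sqrt (k * (w t)\<^sup>2 + (norm (m t))\<^sup>2)"
    by metis
  have sp0: "sp0 t \<ge> 0" if "t \<in> {0..1}" for t
    using speed[of t] that k by (auto simp: sp0_def)
  have L0: "L \<ge> 0" using has_integral_nonneg[OF int_sp] sp0 by blast
  have cont_c: "continuous_on {0..1} c"
    unfolding c_def trace_transpose_mult u_def by (auto intro!: continuous_intros cont)
  have cont_e: "continuous_on {0..1} (\<lambda>s. e s $ i)" for i
    unfolding e_def by simp (intro continuous_intros cont)
  have bound: "k * \<theta> * (arccos (r * c 1) - arccos r) + (norm \<delta>)\<^sup>2 \<le> L * T" if r: "0 < r" "r < 1" for r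
  proof -
    have rc: "\<bar>r * c s\<bar> < 1" if "0 \<le> s" "s \<le> 1" for s
    proof -
      have "\<bar>r * c s\<bar> \<le> r * 1" unfolding abs_mult using c_bounds[OF that] r by (intro mult_mono) auto
      then show ?thesis using r by simp
    qed
    define \<Phi> where "\<Phi> = (\<lambda>s. k * \<theta> * arccos (r * c s) + \<delta> \<bullet> ln_vec (e s))"
    define \<Phi>' where "\<Phi>' = (\<lambda>t. if t \<in> S then 0 else
        k * \<theta> * ((r * w' t) * inverse (- sqrt (1 - (r * c t)\<^sup>2))) + \<delta> \<bullet> m t)"
    have "(\<Phi>' has_integral (\<Phi> 1 - \<Phi> 0)) {0..1}"
    proof (rule fundamental_theorem_of_calculus_strong[OF finS])
      fix t assume t: "t \<in> {0..1} - S"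
      then have t01: "0 \<le> t" "t \<le> 1" by auto
      have "((\<lambda>s. ln_vec (e s) $ i) has_real_derivative m t $ i) (at t)" for i
        unfolding ln_vec_def using e_pos[OF t01, of i] de[OF t, of i]
        by (auto intro!: derivative_eq_intros)
      then have dln: "((\<lambda>s. \<Sum>i\<in>UNIV. \<delta> $ i * ln_vec (e s) $ i) has_real_derivative (\<Sum>i\<in>UNIV. \<delta> $ i * m t $ i)) (at t)"
        by (intro DERIV_sum DERIV_cmult)
      have darc: "((\<lambda>s. arccos (r * c s)) has_real_derivative
          (inverse (- sqrt (1 - (r * c t)\<^sup>2)) * (r * w' t))) (at t)"
        using rc[OF t01] by (intro DERIV_chain2[OF DERIV_arccos] DERIV_cmult dc[OF t]) (auto simp: abs_less_iff)
      have "(\<Phi> has_real_derivative \<Phi>' t) (at t)"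
        using DERIV_add[OF DERIV_cmult[OF darc, of "k * \<theta>"] dln] t
        by (simp add: \<Phi>_def \<Phi>'_def inner_vec_def mult.commute)
      then show "(\<Phi> has_vector_derivative \<Phi>' t) (at t)"
        by (simp add: has_real_derivative_iff_has_vector_derivative)
    next
      show "continuous_on {0..1} \<Phi>"
        unfolding \<Phi>_def inner_vec_def ln_vec_def
        using rc e_pos
        by (auto intro!: continuous_intros cont_c cont_e simp: abs_less_iff less_imp_le)
           (smt (verit))+
    qed simp
    moreover have "((\<lambda>t. sp0 t * T) has_integral L * T) {0..1}"
      using has_integral_mult_left[OF int_sp] .
    moreover have "\<Phi>' t \<le> sp0 t * T" if "t \<in> {0..1}" for t
    proof (cases "t \<in> S")
      case False
      then have t: "t \<in> {0..1} - S" using that by simp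
      have "(r * w' t) * inverse (- sqrt (1 - (r * c t)\<^sup>2)) \<le> w t"
        using shrunk_arccos_speed[OF r _ w0[OF t] w'[OF t]] c_bounds that by simp
      then have "k * \<theta> * ((r * w' t) * inverse (- sqrt (1 - (r * c t)\<^sup>2))) \<le> k * \<theta> * w t"
        by (rule mult_left_mono) (use k \<theta>(1) in simp)
      then have "\<Phi>' t \<le> k * \<theta> * w t + \<delta> \<bullet> m t"
        using False by (simp add: \<Phi>'_def)
      also have "\<dots> \<le> T * sp t"
        unfolding T_def speed[OF t] using k by (intro weighted_Cauchy_Schwarz) simp
      finally show ?thesis using False by (simp add: sp0_def mult.commute)
    qed (simp add: \<Phi>'_def sp0_def)
    ultimately have "\<Phi> 1 - \<Phi> 0 \<le> L * T" by (rule has_integral_le)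
    moreover have "\<delta> \<bullet> ln_vec l - \<delta> \<bullet> ln_vec d = (norm \<delta>)\<^sup>2"
      by (simp add: \<delta>_def inner_diff_right[symmetric] power2_norm_eq_inner)
    ultimately show ?thesis
      by (simp add: \<Phi>_def c0 l d algebra_simps)
  qed
  define r where "r = (\<lambda>n. 1 - inverse (real (Suc (Suc n))))"
  have r: "0 < r n" "r n < 1" for n by (simp_all add: r_def field_simps)
  have lim_r: "r \<longlonglongrightarrow> 1"
    using LIMSEQ_Suc[OF LIMSEQ_inverse_real_of_nat_add_minus[of 1]] by (simp add: r_def)
  have "(\<lambda>n. arccos (r n)) \<longlonglongrightarrow> arccos 1"
    by (rule continuous_on_tendsto_compose[OF continuous_on_arccos' lim_r])
       (use r in \<open>auto intro!: always_eventually less_imp_le simp: less_imp_le\<close>,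
         smt (verit) r)
  moreover have "(\<lambda>n. arccos (r n * c 1)) \<longlonglongrightarrow> arccos (1 * c 1)"
  proof (rule continuous_on_tendsto_compose[OF continuous_on_arccos'])
    show "(\<lambda>n. r n * c 1) \<longlonglongrightarrow> 1 * c 1" by (intro tendsto_intros lim_r)
    show "1 * c 1 \<in> {-1..1}" using c_bounds[of 1] by (simp add: abs_le_iff)
    have "\<bar>r n * c 1\<bar> \<le> 1" for n
      unfolding abs_mult using c_bounds[of 1] r[of n] mult_mono[of "\<bar>r n\<bar>" 1 "\<bar>c 1\<bar>" 1] by simp
    then show "\<forall>\<^sub>F n in sequentially. r n * c 1 \<in> {-1..1}"
      by (intro always_eventually) (simp add: abs_le_iff minus_le_iff)
  qed
  ultimately have "(\<lambda>n. k * \<theta> * (arccos (r n * c 1) - arccos (r n)) + (norm \<delta>)\<^sup>2) \<longlonglongrightarrow>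
      k * \<theta> * (\<theta> - 0) + (norm \<delta>)\<^sup>2"
    by (intro tendsto_intros) (simp_all add: \<theta>(2))
  then have "k * \<theta> * (\<theta> - 0) + (norm \<delta>)\<^sup>2 \<le> L * T"
    by (rule LIMSEQ_le_const2) (use bound r in auto)
  then have "T * T \<le> L * T"
    using T2 by (simp add: power2_eq_square)
  then have "T \<le> L"
    using T0 L0 by (cases "T = 0") (simp_all add: mult_le_cancel_right)
  then show ?thesis
    unfolding T_def \<theta>_def \<delta>_def .
qed

text \<open>The path \<open>U exp (t \<theta> N)\<close> with axis and angle of \<open>U\<^sup>T
  V\<close>, paired with the geometric interpolation of the eigenvalues, has constant speed.\<close>

lemma geodesic_length:
  fixes U V :: "real^3^3"
  assumes UV: "U \<in> SO" "V \<in> SO" and pos: "\<And>i. d $ i > 0" "\<And>i. l $ i > 0"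
  shows "\<exists>\<gamma>. SR_length k \<gamma> (sqrt (k * (rot_angle (U\<^sup>T ** V))\<^sup>2 + (norm (ln_vec l - ln_vec d))\<^sup>2))
           \<and> \<gamma> 0 = (U, diag d) \<and> \<gamma> 1 = (V, diag l)"
proof -
  define \<theta> where "\<theta> = rot_angle (U\<^sup>T ** V)"
  define \<delta> where "\<delta> = ln_vec l - ln_vec d"
  have "U\<^sup>T ** V \<in> SO" using UV by (simp add: SO_mult SO_transpose)
  then obtain n where n: "norm n = 1" "U\<^sup>T ** V = rodrigues n \<theta>"
    unfolding \<theta>_def by (rule SO3_axis_angle)
  let ?N = "skew n"
  define E where "E = (\<lambda>t. \<chi> i. d $ i * exp (t * \<delta> $ i))"
  define \<gamma> where "\<gamma> = (\<lambda>t. (U ** rodrigues n (t * \<theta>), diag (E t)))"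
  define A where "A = (\<lambda>t. (\<theta> * cos (t * \<theta>)) *\<^sub>R (U ** ?N) + (\<theta> * sin (t * \<theta>)) *\<^sub>R (U ** (?N ** ?N)))"
  define m where "m = (\<lambda>t. \<chi> i. \<delta> $ i * E t $ i)"
  have E_pos: "E t $ i > 0" for t i using pos by (simp add: E_def)
  have U_rod: "U ** rodrigues n t = U + sin t *\<^sub>R (U ** ?N) + (1 - cos t) *\<^sub>R (U ** (?N ** ?N))" for t
    by (simp add: rodrigues_def matrix_add_ldistrib scaleR_matrix_mult)
  \<comment> \<open>Expanding a diagonal matrix in basis matrices reduces its derivative to that of scalars.\<close>
  have diag_sum: "diag v = (\<Sum>i\<in>UNIV. v $ i *\<^sub>R axis i (axis i 1))" for v :: "real^3"
    by (simp add: vec_eq_iff diag_nth sum_3 forall_3 axis_def)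
  have du: "((\<lambda>t. U ** rodrigues n (t * \<theta>)) has_vector_derivative A t) (at t)" for t
    unfolding U_rod A_def
    by (auto intro!: derivative_eq_intros simp: algebra_simps scaleR_add_left)
  have dE: "((\<lambda>t. E t $ i) has_real_derivative m t $ i) (at t)" for i t
    unfolding E_def m_def by (auto intro!: derivative_eq_intros)
  have dD: "((\<lambda>t. diag (E t)) has_vector_derivative diag (m t)) (at t)" for t
    unfolding diag_sum
    by (intro has_vector_derivative_sum has_vector_derivative_scaleR[OF dE has_vector_derivative_const, simplified])
  have d\<gamma>: "(\<gamma> has_vector_derivative (A t, diag (m t))) (at t)" for t
    unfolding \<gamma>_def by (rule has_vector_derivative_Pair[OF du dD])
  have cont_E: "continuous_on S (\<lambda>t. E t $ i)" for S i
    using dE by (meson DERIV_continuous_on has_field_derivative_at_within)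
  have "continuous_on S A" for S unfolding A_def by (intro continuous_intros)
  moreover have "continuous_on S (\<lambda>t. diag (m t))" for S
    unfolding diag_sum by (simp add: m_def) (intro continuous_intros cont_E)
  ultimately have "continuous_on S (\<lambda>t. (A t, diag (m t)))" for S
    by (intro continuous_intros)
  then have "\<gamma> C1_differentiable_on {0..1}"
    unfolding C1_differentiable_on_def using d\<gamma>
    by (intro exI[of _ "\<lambda>t. (A t, diag (m t))"]) simp
  then have C1: "\<gamma> piecewise_C1_differentiable_on {0..1}"
    by (rule C1_differentiable_imp_piecewise)
  have mem: "\<gamma> t \<in> SR_M" for t
    using E_pos UV rodrigues_in_SO[OF n(1)] by (auto simp: \<gamma>_def SR_M_def SO_mult Diag_pos_iff)
  have speed: "g_M k (\<gamma> t) (A t, diag (m t)) (A t, diag (m t)) = k * \<theta>\<^sup>2 + (norm \<delta>)\<^sup>2" for t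
  proof -
    let ?E = "rodrigues n (t * \<theta>)" and ?W = "U ** ?N ** U\<^sup>T"
    have E: "?E ** ?E\<^sup>T = mat 1" and U: "U\<^sup>T ** U = mat 1"
      using rodrigues_in_SO[OF n(1)] UV by (simp_all add: SO_iff)
    have "?N ** ?E = cos (t * \<theta>) *\<^sub>R ?N + sin (t * \<theta>) *\<^sub>R (?N ** ?N)"
      unfolding rodrigues_def
      by (simp add: matrix_add_ldistrib scaleR_matrix_mult skew_cube[OF n(1)])
         (simp add: scaleR_left_diff_distrib)
    then have "A t = \<theta> *\<^sub>R (U ** (?N ** ?E))"
      by (simp add: A_def matrix_add_ldistrib scaleR_matrix_mult algebra_simps)
    then have "A t ** (U ** ?E)\<^sup>T = \<theta> *\<^sub>R (U ** ?N ** (?E ** ?E\<^sup>T) ** U\<^sup>T)"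
      by (simp add: scaleR_matrix_mult matrix_transpose_mul matrix_mul_assoc)
    then have AW: "A t ** (U ** ?E)\<^sup>T = \<theta> *\<^sub>R ?W" by (simp add: E)
    have "(\<theta> *\<^sub>R ?W)\<^sup>T = \<theta> *\<^sub>R (U ** (?N\<^sup>T) ** U\<^sup>T)"
      by (simp add: transpose_scalar matrix_transpose_mul matrix_mul_assoc)
    also have "\<dots> = - (\<theta> *\<^sub>R ?W)"
      using scaleR_matrix_mult[where r="-1" and A=U and B="?N"]
            scaleR_matrix_mult[where r="-1" and A="U ** ?N" and B="U\<^sup>T"]
      by (simp add: skew_transpose)
    finally obtain b where b: "\<theta> *\<^sub>R ?W = skew b" using antisymmetric_imp_skew by blast
    have "?W ** ?W = U ** ?N ** (U\<^sup>T ** U) ** (?N ** U\<^sup>T)" by (simp add: matrix_mul_assoc)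
    then have "trace (?W ** ?W) = trace ((U ** (?N ** ?N)) ** U\<^sup>T)" by (simp add: U matrix_mul_assoc)
    also have "\<dots> = trace (U\<^sup>T ** (U ** (?N ** ?N)))" by (rule trace_mul_sym)
    also have "\<dots> = - 2" using trace_skew_square[of n] n(1) by (simp add: matrix_mul_assoc U)
    finally have "trace (skew b ** skew b) = \<theta>\<^sup>2 * (- 2)"
      by (simp add: b[symmetric] scaleR_matrix_mult trace_scaleR power2_eq_square)
    then have "(norm b)\<^sup>2 = \<theta>\<^sup>2" by (simp add: trace_skew_square)
    moreover have "(\<chi> i. m t $ i / E t $ i) = \<delta>"
      using E_pos by (simp add: m_def vec_eq_iff less_imp_neq[symmetric])
    ultimately show ?thesis
      unfolding \<gamma>_def using E_pos UV rodrigues_in_SO[OF n(1)] AW b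
      by (subst g_M_skew_diag[where b=b]) (simp_all add: SO_mult del: g_M.simps)
  qed
  have "((\<lambda>t::real. sqrt (k * \<theta>\<^sup>2 + (norm \<delta>)\<^sup>2)) has_integral sqrt (k * \<theta>\<^sup>2 + (norm \<delta>)\<^sup>2)) {0..1}"
    using has_integral_const_real[of _ 0 1] by simp
  then have "SR_length k \<gamma> (sqrt (k * \<theta>\<^sup>2 + (norm \<delta>)\<^sup>2))"
    unfolding SR_length_def using C1 mem
    by (auto simp: path_image_def vector_derivative_at[OF d\<gamma>] speed simp del: g_M.simps)
  moreover have "\<gamma> 0 = (U, diag d)"
    by (simp add: \<gamma>_def rodrigues_def E_def)
  moreover have "\<gamma> 1 = (V, diag l)"
  proof -
    have "U ** (U\<^sup>T ** V) = V" using UV by (simp add: matrix_mul_assoc SO_iff)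
    moreover have "E 1 = l"
      using pos by (simp add: E_def \<delta>_def ln_vec_def vec_eq_iff exp_diff less_imp_neq[symmetric])
    ultimately show ?thesis by (simp add: \<gamma>_def n(2)[symmetric])
  qed
  ultimately show ?thesis unfolding \<theta>_def \<delta>_def by blast
qed

theorem d_M_eq:
  fixes U V :: "real^3^3"
  assumes k: "k > 0" and UV: "U \<in> SO" "V \<in> SO" and pos: "\<And>i. d $ i > 0" "\<And>i. l $ i > 0"
  shows "d_M k (U, diag d) (V, diag l)
       = sqrt (k * (rot_angle (U\<^sup>T ** V))\<^sup>2 + (norm (ln_vec l - ln_vec d))\<^sup>2)" (is "_ = ?T")
proof -
  have "d_M k (U, diag d) (V, diag l) = Inf {L. \<exists>\<gamma>. SR_length k \<gamma> L \<and> \<gamma> 0 = (U, diag d) \<and> \<gamma> 1 = (V, diag l)}"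
    unfolding d_M_def SR_length_def pathstart_def pathfinish_def
    by (rule arg_cong[where f=Inf]) blast
  also have "\<dots> = ?T"
  proof (rule cInf_eq_minimum)
    show "?T \<in> {L. \<exists>\<gamma>. SR_length k \<gamma> L \<and> \<gamma> 0 = (U, diag d) \<and> \<gamma> 1 = (V, diag l)}"
      using geodesic_length[OF UV pos] by blast
    show "?T \<le> L" if "L \<in> {L. \<exists>\<gamma>. SR_length k \<gamma> L \<and> \<gamma> 0 = (U, diag d) \<and> \<gamma> 1 = (V, diag l)}" for L
      using SR_length_ge[OF k] that by blast
  qed
  finally show ?thesis .
qed

corollary d_M_eq_log:
  fixes U V :: "real^3^3"
  assumes "k > 0" "U \<in> SO" "V \<in> SO" "D \<in> Diag_pos" "\<Lambda> \<in> Diag_pos"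
  shows "d_M k (U, D) (V, \<Lambda>)
       = sqrt (k * (rot_angle (U\<^sup>T ** V))\<^sup>2 + (norm (log_Diag (matrix_inv D ** \<Lambda>)))\<^sup>2)"
  using assms by (auto simp: Diag_pos_iff d_M_eq log_Diag_quotient norm_diag)

section \<open>Signed permutation matrices\<close>

lemma signed_perm_entry:
  assumes "signed_perm P \<pi>"
  shows "i \<noteq> \<pi> j \<Longrightarrow> P $ i $ j = 0" "(P $ \<pi> j $ j)\<^sup>2 = 1"
proof -
  have e: "P $ i $ j = (if i = \<pi> j then 1 else 0) \<or> P $ i $ j = - (if i = \<pi> j then 1 else 0)" for i j
    using assms by (simp add: signed_perm_def)
  show "P $ i $ j = 0" if "i \<noteq> \<pi> j" using e[of i j] that by simp
  show "(P $ \<pi> j $ j)\<^sup>2 = 1" using e[of "\<pi> j" j] by (auto simp: power2_eq_1_iff)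
qed

lemma signed_permI:
  assumes "\<pi> permutes UNIV" "\<And>i j. i \<noteq> \<pi> j \<Longrightarrow> P $ i $ j = 0" "\<And>j. (P $ \<pi> j $ j)\<^sup>2 = 1"
  shows "signed_perm P \<pi>"
  unfolding signed_perm_def using assms by (auto simp: power2_eq_1_iff)

lemma signed_perm_mult_entry:
  assumes "signed_perm P \<pi>"
  shows "(A ** P) $ i $ j = A $ i $ \<pi> j * P $ \<pi> j $ j"
proof -
  have "(A ** P) $ i $ j = (\<Sum>k\<in>UNIV. if k = \<pi> j then A $ i $ k * P $ k $ j else 0)"
    unfolding matrix_matrix_mult_def vec_lambda_beta
    by (rule sum.cong) (use signed_perm_entry(1)[OF assms] in auto)
  then show ?thesis by simp
qed

lemma signed_perm_mult:
  assumes "signed_perm P \<pi>" "signed_perm Q \<sigma>"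
  shows "signed_perm (P ** Q) (\<pi> \<circ> \<sigma>)"
proof (rule signed_permI)
  show "\<pi> \<circ> \<sigma> permutes UNIV" using assms by (auto simp: signed_perm_def intro: permutes_compose)
qed (use signed_perm_entry[OF assms(1)] signed_perm_entry[OF assms(2)] in
     \<open>simp_all add: signed_perm_mult_entry[OF assms(2)] power_mult_distrib\<close>)

lemma signed_perm_transpose:
  assumes "signed_perm P \<pi>"
  shows "signed_perm (P\<^sup>T) (inv \<pi>)"
proof (rule signed_permI)
  have \<pi>: "\<pi> permutes UNIV" using assms by (simp add: signed_perm_def)
  then show "inv \<pi> permutes UNIV" by (rule permutes_inv)
  show "(P\<^sup>T) $ i $ j = 0" if "i \<noteq> inv \<pi> j" for i j
  proof -
    have "j \<noteq> \<pi> i" using that permutes_inverses(2)[OF \<pi>] by auto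
    then show ?thesis
      using signed_perm_entry(1)[OF assms] by (simp add: Finite_Cartesian_Product.transpose_def)
  qed
  show "((P\<^sup>T) $ inv \<pi> j $ j)\<^sup>2 = 1" for j
    using signed_perm_entry(2)[OF assms, of "inv \<pi> j"] permutes_inverses[OF \<pi>]
    by (simp add: Finite_Cartesian_Product.transpose_def)
qed

lemma signed_perm_conj_diag:
  assumes "signed_perm P \<pi>"
  shows "P ** diag d ** P\<^sup>T = diag (\<chi> i. d $ inv \<pi> i)"
proof -
  have \<pi>: "\<pi> permutes UNIV" using assms by (simp add: signed_perm_def)
  have "(P ** diag d ** P\<^sup>T) $ i $ j = diag (\<chi> i. d $ inv \<pi> i) $ i $ j" for i j
  proof -
    have "(P ** diag d ** P\<^sup>T) $ i $ j = P $ i $ inv \<pi> j * d $ inv \<pi> j * P $ j $ inv \<pi> j"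
      by (simp add: signed_perm_mult_entry[OF signed_perm_transpose[OF assms]] matrix_mult_diag_nth)
         (simp add: Finite_Cartesian_Product.transpose_def)
    moreover have "(P $ j $ inv \<pi> j)\<^sup>2 = 1" "i \<noteq> j \<Longrightarrow> P $ i $ inv \<pi> j = 0"
      using signed_perm_entry[OF assms] permutes_inverses[OF \<pi>] by metis+
    ultimately show ?thesis
      by (cases "i = j") (simp_all add: diag_nth power2_eq_square)
  qed
  then show ?thesis by (simp add: vec_eq_iff)
qed

lemma signed_perm_orthogonal:
  fixes P :: "real^3^3"
  assumes "signed_perm P \<pi>"
  shows "P ** P\<^sup>T = mat 1"
proof -
  have "diag (\<chi> i. 1) = (mat 1 :: real^3^3)" by (simp add: vec_eq_iff diag_nth mat_def)
  then show ?thesis using signed_perm_conj_diag[OF assms, of "\<chi> i. 1"] by simp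
qed

lemma S3_evenE:
  assumes "P \<in> S3_even"
  obtains \<pi> where "signed_perm P \<pi>" "\<pi> permutes UNIV" "P \<in> SO"
proof -
  obtain \<pi> where \<pi>: "signed_perm P \<pi>" and det: "det P = 1" using assms by (auto simp: S3_even_def)
  have "P ** P\<^sup>T = mat 1" by (rule signed_perm_orthogonal[OF \<pi>])
  then have "P \<in> SO" using det by (simp add: SO_iff matrix_left_right_inverse)
  then show ?thesis using that[OF \<pi>] \<pi> by (simp add: signed_perm_def)
qed

lemma S3_evenI: "P \<in> SO \<Longrightarrow> signed_perm P \<pi> \<Longrightarrow> P \<in> S3_even"
  by (auto simp: S3_even_def SO_iff)

lemma S3_even_in_SO: "P \<in> S3_even \<Longrightarrow> P \<in> SO"
  using S3_evenE by blast

lemma S3_even_mult: "P \<in> S3_even \<Longrightarrow> Q \<in> S3_even \<Longrightarrow> P ** Q \<in> S3_even"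
  by (metis S3_evenE S3_evenI SO_mult signed_perm_mult)

lemma S3_even_transpose: "P \<in> S3_even \<Longrightarrow> P\<^sup>T \<in> S3_even"
  by (metis S3_evenE S3_evenI SO_transpose signed_perm_transpose)

lemma mat_1_in_SO: "mat 1 \<in> SO"
  by (simp add: SO_iff)

lemma mat_1_in_S3_even: "mat 1 \<in> S3_even"
  by (rule S3_evenI[OF mat_1_in_SO, of id], rule signed_permI) (auto simp: mat_def permutes_id)

lemma perm_of_eq:
  assumes "signed_perm P \<pi>"
  shows "perm_of P = \<pi>"
  unfolding perm_of_def
proof (rule the_equality)
  show "signed_perm P \<pi>" by (rule assms)
next
  fix \<sigma> assume \<sigma>: "signed_perm P \<sigma>"
  show "\<sigma> = \<pi>"
  proof
    fix j show "\<sigma> j = \<pi> j"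
      using signed_perm_entry(1)[OF assms, of "\<sigma> j" j] signed_perm_entry(2)[OF \<sigma>, of j] by force
  qed
qed

lemma perm_act_eq_conj:
  assumes "signed_perm P \<pi>" "D \<in> Diag_pos"
  shows "perm_act \<pi> D = P ** D ** P\<^sup>T"
  using assms by (auto simp: Diag_pos_iff signed_perm_conj_diag perm_act_def diag_nth)

lemma S3_even_conj_Diag_pos:
  assumes "P \<in> S3_even" "D \<in> Diag_pos"
  shows "P ** D ** P\<^sup>T \<in> Diag_pos"
  using assms by (auto elim!: S3_evenE simp: Diag_pos_iff signed_perm_conj_diag)

lemma norm_log_Diag_conj:
  assumes "P \<in> S3_even"
  shows "norm (log_Diag (P ** diag a ** P\<^sup>T)) = norm (log_Diag (diag a))"
proof -
  obtain \<pi> where \<pi>: "signed_perm P \<pi>" "\<pi> permutes UNIV" by (rule S3_evenE[OF assms])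
  have "(\<Sum>i\<in>UNIV. (ln (a $ inv \<pi> i))\<^sup>2) = (\<Sum>i\<in>UNIV. (ln (a $ i))\<^sup>2)"
    using sum.permute[OF permutes_inv[OF \<pi>(2)], of "\<lambda>i. (ln (a $ i))\<^sup>2"] by (simp add: o_def)
  then have "norm (ln_vec (\<chi> i. a $ inv \<pi> i)) = norm (ln_vec a)"
    by (simp add: norm_vec_def L2_set_def ln_vec_def)
  then show ?thesis
    by (simp add: signed_perm_conj_diag[OF \<pi>(1)] log_Diag_diag norm_diag)
qed

lemma finite_S3_even: "finite S3_even"
proof (rule finite_subset)
  let ?f = "\<lambda>(\<pi>, s). (\<chi> i j. if i = \<pi> j then if s j then 1 else -1 else 0) :: real^3^3"
  show "S3_even \<subseteq> ?f ` UNIV"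
  proof
    fix P assume "P \<in> S3_even"
    then obtain \<pi> where \<pi>: "signed_perm P \<pi>" by (rule S3_evenE)
    have "P = ?f (\<pi>, \<lambda>j. P $ \<pi> j $ j = 1)"
      using signed_perm_entry[OF \<pi>] by (auto simp: vec_eq_iff power2_eq_1_iff)
    then show "P \<in> ?f ` UNIV" by blast
  qed
qed simp

text \<open>A permutation matrix has determinant \<open>1\<close> or \<open>-1\<close>; in odd
  dimension negating the matrix flips the sign.\<close>

lemma permutation_in_S3_even:
  assumes "\<pi> permutes UNIV"
  obtains P where "P \<in> S3_even" "signed_perm P \<pi>"
proof -
  define Q :: "real^3^3" where "Q = (\<chi> i j. if i = \<pi> j then 1 else 0)"
  have Q: "signed_perm Q \<pi>" "signed_perm (- Q) \<pi>"
    by (rule signed_permI; use assms in \<open>simp add: Q_def\<close>)+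
  have det_minus: "det (- Q) = - det Q" by (simp add: det_3)
  have "det Q = 1 \<or> det Q = -1"
    using det_orthogonal_matrix[of Q] signed_perm_orthogonal[OF Q(1)]
    by (simp add: orthogonal_matrix_def matrix_left_right_inverse)
  then show ?thesis
    using that[of Q] that[of "- Q"] Q det_minus by (auto simp: S3_even_def)
qed

section \<open>Fibers and the distance between them\<close>

text \<open>These are the rotations that can be inserted between \<open>U\<close> and
  \<open>D\<close> without changing \<open>U ** D ** U\<^sup>T\<close>.\<close>

definition rot_stab :: "real^3^3 \<Rightarrow> (real^3^3) set" where
  "rot_stab D = {G \<in> SO. G ** D = D ** G}"

lemma rot_stab_mult: "G \<in> rot_stab D \<Longrightarrow> H \<in> rot_stab D \<Longrightarrow> G ** H \<in> rot_stab D"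
  by (auto simp: rot_stab_def SO_mult) (metis matrix_mul_assoc)

lemma mat_1_in_rot_stab: "mat 1 \<in> rot_stab D"
  by (simp add: rot_stab_def mat_1_in_SO)

lemma rot_stab_conj:
  assumes "G \<in> SO"
  shows "G \<in> rot_stab D \<longleftrightarrow> G ** D ** G\<^sup>T = D"
proof -
  have G: "G ** G\<^sup>T = mat 1" "G\<^sup>T ** G = mat 1" using assms by (simp_all add: SO_iff)
  then show ?thesis using assms
    by (auto simp: rot_stab_def) (metis matrix_mul_assoc matrix_mul_rid)+
qed

lemma rot_stab_transpose:
  assumes "G \<in> rot_stab D"
  shows "G\<^sup>T \<in> rot_stab D"
proof -
  have G: "G ** G\<^sup>T = mat 1" "G\<^sup>T ** G = mat 1" "G ** D = D ** G" using assms by (simp_all add: SO_iff rot_stab_def)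
  have "G\<^sup>T ** D = G\<^sup>T ** (D ** G) ** G\<^sup>T" using G(1) by (metis matrix_mul_assoc matrix_mul_rid)
  also have "\<dots> = D ** G\<^sup>T" using G by (metis matrix_mul_assoc matrix_mul_lid)
  finally show ?thesis using assms by (simp add: rot_stab_def SO_transpose)
qed

lemma fiberD:
  assumes "(U, D) \<in> fiber X"
  shows "U \<in> SO" "D \<in> Diag_pos" "U ** D ** U\<^sup>T = X"
  using assms by (auto simp: fiber_def SR_M_def)

text \<open>Some term of the Leibniz expansion does not vanish.\<close>

lemma nonzero_det_permutation:
  fixes W :: "real^'n^'n"
  assumes "det W \<noteq> 0"
  obtains \<pi> where "\<pi> permutes UNIV" "\<And>i. W $ i $ \<pi> i \<noteq> 0"
proof -
  from assms obtain \<pi> where "\<pi> permutes UNIV" "of_int (sign \<pi>) * (\<Prod>i\<in>UNIV. W $ i $ \<pi> i) \<noteq> 0"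
    unfolding det_def by (metis (mono_tags, lifting) mem_Collect_eq sum.neutral)
  then show ?thesis using that by auto
qed

text \<open>The matrix \<open>W = U\<^sup>T U'\<close> satisfies \<open>W D' = D W\<close>, so a
  nonzero entry \<open>W\<^sub>i\<^sub>j\<close> forces the \<open>i\<close>-th diagonal entry of
  \<open>D\<close> to equal the \<open>j\<close>-th one of \<open>D'\<close>. As \<open>det W
  \<noteq> 0\<close>, there are nonzero entries along some permutation, which therefore carries
  \<open>D'\<close> to \<open>D\<close>; dividing \<open>W\<close> by a corresponding element
  \<open>P\<close> leaves a rotation commuting with \<open>D\<close>.\<close>

lemma fiber_param:
  assumes "(U, D) \<in> fiber X" "(U', D') \<in> fiber X"
  obtains G P where "G \<in> rot_stab D" "P \<in> S3_even" "U' = U ** G ** P" "D' = P\<^sup>T ** D ** P"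
proof -
  note a = fiberD[OF assms(1)] and b = fiberD[OF assms(2)]
  have UU: "U\<^sup>T ** U = mat 1" "U ** U\<^sup>T = mat 1" "U'\<^sup>T ** U' = mat 1" using a b by (simp_all add: SO_iff)
  define W where "W = U\<^sup>T ** U'"
  have W: "W \<in> SO" using a b by (simp add: W_def SO_mult SO_transpose)
  have "U\<^sup>T ** (U' ** D' ** U'\<^sup>T) ** U' = U\<^sup>T ** (U ** D ** U\<^sup>T) ** U'" using a b by simp
  then have "U\<^sup>T ** U' ** D' ** (U'\<^sup>T ** U') = (U\<^sup>T ** U) ** D ** U\<^sup>T ** U'"
    by (simp only: matrix_mul_assoc)
  then have WD: "W ** D' = D ** W"
    using UU by (simp add: W_def matrix_mul_assoc)
  obtain d d' where d: "D = diag d" and d': "D' = diag d'"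
    using a b by (auto simp: Diag_pos_iff)
  obtain \<pi> where \<pi>: "\<pi> permutes UNIV" "\<And>i. W $ i $ \<pi> i \<noteq> 0"
    using nonzero_det_permutation[of W] W by (auto simp: SO_iff)
  have dd': "d $ i = d' $ \<pi> i" for i
  proof -
    have "(W ** D') $ i $ \<pi> i = (D ** W) $ i $ \<pi> i" by (simp add: WD)
    then show ?thesis using \<pi>(2)[of i] by (simp add: d d' matrix_mult_diag_nth diag_mult_matrix_nth)
  qed
  obtain P where P: "P \<in> S3_even" "signed_perm P (inv \<pi>)"
    using permutation_in_S3_even permutes_inv[OF \<pi>(1)] by blast
  have PD: "P ** D' ** P\<^sup>T = D"
  proof -
    have "(\<chi> i. d' $ \<pi> i) = d" by (simp add: vec_eq_iff dd')
    then show ?thesis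
      using signed_perm_conj_diag[OF P(2), of d'] permutes_inv_inv[OF \<pi>(1)] by (simp add: d d')
  qed
  have PP: "P ** P\<^sup>T = mat 1" "P\<^sup>T ** P = mat 1" using S3_even_in_SO[OF P(1)] by (simp_all add: SO_iff)
  show ?thesis
  proof (rule that[OF _ P(1)])
    have "(W ** P\<^sup>T) ** D = W ** (P\<^sup>T ** P) ** D' ** P\<^sup>T"
      unfolding PD[symmetric] by (simp only: matrix_mul_assoc)
    also have "\<dots> = D ** (W ** P\<^sup>T)" using PP WD by (simp add: matrix_mul_assoc)
    finally show "W ** P\<^sup>T \<in> rot_stab D"
      using W S3_even_in_SO[OF P(1)] by (simp add: rot_stab_def SO_mult SO_transpose)
    have "U ** (W ** P\<^sup>T) ** P = (U ** U\<^sup>T) ** U' ** (P\<^sup>T ** P)"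
      unfolding W_def by (simp only: matrix_mul_assoc)
    then show "U' = U ** (W ** P\<^sup>T) ** P" using UU PP by simp
    have "P\<^sup>T ** D ** P = (P\<^sup>T ** P) ** D' ** (P\<^sup>T ** P)"
      unfolding PD[symmetric] by (simp only: matrix_mul_assoc)
    then show "D' = P\<^sup>T ** D ** P" using PP by simp
  qed
qed

lemma S3_even_conj_transpose_Diag_pos:
  "P \<in> S3_even \<Longrightarrow> D \<in> Diag_pos \<Longrightarrow> P\<^sup>T ** D ** P \<in> Diag_pos"
  using S3_even_conj_Diag_pos[OF S3_even_transpose] by simp

lemma fiber_intro:
  assumes "(U, D) \<in> fiber X" "G \<in> rot_stab D" "P \<in> S3_even"
  shows "(U ** G ** P, P\<^sup>T ** D ** P) \<in> fiber X"
proof -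
  note a = fiberD[OF assms(1)]
  have P: "P ** P\<^sup>T = mat 1" "P \<in> SO" using S3_even_in_SO[OF assms(3)] by (simp_all add: SO_iff)
  have G: "G \<in> SO" using assms(2) by (simp add: rot_stab_def)
  then have GD: "G ** D ** G\<^sup>T = D" using assms(2) rot_stab_conj by blast
  have "(U ** G ** P) ** (P\<^sup>T ** D ** P) ** (U ** G ** P)\<^sup>T
      = U ** G ** (P ** P\<^sup>T) ** D ** (P ** P\<^sup>T) ** G\<^sup>T ** U\<^sup>T"
    by (simp only: matrix_transpose_mul matrix_mul_assoc)
  also have "\<dots> = U ** (G ** D ** G\<^sup>T) ** U\<^sup>T"
    unfolding P by (simp add: matrix_mul_assoc)
  finally have "(U ** G ** P) ** (P\<^sup>T ** D ** P) ** (U ** G ** P)\<^sup>T = X" using GD a by simp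
  then show ?thesis
    using a G P assms(3) S3_even_conj_transpose_Diag_pos
    by (auto simp: fiber_def SR_M_def SO_mult)
qed

text \<open>The distance between two fiber elements, expressed by the relative rotation
  \<open>R\<close> and the relative signed permutation \<open>S\<close> that matches the
  eigenvalues.\<close>

definition SR_cost :: "real \<Rightarrow> real^3^3 \<Rightarrow> real^3^3 \<Rightarrow> real^3^3 \<Rightarrow> real^3^3 \<Rightarrow> real" where
  "SR_cost k D \<Lambda> R S =
     sqrt (k * (rot_angle (R ** S\<^sup>T))\<^sup>2 + (norm (log_Diag (matrix_inv D ** (S ** \<Lambda> ** S\<^sup>T))))\<^sup>2)"

lemma matrix_inv_Diag_pos:
  fixes D :: "real^'n^'n"
  assumes "D \<in> Diag_pos"
  shows "matrix_inv D ** D = mat 1" "D ** matrix_inv D = mat 1"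
proof -
  obtain d where d: "D = diag d" "\<forall>i. d $ i > 0" using assms by (auto simp: Diag_pos_iff)
  have "d $ i \<noteq> 0" for i using d(2) by (metis less_irrefl)
  then show "matrix_inv D ** D = mat 1"
    by (simp add: d matrix_inv_diag diag_mult_diag) (simp add: diag_def mat_def vec_eq_iff)
  then show "D ** matrix_inv D = mat 1" using matrix_left_right_inverse by blast
qed

lemma matrix_inv_commute:
  assumes "D \<in> Diag_pos" "G ** D = D ** G"
  shows "matrix_inv D ** G = G ** matrix_inv D"
proof -
  note i = matrix_inv_Diag_pos[OF assms(1)]
  have "matrix_inv D ** G = matrix_inv D ** (G ** D) ** matrix_inv D"
    using i by (metis matrix_mul_assoc matrix_mul_rid)
  also have "\<dots> = G ** matrix_inv D"
    unfolding assms(2) using i by (simp add: matrix_mul_assoc)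
  finally show ?thesis .
qed

text \<open>Traces and log-norms are invariant under conjugation by \<open>P\<close>, so only the
  quotient \<open>P ** Q\<^sup>T\<close> of the two signed permutations enters.\<close>

lemma d_M_between_fibers:
  assumes k: "k > 0" and UV: "U \<in> SO" "V \<in> SO" and DL: "D \<in> Diag_pos" "\<Lambda> \<in> Diag_pos"
    and GH: "G \<in> SO" "H \<in> SO" and PQ: "P \<in> S3_even" "Q \<in> S3_even"
  shows "d_M k (U ** G ** P, P\<^sup>T ** D ** P) (V ** H ** Q, Q\<^sup>T ** \<Lambda> ** Q)
       = SR_cost k D \<Lambda> (G\<^sup>T ** (U\<^sup>T ** V) ** H) (P ** Q\<^sup>T)"
proof -
  have P: "P ** P\<^sup>T = mat 1" "P \<in> SO" and Q: "Q \<in> SO" using S3_even_in_SO PQ by (auto simp: SO_iff)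
  let ?S = "P ** Q\<^sup>T"
  have "matrix_inv (P\<^sup>T ** D ** P) = P\<^sup>T ** matrix_inv D ** P"
  proof (rule matrix_inv_eqI)
    have "P\<^sup>T ** D ** P ** (P\<^sup>T ** matrix_inv D ** P) = P\<^sup>T ** D ** (P ** P\<^sup>T) ** matrix_inv D ** P"
      by (simp only: matrix_mul_assoc)
    also have "\<dots> = P\<^sup>T ** (D ** matrix_inv D) ** P" unfolding P by (simp add: matrix_mul_assoc)
    finally show "P\<^sup>T ** D ** P ** (P\<^sup>T ** matrix_inv D ** P) = mat 1"
      using matrix_inv_Diag_pos[OF DL(1)] P(2) by (simp add: SO_iff)
  qed
  then have "matrix_inv (P\<^sup>T ** D ** P) ** (Q\<^sup>T ** \<Lambda> ** Q)
    = P\<^sup>T ** matrix_inv D ** P ** Q\<^sup>T ** \<Lambda> ** Q ** (P\<^sup>T ** P)"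
    using P(2) by (simp add: SO_iff matrix_mul_assoc)
  also have "\<dots> = P\<^sup>T ** (matrix_inv D ** (?S ** \<Lambda> ** ?S\<^sup>T)) ** (P\<^sup>T)\<^sup>T"
    by (simp add: matrix_transpose_mul matrix_mul_assoc)
  finally have conj: "matrix_inv (P\<^sup>T ** D ** P) ** (Q\<^sup>T ** \<Lambda> ** Q) = \<dots>" .
  obtain a where "matrix_inv D ** (?S ** \<Lambda> ** ?S\<^sup>T) = diag a"
    using matrix_inv_diag_mult_in_Diag DL S3_even_conj_Diag_pos S3_even_mult S3_even_transpose PQ by metis
  then have nl: "norm (log_Diag (matrix_inv (P\<^sup>T ** D ** P) ** (Q\<^sup>T ** \<Lambda> ** Q)))
      = norm (log_Diag (matrix_inv D ** (?S ** \<Lambda> ** ?S\<^sup>T)))"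
    unfolding conj using norm_log_Diag_conj[OF S3_even_transpose[OF PQ(1)]] by simp
  have "(U ** G ** P)\<^sup>T ** (V ** H ** Q) = P\<^sup>T ** (G\<^sup>T ** (U\<^sup>T ** V) ** H ** Q)"
    by (simp add: matrix_transpose_mul matrix_mul_assoc)
  also have "rot_angle \<dots> = rot_angle ((G\<^sup>T ** (U\<^sup>T ** V) ** H ** Q) ** P\<^sup>T)"
    by (rule rot_angle_mult_commute)
  also have "(G\<^sup>T ** (U\<^sup>T ** V) ** H ** Q) ** P\<^sup>T = G\<^sup>T ** (U\<^sup>T ** V) ** H ** ?S\<^sup>T"
    by (simp add: matrix_transpose_mul matrix_mul_assoc)
  finally show ?thesis
    unfolding SR_cost_def using nl k UV GH DL P Q S3_even_conj_transpose_Diag_pos PQ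
    by (subst d_M_eq_log) (simp_all add: SO_mult)
qed

text \<open>Signed permutations commuting with \<open>D\<close> or \<open>\<Lambda>\<close> do not
  affect the matching of eigenvalues, so they can be absorbed into the relative rotation.\<close>

lemma SR_cost_shift:
  assumes DL: "D \<in> Diag_pos" "\<Lambda> \<in> Diag_pos" and S: "S \<in> S3_even"
    and K: "K \<in> S3_even" "K \<in> rot_stab D" and J: "J \<in> S3_even" "J \<in> rot_stab \<Lambda>"
  shows "SR_cost k D \<Lambda> R (K ** S ** J) = SR_cost k D \<Lambda> (K\<^sup>T ** R ** J\<^sup>T) S"
proof -
  have "rot_angle (R ** (K ** S ** J)\<^sup>T) = rot_angle (R ** J\<^sup>T ** S\<^sup>T ** K\<^sup>T)"
    by (simp add: matrix_transpose_mul matrix_mul_assoc)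
  also have "\<dots> = rot_angle (K\<^sup>T ** (R ** J\<^sup>T ** S\<^sup>T))" by (rule rot_angle_mult_commute)
  finally have ang: "rot_angle (R ** (K ** S ** J)\<^sup>T) = rot_angle (K\<^sup>T ** R ** J\<^sup>T ** S\<^sup>T)"
    by (simp add: matrix_mul_assoc)
  have J': "J ** \<Lambda> ** J\<^sup>T = \<Lambda>" using J rot_stab_conj S3_even_in_SO by blast
  have K': "matrix_inv D ** K = K ** matrix_inv D"
    using matrix_inv_commute DL K by (auto simp: rot_stab_def)
  have "matrix_inv D ** (K ** S ** J ** \<Lambda> ** (K ** S ** J)\<^sup>T) = (matrix_inv D ** K) ** S ** (J ** \<Lambda> ** J\<^sup>T) ** S\<^sup>T ** K\<^sup>T"
    by (simp add: matrix_transpose_mul matrix_mul_assoc)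
  also have "\<dots> = K ** (matrix_inv D ** (S ** \<Lambda> ** S\<^sup>T)) ** K\<^sup>T"
    unfolding J' K' by (simp add: matrix_mul_assoc)
  finally have conj: "matrix_inv D ** (K ** S ** J ** \<Lambda> ** (K ** S ** J)\<^sup>T) = \<dots>" .
  obtain a where "matrix_inv D ** (S ** \<Lambda> ** S\<^sup>T) = diag a"
    using matrix_inv_diag_mult_in_Diag DL S3_even_conj_Diag_pos S by metis
  then show ?thesis
    unfolding SR_cost_def ang conj using norm_log_Diag_conj[OF K(1)] by simp
qed

text \<open>The fibers are parametrized by \<open>fiber_param\<close> and
  \<open>fiber_intro\<close>. It suffices to attain each value with trivial signed permutation over
  \<open>Y\<close>, because only the quotient of the two matters.\<close>

theorem d_SR_eq_MinI:
  assumes k: "k > 0" and X: "(U, D) \<in> fiber X" and Y: "(V, \<Lambda>) \<in> fiber Y"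
    and A: "finite A" "A \<noteq> {}"
    and lower: "\<And>G H S. G \<in> rot_stab D \<Longrightarrow> H \<in> rot_stab \<Lambda> \<Longrightarrow> S \<in> S3_even \<Longrightarrow>
       \<exists>a\<in>A. a \<le> SR_cost k D \<Lambda> (G\<^sup>T ** (U\<^sup>T ** V) ** H) S"
    and attained: "\<And>a. a \<in> A \<Longrightarrow> \<exists>G\<in>rot_stab D. \<exists>H\<in>rot_stab \<Lambda>. \<exists>S\<in>S3_even.
       a = SR_cost k D \<Lambda> (G\<^sup>T ** (U\<^sup>T ** V) ** H) S"
  shows "d_SR k X Y = Min A"
  unfolding d_SR_def
proof (rule cInf_eq_minimum)
  note x = fiberD[OF X] and y = fiberD[OF Y]
  obtain G H S where GHS: "G \<in> rot_stab D" "H \<in> rot_stab \<Lambda>" "S \<in> S3_even"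
    "Min A = SR_cost k D \<Lambda> (G\<^sup>T ** (U\<^sup>T ** V) ** H) S"
    using attained[OF Min_in[OF A]] by blast
  have "Min A = d_M k (U ** G ** S, S\<^sup>T ** D ** S) (V ** H ** mat 1, (mat 1)\<^sup>T ** \<Lambda> ** mat 1)"
    using GHS by (subst d_M_between_fibers[OF k x(1) y(1) x(2) y(2)])
       (simp_all add: rot_stab_def mat_1_in_S3_even)
  then show "Min A \<in> {d_M k x y |x y. x \<in> fiber X \<and> y \<in> fiber Y}"
    using fiber_intro[OF X GHS(1,3)] fiber_intro[OF Y GHS(2) mat_1_in_S3_even] by blast
next
  note x = fiberD[OF X] and y = fiberD[OF Y]
  fix t assume "t \<in> {d_M k x y |x y. x \<in> fiber X \<and> y \<in> fiber Y}"
  then obtain U' D' V' L' where t: "t = d_M k (U', D') (V', L')" "(U', D') \<in> fiber X" "(V', L') \<in> fiber Y"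
    by auto
  obtain G P where GP: "G \<in> rot_stab D" "P \<in> S3_even" "U' = U ** G ** P" "D' = P\<^sup>T ** D ** P"
    by (rule fiber_param[OF X t(2)])
  obtain H Q where HQ: "H \<in> rot_stab \<Lambda>" "Q \<in> S3_even" "V' = V ** H ** Q" "L' = Q\<^sup>T ** \<Lambda> ** Q"
    by (rule fiber_param[OF Y t(3)])
  have "t = SR_cost k D \<Lambda> (G\<^sup>T ** (U\<^sup>T ** V) ** H) (P ** Q\<^sup>T)"
    unfolding t GP HQ using GP HQ x y
    by (intro d_M_between_fibers k) (simp_all add: rot_stab_def)
  then obtain a where "a \<in> A" "a \<le> t"
    using lower GP HQ S3_even_mult S3_even_transpose by metis
  then show "Min A \<le> t" using A Min_le order_trans by blast
qed

section \<open>Strata\<close>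

lemma eigenvalues_eigen_decomposition:
  fixes U :: "real^'n^'n"
  assumes "U \<in> SO"
  shows "eigenvalues (U ** diag d ** U\<^sup>T) = range (\<lambda>i. d $ i)"
proof (rule set_eqI)
  fix c
  have U: "U\<^sup>T ** U = mat 1" using assms by (simp add: SO_iff)
  have dv: "(diag d *v w) $ i = d $ i * w $ i" for w i
    by (simp add: matrix_vector_mult_def diag_nth if_distrib if_distribR cong: if_cong)
  show "c \<in> eigenvalues (U ** diag d ** U\<^sup>T) \<longleftrightarrow> c \<in> range (\<lambda>i. d $ i)"
  proof
    assume "c \<in> eigenvalues (U ** diag d ** U\<^sup>T)"
    then obtain v where v: "v \<noteq> 0" "(U ** diag d ** U\<^sup>T) *v v = c *s v"
      by (auto simp: eigenvalues_def)
    define w where "w = U\<^sup>T *v v"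
    have "U *v w = (U ** U\<^sup>T) *v v" by (simp only: w_def matrix_vector_mul_assoc)
    then have "U *v w = v" using assms by (simp add: SO_iff)
    then have w: "w \<noteq> 0" using v(1) by force
    have "U\<^sup>T *v ((U ** diag d ** U\<^sup>T) *v v) = c *s w"
      unfolding v(2) w_def by (simp add: vector_scalar_commute)
    moreover have "U\<^sup>T *v ((U ** diag d ** U\<^sup>T) *v v) = ((U\<^sup>T ** U) ** diag d) *v w"
      by (simp only: w_def matrix_vector_mul_assoc matrix_mul_assoc)
    ultimately have "diag d *v w = c *s w" using U by simp
    moreover obtain i where "w $ i \<noteq> 0" using w by (auto simp: vec_eq_iff)
    ultimately show "c \<in> range (\<lambda>i. d $ i)"
      using dv[of w i] by (auto simp: vector_smult_component)
  next
    assume "c \<in> range (\<lambda>i. d $ i)"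
    then obtain i where i: "c = d $ i" by blast
    have e: "diag d *v axis i 1 = c *s axis i 1"
      by (simp add: vec_eq_iff dv i axis_def)
    have "(U ** diag d ** U\<^sup>T) *v (U *v axis i 1) = U *v (diag d *v ((U\<^sup>T ** U) *v axis i 1))"
      by (simp add: matrix_vector_mul_assoc matrix_mul_assoc)
    also have "\<dots> = c *s (U *v axis i 1)"
      using U e by (simp add: vector_scalar_commute)
    finally have 1: "(U ** diag d ** U\<^sup>T) *v (U *v axis i 1) = c *s (U *v axis i 1)" .
    have "U\<^sup>T *v (U *v axis i 1) = axis i 1" using U by (simp add: matrix_vector_mul_assoc)
    then have "U *v axis i 1 \<noteq> 0"
      by (metis matrix_vector_mult_0_right axis_eq_0_iff zero_neq_one)
    then show "c \<in> eigenvalues (U ** diag d ** U\<^sup>T)"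
      using 1 unfolding eigenvalues_def by blast
  qed
qed

lemma fiber_eigenvalues:
  assumes "(U, diag d) \<in> fiber X"
  shows "eigenvalues X = range (\<lambda>i. d $ i)"
  using fiberD[OF assms] eigenvalues_eigen_decomposition by blast

lemma S_top_fiber_distinct:
  assumes "(U, diag d) \<in> fiber X" "X \<in> S_top" "i \<noteq> j"
  shows "d $ i \<noteq> d $ j"
proof -
  have "card (range (\<lambda>i. d $ i)) = card (UNIV :: 3 set)"
    using assms fiber_eigenvalues[OF assms(1)] by (simp add: S_top_def)
  then have "inj (\<lambda>i. d $ i)" by (simp add: eq_card_imp_inj_on)
  then show ?thesis using assms(3) by (auto dest: injD)
qed

lemma S_bot_fiber_constant:
  assumes "(U, diag d) \<in> fiber X" "X \<in> S_bot"
  shows "d $ i = d $ j"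
proof -
  have "card (range (\<lambda>i. d $ i)) = 1"
    using assms fiber_eigenvalues[OF assms(1)] by (simp add: S_bot_def)
  then show ?thesis by (metis card_1_singletonE rangeI singletonD)
qed

text \<open>Commuting with a diagonal matrix with distinct entries means being diagonal, and an
  orthogonal diagonal matrix has entries \<open>1\<close> and \<open>-1\<close>.\<close>

lemma rot_stab_distinct:
  assumes "\<And>i j. i \<noteq> j \<Longrightarrow> d $ i \<noteq> d $ j" "G \<in> rot_stab (diag d)"
  shows "G \<in> S3_even"
proof (rule S3_evenI)
  show "G \<in> SO" using assms(2) by (simp add: rot_stab_def)
  have off: "G $ i $ j = 0" if "i \<noteq> j" for i j
  proof -
    have "(G ** diag d) $ i $ j = (diag d ** G) $ i $ j" using assms(2) by (simp add: rot_stab_def)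
    then show ?thesis using assms(1)[OF that] by (simp add: matrix_mult_diag_nth diag_mult_matrix_nth)
  qed
  show "signed_perm G id"
  proof (rule signed_permI)
    show "(G $ id j $ j)\<^sup>2 = 1" for j
      using SO3_unit_rows_cols(2)[OF \<open>G \<in> SO\<close>, of j] exhaust_3[of j] by (auto simp: off)
  qed (simp_all add: off permutes_id)
qed

section \<open>Quaternions in complex coordinates\<close>

lemma qmult_quat_of:
  "qmult (quat_of z w) (quat_of u v) = quat_of (z * u - w * cnj v) (z * v + w * cnj u)"
  by (simp add: quat_of_def)

lemma qcnj_quat_of: "qcnj (quat_of u v) = quat_of (cnj u) (- v)"
  by (simp add: quat_of_def)

lemma unit_quat_of: "quat_of z w \<in> unit_quats \<longleftrightarrow> (cmod z)\<^sup>2 + (cmod w)\<^sup>2 = 1"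
  by (simp add: quat_of_def unit_quats_Quat cmod_power2 add.assoc)

lemma ex_quat_of: "\<exists>u v. q = quat_of u v"
proof
  show "\<exists>v. q = quat_of (Complex (q1 q) (qi q)) v"
    by (rule exI[of _ "Complex (qj q) (qk q)"]) (cases q; simp add: quat_of_def)
qed

lemma unit_quats_mult:
  assumes "p \<in> unit_quats" "q \<in> unit_quats"
  shows "qmult p q \<in> unit_quats"
proof (cases p; cases q)
  fix a b c d a' b' c' d'
  assume pq: "p = Quat a b c d" "q = Quat a' b' c' d'"
  have "a\<^sup>2 + b\<^sup>2 + c\<^sup>2 + d\<^sup>2 = 1" "a'\<^sup>2 + b'\<^sup>2 + c'\<^sup>2 + d'\<^sup>2 = 1"
    using assms by (simp_all add: pq unit_quats_Quat)
  moreover have "(a * a' - b * b' - c * c' - d * d')\<^sup>2 + (a * b' + b * a' + c * d' - d * c')\<^sup>2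
     + (a * c' - b * d' + c * a' + d * b')\<^sup>2 + (a * d' + b * c' - c * b' + d * a')\<^sup>2
     = (a\<^sup>2 + b\<^sup>2 + c\<^sup>2 + d\<^sup>2) * (a'\<^sup>2 + b'\<^sup>2 + c'\<^sup>2 + d'\<^sup>2)"
    by (simp add: power2_eq_square algebra_simps)
  ultimately show ?thesis by (simp add: pq unit_quats_Quat)
qed

lemma unit_quats_cnj: "q \<in> unit_quats \<Longrightarrow> qcnj q \<in> unit_quats"
  by (cases q) (simp add: unit_quats_Quat)

lemma rot_angle_quat_of: "quat_of z w \<in> unit_quats \<Longrightarrow> rot_angle (rot (quat_of z w)) = 2 * arccos \<bar>Re z\<bar>"
  by (simp add: rot_angle_rot) (simp add: quat_of_def)

lemma D_J1E:
  assumes "D \<in> D_J1"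
  obtains d where "D = diag d" "d $ 1 > 0" "d $ 2 > 0" "d $ 3 = d $ 2" "d $ 1 \<noteq> d $ 2" "D \<in> Diag_pos"
proof -
  obtain d1 d2 where d: "D = diag (vector [d1, d2, d2])" "d1 > 0" "d2 > 0" "d1 \<noteq> d2"
    using assms by (auto simp: D_J1_def)
  show ?thesis
    by (rule that[OF d(1)]) (use d in \<open>auto simp: vector_3 Diag_pos_iff forall_3\<close>)
qed

text \<open>The condition on the left says that the first row and column of the rotation vanish off
  the diagonal; for \<open>u + v j\<close> these entries are the real products of the coordinates of
  \<open>u\<close> with those of \<open>v\<close>, up to invertible linear combination.\<close>

lemma rot_stab_D_J1_iff:
  assumes D: "D \<in> D_J1" and unit: "quat_of u v \<in> unit_quats"
  shows "rot (quat_of u v) \<in> rot_stab D \<longleftrightarrow> u = 0 \<or> v = 0"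
proof -
  obtain d where d: "D = diag d" "d $ 3 = d $ 2" "d $ 1 \<noteq> d $ 2" by (rule D_J1E[OF D])
  let ?G = "rot (quat_of u v)"
  have G: "?G \<in> SO" by (rule rot_in_SO[OF unit])
  have "?G \<in> rot_stab D \<longleftrightarrow> (\<forall>i j. ?G $ i $ j * d $ j = d $ i * ?G $ i $ j)"
    using G by (simp add: rot_stab_def vec_eq_iff d(1) matrix_mult_diag_nth diag_mult_matrix_nth)
  also have "\<dots> \<longleftrightarrow> ?G $ 1 $ 2 = 0 \<and> ?G $ 1 $ 3 = 0 \<and> ?G $ 2 $ 1 = 0 \<and> ?G $ 3 $ 1 = 0"
    using d by (auto simp: forall_3 mult.commute)
  also have "\<dots> \<longleftrightarrow> u = 0 \<or> v = 0"
  proof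
    assume z: "?G $ 1 $ 2 = 0 \<and> ?G $ 1 $ 3 = 0 \<and> ?G $ 2 $ 1 = 0 \<and> ?G $ 3 $ 1 = 0"
    have "?G $ 1 $ 2 = 2 * (Im u * Re v) - 2 * (Re u * Im v)" "?G $ 1 $ 3 = 2 * (Im u * Im v) + 2 * (Re u * Re v)"
      "?G $ 2 $ 1 = 2 * (Im u * Re v) + 2 * (Re u * Im v)" "?G $ 3 $ 1 = 2 * (Im u * Im v) - 2 * (Re u * Re v)"
      by (simp_all add: quat_of_def rot_Quat vector_3)
    then have "Re u * Re v = 0" "Re u * Im v = 0" "Im u * Re v = 0" "Im u * Im v = 0"
      using z by linarith+
    then show "u = 0 \<or> v = 0" by (auto simp: complex_eq_iff)
  next
    assume "u = 0 \<or> v = 0"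
    then show "?G $ 1 $ 2 = 0 \<and> ?G $ 1 $ 3 = 0 \<and> ?G $ 2 $ 1 = 0 \<and> ?G $ 3 $ 1 = 0"
      by (auto simp: quat_of_def rot_Quat vector_3)
  qed
  finally show ?thesis .
qed

lemma rot_stab_D_J1E:
  assumes "D \<in> D_J1" "G \<in> rot_stab D"
  obtains u v where "G = rot (quat_of u v)" "quat_of u v \<in> unit_quats" "u = 0 \<or> v = 0"
proof -
  obtain q where q: "q \<in> unit_quats" "rot q = G"
    using rot_surj[of G] assms(2) by (auto simp: rot_stab_def)
  obtain u v where "q = quat_of u v" using ex_quat_of by blast
  then show ?thesis using that q assms rot_stab_D_J1_iff by metis
qed

text \<open>If the first eigenvalue stays in place, the other two can only be exchanged, and they
  are equal.\<close>

lemma S3_even_rot_stab_D_J1: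
  assumes D: "D \<in> D_J1" and S: "S \<in> S3_even" "signed_perm S \<pi>" "\<pi> 1 = 1"
  shows "S \<in> rot_stab D"
proof -
  obtain d where d: "D = diag d" "d $ 3 = d $ 2" by (rule D_J1E[OF D])
  have \<pi>: "\<pi> permutes UNIV" using S by (simp add: signed_perm_def)
  then have i1: "inv \<pi> i = 1 \<longleftrightarrow> i = 1" for i using S(3) by (metis permutes_inverses)
  have d23: "d $ i = d $ 2" if "i \<noteq> 1" for i using that d(2) exhaust_3[of i] by auto
  have "d $ inv \<pi> i = d $ i" for i
    using i1[of i] d23[of i] d23[of "inv \<pi> i"] by (cases "i = 1") auto
  then have "S ** D ** S\<^sup>T = D" by (simp add: d(1) signed_perm_conj_diag[OF S(2)])
  then show ?thesis using rot_stab_conj S3_even_in_SO[OF S(1)] by blast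
qed

lemma rot_transpose_mult_quat_of:
  "(rot (quat_of u v))\<^sup>T ** rot (quat_of z w) = rot (quat_of (cnj u * z + v * cnj w) (cnj u * w - v * cnj z))"
  unfolding rot_qcnj[symmetric] rot_qmult[symmetric] qcnj_quat_of qmult_quat_of by simp

text \<open>The real part of the product of \<open>z + w j\<close> with the conjugate of \<open>u +
  v j\<close> is that of \<open>cnj u * z\<close> or of \<open>v * cnj w\<close>, according to which
  of \<open>u\<close>, \<open>v\<close> vanishes, and the nonvanishing one of the two has modulus
  \<open>1\<close>.\<close>

lemma rot_stab_angle_ge:
  assumes D: "D \<in> D_J1" and G: "G \<in> rot_stab D" and zw: "quat_of z w \<in> unit_quats"
  shows "2 * arccos (max (cmod z) (cmod w)) \<le> rot_angle (G\<^sup>T ** rot (quat_of z w))"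
proof -
  obtain u v where uv: "G = rot (quat_of u v)" "quat_of u v \<in> unit_quats" "u = 0 \<or> v = 0"
    by (rule rot_stab_D_J1E[OF D G])
  let ?r = "cnj u * z + v * cnj w"
  have unit: "quat_of ?r (cnj u * w - v * cnj z) \<in> unit_quats"
    using unit_quats_mult[OF unit_quats_cnj[OF uv(2)] zw] by (simp add: qcnj_quat_of qmult_quat_of)
  have ang: "rot_angle (G\<^sup>T ** rot (quat_of z w)) = 2 * arccos \<bar>Re ?r\<bar>"
    unfolding uv(1) rot_transpose_mult_quat_of by (rule rot_angle_quat_of[OF unit])
  have "cmod u \<le> 1" "cmod v \<le> 1"
    using uv(2,3) by (auto simp: unit_quat_of power2_eq_1_iff)
  then have "cmod u * cmod z \<le> cmod z" "cmod v * cmod w \<le> cmod w"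
    by (simp_all add: mult_left_le_one_le)
  then have "cmod ?r \<le> max (cmod z) (cmod w)"
    using uv(3) by (auto simp: norm_mult le_max_iff_disj)
  then have "\<bar>Re ?r\<bar> \<le> max (cmod z) (cmod w)"
    using abs_Re_le_cmod order_trans by blast
  moreover have "max (cmod z) (cmod w) \<le> 1"
    using zw by (simp add: unit_quat_of) (smt (verit) power2_le_imp_le one_power2 zero_le_power2)
  ultimately have "arccos (max (cmod z) (cmod w)) \<le> arccos \<bar>Re ?r\<bar>"
    by (intro arccos_le_arccos) auto
  then show ?thesis using ang by simp
qed

text \<open>Equality holds when the nonzero one of \<open>u\<close>, \<open>v\<close> has the phase
  of the larger one of \<open>z\<close>, \<open>w\<close>.\<close>

lemma rot_stab_angle_attained:
  assumes D: "D \<in> D_J1" and zw: "quat_of z w \<in> unit_quats"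
  obtains G where "G \<in> rot_stab D"
    "rot_angle (G\<^sup>T ** rot (quat_of z w)) = 2 * arccos (max (cmod z) (cmod w))"
proof -
  define u where "u = (if cmod w \<le> cmod z then z / cmod z else 0)"
  define v where "v = (if cmod w \<le> cmod z then 0 else w / cmod w)"
  have z0: "z \<noteq> 0 \<or> w \<noteq> 0" using zw by (auto simp: unit_quat_of)
  have uv: "quat_of u v \<in> unit_quats" "u = 0 \<or> v = 0"
    using z0 by (auto simp: unit_quat_of u_def v_def norm_divide)
  let ?r = "cnj u * z + v * cnj w"
  have unit: "quat_of ?r (cnj u * w - v * cnj z) \<in> unit_quats"
    using unit_quats_mult[OF unit_quats_cnj[OF uv(1)] zw] by (simp add: qcnj_quat_of qmult_quat_of)
  have "?r = of_real (max (cmod z) (cmod w))"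
  proof -
    have "cnj x * x = of_real (cmod x) * of_real (cmod x)" "x * cnj x = of_real (cmod x) * of_real (cmod x)" for x
      using complex_norm_square[of x] by (simp_all add: power2_eq_square mult.commute)
    then show ?thesis
      using z0 by (auto simp: u_def v_def max_def field_simps)
  qed
  then have "\<bar>Re ?r\<bar> = max (cmod z) (cmod w)" by (simp add: le_max_iff_disj)
  then have "rot_angle ((rot (quat_of u v))\<^sup>T ** rot (quat_of z w)) = 2 * arccos (max (cmod z) (cmod w))"
    unfolding rot_transpose_mult_quat_of using rot_angle_quat_of[OF unit] by simp
  then show ?thesis using that[of "rot (quat_of u v)"] uv rot_stab_D_J1_iff[OF D uv(1)] by blast
qed

text \<open>Quarter turns about the axes \<open>j\<close>, \<open>k\<close> and \<open>i\<close>,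
  representing the three transpositions.\<close>

definition P13 :: "real^3^3" where "P13 = rot (quat_of (1 / sqrt 2) (1 / sqrt 2))"
definition P12 :: "real^3^3" where "P12 = rot (quat_of (1 / sqrt 2) (\<i> / sqrt 2))"
definition P23 :: "real^3^3" where "P23 = rot (quat_of ((1 + \<i>) / sqrt 2) 0)"

lemma quarter_turns:
  "P13 = vector [vector [0, 0, 1], vector [0, 1, 0], vector [-1, 0, 0]]"
  "P12 = vector [vector [0, -1, 0], vector [1, 0, 0], vector [0, 0, 1]]"
  "P23 = vector [vector [1, 0, 0], vector [0, 0, -1], vector [0, 1, 0]]"
  by (simp_all add: P13_def P12_def P23_def quat_of_def rot_Quat vec_eq_iff forall_3 vector_3 power_divide)

lemma signed_perm_transpositions:
  "signed_perm P13 (Transposition.transpose 1 3)" "signed_perm P12 (Transposition.transpose 1 2)"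
  "signed_perm P23 (Transposition.transpose 2 3)"
  by (simp_all add: signed_perm_def permutes_swap_id quarter_turns forall_3 vector_3 Transposition.transpose_def)

lemma quarter_turns_in_S3_even: "P13 \<in> S3_even" "P12 \<in> S3_even" "P23 \<in> S3_even"
proof -
  have "quat_of (1 / sqrt 2) (1 / sqrt 2) \<in> unit_quats" "quat_of (1 / sqrt 2) (\<i> / sqrt 2) \<in> unit_quats"
    "quat_of ((1 + \<i>) / sqrt 2) 0 \<in> unit_quats"
    by (simp_all add: quat_of_def unit_quats_Quat power_divide)
  then show "P13 \<in> S3_even" "P12 \<in> S3_even" "P23 \<in> S3_even"
    using signed_perm_transpositions rot_in_SO
    by (auto intro!: S3_evenI simp: P13_def P12_def P23_def)
qed

text \<open>Two signed permutations that send the same index to \<open>1\<close> differ by one that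
  fixes \<open>1\<close>. The cosets of the stabilizer of \<open>D\<close> are therefore
  distinguished by the eigenvalue of \<open>\<Lambda>\<close> that is matched with the simple
  eigenvalue of \<open>D\<close>.\<close>

lemma S3_even_coset:
  assumes "S \<in> S3_even" "signed_perm S \<pi>" "Q \<in> S3_even" "signed_perm Q \<sigma>" "\<pi> (inv \<sigma> 1) = 1" "D \<in> D_J1"
  obtains K where "K \<in> S3_even" "K \<in> rot_stab D" "S = K ** Q"
proof -
  have sp: "signed_perm (S ** Q\<^sup>T) (\<pi> \<circ> inv \<sigma>)"
    using assms signed_perm_mult signed_perm_transpose by blast
  have K: "S ** Q\<^sup>T \<in> S3_even" using assms S3_even_mult S3_even_transpose by blast
  have "S = S ** Q\<^sup>T ** Q"
    using S3_even_in_SO[OF assms(3)] by (simp add: SO_iff matrix_mul_assoc[symmetric])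
  then show ?thesis
    using that[OF K S3_even_rot_stab_D_J1[OF assms(6) K sp]] assms(5) by simp
qed

lemma rot_mult_quarter_turn_transpose:
  "rot (quat_of z w) ** P13\<^sup>T = rot (quat_of ((z + w) / sqrt 2) ((w - z) / sqrt 2))"
  "rot (quat_of z w) ** P12\<^sup>T = rot (quat_of ((z - \<i> * w) / sqrt 2) ((w - \<i> * z) / sqrt 2))"
  unfolding P13_def P12_def rot_qcnj[symmetric] rot_qmult[symmetric] qcnj_quat_of qmult_quat_of
  by (simp_all add: field_simps)

text \<open>The least cost of \<open>S\<close> over the stabilizer of a matrix with one double
  eigenvalue, for the relative rotation with \<open>R ** S\<^sup>T = rot (quat_of z
  w)\<close>.\<close>

definition stab_cost :: "real \<Rightarrow> real^3^3 \<Rightarrow> real^3^3 \<Rightarrow> complex \<Rightarrow> complex \<Rightarrow> real^3^3 \<Rightarrow> real" where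
  "stab_cost k D \<Lambda> z w S = sqrt (4 * k * (arccos (max (cmod z) (cmod w)))\<^sup>2
      + (norm (log_Diag (matrix_inv D ** (S ** \<Lambda> ** S\<^sup>T))))\<^sup>2)"

lemma max_cmod_unit:
  assumes "quat_of z w \<in> unit_quats"
  shows "max (cmod z) (cmod w) \<le> 1" "sqrt 2 / 2 \<le> max (cmod z) (cmod w)"
proof -
  have u: "(cmod z)\<^sup>2 + (cmod w)\<^sup>2 = 1" using assms by (simp add: unit_quat_of)
  then show "max (cmod z) (cmod w) \<le> 1"
    by (smt (verit) power2_le_imp_le one_power2 zero_le_power2)
  have "(sqrt 2 / 2)\<^sup>2 \<le> (max (cmod z) (cmod w))\<^sup>2"
    using u by (simp add: power_divide max_def power2_le_iff_abs_le)
       (smt (verit) power_mono norm_ge_zero)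
  then show "sqrt 2 / 2 \<le> max (cmod z) (cmod w)"
    by (rule power2_le_imp_le) (simp add: le_max_iff_disj)
qed

lemma stab_cost_le:
  assumes k: "k > 0" and D: "D \<in> D_J1" and G: "G \<in> rot_stab D" and zw: "quat_of z w \<in> unit_quats"
    and R: "R ** S\<^sup>T = rot (quat_of z w)"
  shows "stab_cost k D \<Lambda> z w S \<le> SR_cost k D \<Lambda> (G\<^sup>T ** R) S"
proof -
  have RS: "G\<^sup>T ** R ** S\<^sup>T = G\<^sup>T ** rot (quat_of z w)" unfolding R[symmetric] by (simp add: matrix_mul_assoc)
  have "0 \<le> 2 * arccos (max (cmod z) (cmod w))"
    using max_cmod_unit[OF zw] by (intro mult_nonneg_nonneg arccos_lbound) (auto simp: le_max_iff_disj intro: order_trans[of _ 0])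
  then have "(2 * arccos (max (cmod z) (cmod w)))\<^sup>2 \<le> (rot_angle (G\<^sup>T ** R ** S\<^sup>T))\<^sup>2"
    unfolding RS using rot_stab_angle_ge[OF D G zw] by (intro power_mono)
  then have "4 * k * (arccos (max (cmod z) (cmod w)))\<^sup>2 \<le> k * (rot_angle (G\<^sup>T ** R ** S\<^sup>T))\<^sup>2"
    using mult_left_mono[of _ _ k] k by (fastforce simp: power_mult_distrib)
  then show ?thesis unfolding stab_cost_def SR_cost_def by simp
qed

lemma stab_cost_attained:
  assumes k: "k > 0" and D: "D \<in> D_J1" and zw: "quat_of z w \<in> unit_quats"
    and R: "R ** S\<^sup>T = rot (quat_of z w)"
  obtains G where "G \<in> rot_stab D" "stab_cost k D \<Lambda> z w S = SR_cost k D \<Lambda> (G\<^sup>T ** R) S"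
proof -
  obtain G where G: "G \<in> rot_stab D" "rot_angle (G\<^sup>T ** rot (quat_of z w)) = 2 * arccos (max (cmod z) (cmod w))"
    by (rule rot_stab_angle_attained[OF D zw])
  have "G\<^sup>T ** R ** S\<^sup>T = G\<^sup>T ** rot (quat_of z w)" unfolding R[symmetric] by (simp add: matrix_mul_assoc)
  then have "stab_cost k D \<Lambda> z w S = SR_cost k D \<Lambda> (G\<^sup>T ** R) S"
    unfolding stab_cost_def SR_cost_def using G(2) by (simp add: power_mult_distrib)
  then show ?thesis using that G(1) by blast
qed

text \<open>The half-angle formula \<open>cos (x/2)\<^sup>2 = (1 + cos x) / 2\<close>, read
  backwards.\<close>

lemma half_arccos:
  assumes "0 \<le> c" "c \<le> 1" "m \<ge> 0" "m\<^sup>2 = (1 + c) / 2"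
  shows "arccos m = 1 / 2 * arccos c"
proof -
  have a: "0 \<le> arccos c" "arccos c \<le> pi" using assms by (auto intro: arccos_lbound arccos_ubound)
  have "(cos (arccos c / 2))\<^sup>2 = m\<^sup>2"
    using cos_double_cos[of "arccos c / 2"] assms by (simp add: cos_arccos field_simps)
  moreover have "cos (arccos c / 2) \<ge> 0" using a by (intro cos_ge_zero) auto
  ultimately have "m = cos (arccos c / 2)" using assms(3) by (simp add: power2_eq_iff_nonneg)
  then show ?thesis using a by (simp add: arccos_cos)
qed

lemma two_cmod_mult_le_1:
  assumes "quat_of z w \<in> unit_quats"
  shows "2 * (cmod z * cmod w) \<le> 1"
  using assms sum_squares_bound[of "cmod z" "cmod w"] by (simp add: unit_quat_of)

lemma cmod_add_sub_unit:
  assumes "quat_of z w \<in> unit_quats"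
  shows "(cmod ((z + w) / sqrt 2))\<^sup>2 = (1 + 2 * Re (cnj z * w)) / 2"
    and "(cmod ((w - z) / sqrt 2))\<^sup>2 = (1 - 2 * Re (cnj z * w)) / 2"
proof -
  have "(Re z)\<^sup>2 + (Im z)\<^sup>2 + (Re w)\<^sup>2 + (Im w)\<^sup>2 = 1"
    using assms by (simp add: unit_quat_of cmod_power2)
  then show "(cmod ((z + w) / sqrt 2))\<^sup>2 = (1 + 2 * Re (cnj z * w)) / 2"
    and "(cmod ((w - z) / sqrt 2))\<^sup>2 = (1 - 2 * Re (cnj z * w)) / 2"
    by (simp_all add: norm_divide power_divide cmod_power2) (simp_all add: power2_eq_square algebra_simps)
qed

lemma unit_add_sub:
  assumes "quat_of z w \<in> unit_quats"
  shows "quat_of ((z + w) / sqrt 2) ((w - z) / sqrt 2) \<in> unit_quats"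
  using cmod_add_sub_unit[OF assms] by (simp add: unit_quat_of)

lemma arccos_max_add_sub:
  assumes "quat_of z w \<in> unit_quats"
  shows "arccos (max (cmod ((z + w) / sqrt 2)) (cmod ((w - z) / sqrt 2)))
       = 1 / 2 * arccos (2 * \<bar>Re (cnj z * w)\<bar>)"
proof (rule half_arccos)
  have "\<bar>Re (cnj z * w)\<bar> \<le> cmod z * cmod w"
    using abs_Re_le_cmod[of "cnj z * w"] by (simp add: norm_mult)
  then show "2 * \<bar>Re (cnj z * w)\<bar> \<le> 1" using two_cmod_mult_le_1[OF assms] by linarith
  let ?a = "cmod ((z + w) / sqrt 2)" and ?b = "cmod ((w - z) / sqrt 2)"
  note ab = cmod_add_sub_unit[OF assms]
  have "(max ?a ?b)\<^sup>2 = max (?a\<^sup>2) (?b\<^sup>2)"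
    by (simp add: max_def abs_le_square_iff[symmetric])
  also have "\<dots> = (1 + 2 * \<bar>Re (cnj z * w)\<bar>) / 2"
    unfolding ab by (simp add: max_def abs_if field_simps)
  finally show "(max ?a ?b)\<^sup>2 = (1 + 2 * \<bar>Re (cnj z * w)\<bar>) / 2" .
qed (simp_all add: le_max_iff_disj)

lemma arccos_in_0_pi4:
  assumes "sqrt 2 / 2 \<le> m" "m \<le> 1"
  shows "arccos m \<in> {0..pi/4}"
proof -
  have "arccos m \<le> arccos (cos (pi/4))"
    using assms unfolding cos_45 by (intro arccos_le_arccos) (auto intro: order_trans[of _ 0])
  moreover have "arccos m \<ge> 0"
  proof (rule arccos_lbound)
    have "0 \<le> sqrt 2 / 2" by simp
    then show "- 1 \<le> m" using assms by linarith
  qed (rule assms)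
  ultimately show ?thesis by (simp add: arccos_cos)
qed

text \<open>With \<open>\<phi> = arccos (max \<bar>z\<bar> \<bar>w\<bar>)\<close> the two moduli are
  \<open>cos \<phi>\<close> and \<open>sin \<phi>\<close>, and \<open>cos (\<pi>/4 - \<phi>) = (cos
  \<phi> + sin \<phi>) / sqrt 2\<close>.\<close>

lemma arccos_normalized_sum:
  assumes "quat_of z w \<in> unit_quats"
  shows "arccos ((cmod z + cmod w) / sqrt 2) = pi / 4 - arccos (max (cmod z) (cmod w))"
proof -
  let ?m = "max (cmod z) (cmod w)" and ?n = "min (cmod z) (cmod w)"
  have u: "(cmod z)\<^sup>2 + (cmod w)\<^sup>2 = 1" using assms by (simp add: unit_quat_of)
  have m: "0 \<le> ?m" "?m \<le> 1" using max_cmod_unit[OF assms] by (auto simp: le_max_iff_disj)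
  have \<phi>: "arccos ?m \<in> {0..pi/4}" using max_cmod_unit[OF assms] by (intro arccos_in_0_pi4)
  have "1 - ?m\<^sup>2 = ?n\<^sup>2" using u by (auto simp: max_def min_def)
  then have sin: "sin (arccos ?m) = ?n" using m by (simp add: sin_arccos)
  have cos: "cos (arccos ?m) = ?m" by (rule cos_arccos) (use m in linarith)+
  have "cos (pi / 4 - arccos ?m) = (?m + ?n) * (sqrt 2 / 2)"
    unfolding cos_diff cos sin cos_45 sin_45 by (simp add: algebra_simps)
  also have "?m + ?n = cmod z + cmod w" by (simp add: max_def min_def)
  also have "(cmod z + cmod w) * (sqrt 2 / 2) = (cmod z + cmod w) / sqrt 2"
    by (simp add: field_simps)
  finally have "arccos ((cmod z + cmod w) / sqrt 2) = arccos (cos (pi / 4 - arccos ?m))" by simp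
  also have "\<dots> = pi / 4 - arccos ?m" using \<phi> by (intro arccos_cos) auto
  finally show ?thesis .
qed

lemma Diag_pos_inv_commute:
  assumes "D \<in> Diag_pos" "\<Lambda> \<in> Diag_pos"
  shows "\<Lambda> ** matrix_inv D = matrix_inv D ** \<Lambda>"
proof -
  have "\<Lambda> ** D = D ** \<Lambda>" using assms by (auto simp: Diag_pos_iff diag_mult_diag mult.commute)
  then show ?thesis using matrix_inv_commute[OF assms(1)] by simp
qed

section \<open>The four cases\<close>

text \<open>Both stabilizers consist of signed permutations, so \<open>G\<close> and
  \<open>H\<close> are absorbed into \<open>S\<close>.\<close>

lemma d_SR_top_top:
  assumes k: "k > 0" and X: "(U, D) \<in> fiber X" "X \<in> S_top" and Y: "(V, \<Lambda>) \<in> fiber Y" "Y \<in> S_top"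
  shows "d_SR k X Y = Min (SR_cost k D \<Lambda> (U\<^sup>T ** V) ` S3_even)"
proof (rule d_SR_eq_MinI[OF k X(1) Y(1)])
  note x = fiberD[OF X(1)] and y = fiberD[OF Y(1)]
  obtain d l where dl: "D = diag d" "\<Lambda> = diag l" using x y by (auto simp: Diag_pos_iff)
  show "finite (SR_cost k D \<Lambda> (U\<^sup>T ** V) ` S3_even)" "SR_cost k D \<Lambda> (U\<^sup>T ** V) ` S3_even \<noteq> {}"
    using finite_S3_even mat_1_in_S3_even by auto
  show "\<exists>a\<in>SR_cost k D \<Lambda> (U\<^sup>T ** V) ` S3_even. a \<le> SR_cost k D \<Lambda> (G\<^sup>T ** (U\<^sup>T ** V) ** H) S"
    if G: "G \<in> rot_stab D" and H: "H \<in> rot_stab \<Lambda>" and S: "S \<in> S3_even" for G H S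
  proof -
    have GH: "G \<in> S3_even" "H\<^sup>T \<in> S3_even"
      using rot_stab_distinct S_top_fiber_distinct X Y G H dl S3_even_transpose by metis+
    have "SR_cost k D \<Lambda> (U\<^sup>T ** V) (G ** S ** H\<^sup>T) = SR_cost k D \<Lambda> (G\<^sup>T ** (U\<^sup>T ** V) ** H) S"
      using SR_cost_shift[OF x(2) y(2) S GH(1) G GH(2) rot_stab_transpose[OF H]] by simp
    moreover have "G ** S ** H\<^sup>T \<in> S3_even" using GH S S3_even_mult by blast
    ultimately show ?thesis by (metis image_eqI order_refl)
  qed
  show "\<exists>G\<in>rot_stab D. \<exists>H\<in>rot_stab \<Lambda>. \<exists>S\<in>S3_even. a = SR_cost k D \<Lambda> (G\<^sup>T ** (U\<^sup>T ** V) ** H) S"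
    if "a \<in> SR_cost k D \<Lambda> (U\<^sup>T ** V) ` S3_even" for a
  proof -
    obtain S where "S \<in> S3_even" "a = SR_cost k D \<Lambda> (U\<^sup>T ** V) S" using \<open>a \<in> _\<close> by blast
    then show ?thesis
      by (intro bexI[of _ "mat 1" "rot_stab D"] bexI[of _ "mat 1" "rot_stab \<Lambda>"] bexI[of _ S])
         (simp_all add: mat_1_in_rot_stab)
  qed
qed

text \<open>Here \<open>H\<close> is absorbed into \<open>S\<close>, while \<open>S\<close> is
  reduced to a coset representative whose remaining factor is absorbed into \<open>G\<close>;
  minimizing over \<open>G\<close> leaves \<open>stab_cost\<close>.\<close>

lemma d_SR_mid_top:
  assumes k: "k > 0" and X: "(U, D) \<in> fiber X" "D \<in> D_J1" and Y: "(V, \<Lambda>) \<in> fiber Y" "Y \<in> S_top"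
    and zw: "quat_of z w \<in> unit_quats" "rot (quat_of z w) = U\<^sup>T ** V"
  shows "d_SR k X Y = Min {stab_cost k D \<Lambda> z w (mat 1),
      stab_cost k D \<Lambda> ((z + w) / sqrt 2) ((w - z) / sqrt 2) P13,
      stab_cost k D \<Lambda> ((z - \<i> * w) / sqrt 2) ((w - \<i> * z) / sqrt 2) P12}" (is "_ = Min {?a1, ?a3, ?a2}")
proof (rule d_SR_eq_MinI[OF k X(1) Y(1)])
  note x = fiberD[OF X(1)] and y = fiberD[OF Y(1)]
  obtain l where l: "\<Lambda> = diag l" using y by (auto simp: Diag_pos_iff)
  let ?R = "U\<^sup>T ** V"
  have R1: "?R ** (mat 1)\<^sup>T = rot (quat_of z w)" using zw by simp
  have R3: "?R ** P13\<^sup>T = rot (quat_of ((z + w) / sqrt 2) ((w - z) / sqrt 2))"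
    and R2: "?R ** P12\<^sup>T = rot (quat_of ((z - \<i> * w) / sqrt 2) ((w - \<i> * z) / sqrt 2))"
    unfolding zw(2)[symmetric] by (rule rot_mult_quarter_turn_transpose)+
  have unit: "quat_of ((z + w) / sqrt 2) ((w - z) / sqrt 2) \<in> unit_quats"
    "quat_of ((z - \<i> * w) / sqrt 2) ((w - \<i> * z) / sqrt 2) \<in> unit_quats"
    using unit_add_sub[OF zw(1)] unit_quats_mult[OF zw(1), of "quat_of (1 / sqrt 2) (- \<i> / sqrt 2)"]
    by (simp_all add: qmult_quat_of) (simp add: unit_quat_of norm_divide power_divide field_simps)
  show "\<exists>a\<in>{?a1, ?a3, ?a2}. a \<le> SR_cost k D \<Lambda> (G\<^sup>T ** ?R ** H) S"
    if G: "G \<in> rot_stab D" and H: "H \<in> rot_stab \<Lambda>" and S: "S \<in> S3_even" for G H S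
  proof -
    have H': "H\<^sup>T \<in> S3_even"
      using rot_stab_distinct S_top_fiber_distinct Y H l S3_even_transpose by metis
    define S' where "S' = S ** H\<^sup>T"
    have S': "S' \<in> S3_even" using S H' S3_even_mult by (simp add: S'_def)
    have "SR_cost k D \<Lambda> (G\<^sup>T ** ?R) (mat 1 ** S ** H\<^sup>T) = SR_cost k D \<Lambda> (G\<^sup>T ** ?R ** H) S"
      using SR_cost_shift[OF x(2) y(2) S mat_1_in_S3_even mat_1_in_rot_stab H' rot_stab_transpose[OF H]] by simp
    then have eq: "SR_cost k D \<Lambda> (G\<^sup>T ** ?R ** H) S = SR_cost k D \<Lambda> (G\<^sup>T ** ?R) S'"
      by (simp add: S'_def)
    obtain \<pi> where \<pi>: "signed_perm S' \<pi>" "\<pi> permutes UNIV" using S3_evenE[OF S'] by blast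
    have *: "\<exists>a\<in>{?a1, ?a3, ?a2}. a \<le> SR_cost k D \<Lambda> (G\<^sup>T ** ?R) S'"
      if Q: "Q \<in> S3_even" "signed_perm Q \<sigma>" "\<pi> (inv \<sigma> 1) = 1" and "a \<in> {?a1, ?a3, ?a2}"
        and uv: "a = stab_cost k D \<Lambda> u v Q" "quat_of u v \<in> unit_quats" "?R ** Q\<^sup>T = rot (quat_of u v)" for Q \<sigma> a u v
    proof -
      obtain K where K: "K \<in> S3_even" "K \<in> rot_stab D" "S' = K ** Q"
        using S3_even_coset[OF S' \<pi>(1) Q X(2)] by blast
      have "SR_cost k D \<Lambda> (G\<^sup>T ** ?R) (K ** Q ** mat 1) = SR_cost k D \<Lambda> (K\<^sup>T ** (G\<^sup>T ** ?R) ** (mat 1)\<^sup>T) Q"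
        by (rule SR_cost_shift[OF x(2) y(2) Q(1) K(1,2) mat_1_in_S3_even mat_1_in_rot_stab])
      then have "SR_cost k D \<Lambda> (G\<^sup>T ** ?R) S' = SR_cost k D \<Lambda> ((G ** K)\<^sup>T ** ?R) Q"
        by (simp add: K matrix_transpose_mul matrix_mul_assoc)
      moreover have "stab_cost k D \<Lambda> u v Q \<le> SR_cost k D \<Lambda> ((G ** K)\<^sup>T ** ?R) Q"
        by (rule stab_cost_le[OF k X(2) rot_stab_mult[OF G K(2)] uv(2,3)])
      ultimately show ?thesis using that by auto
    qed
    have id: "signed_perm (mat 1) id"
      by (rule signed_permI) (auto simp: mat_def permutes_id)
    consider "\<pi> 1 = 1" | "\<pi> 3 = 1" | "\<pi> 2 = 1"
      using permutes_surj[OF \<pi>(2)] by (metis exhaust_3 surjD)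
    then have "\<exists>a\<in>{?a1, ?a3, ?a2}. a \<le> SR_cost k D \<Lambda> (G\<^sup>T ** ?R) S'"
    proof cases
      case 1 then show ?thesis
        by (intro *[OF mat_1_in_S3_even id _ _ refl zw(1) R1]) simp_all
    next
      case 2 then show ?thesis
        by (intro *[OF quarter_turns_in_S3_even(1) signed_perm_transpositions(1) _ _ refl unit(1) R3]) simp_all
    next
      case 3 then show ?thesis
        by (intro *[OF quarter_turns_in_S3_even(2) signed_perm_transpositions(2) _ _ refl unit(2) R2]) simp_all
    qed
    then show ?thesis unfolding eq .
  qed
  show "\<exists>G\<in>rot_stab D. \<exists>H\<in>rot_stab \<Lambda>. \<exists>S\<in>S3_even. a = SR_cost k D \<Lambda> (G\<^sup>T ** ?R ** H) S"
    if a: "a \<in> {?a1, ?a3, ?a2}" for a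
  proof -
    obtain u v Q where uv: "a = stab_cost k D \<Lambda> u v Q" "quat_of u v \<in> unit_quats"
      "?R ** Q\<^sup>T = rot (quat_of u v)" "Q \<in> S3_even"
      using a zw(1) unit R1 R2 R3 mat_1_in_S3_even quarter_turns_in_S3_even by blast
    obtain G where "G \<in> rot_stab D" "stab_cost k D \<Lambda> u v Q = SR_cost k D \<Lambda> (G\<^sup>T ** ?R) Q"
      by (rule stab_cost_attained[OF k X(2) uv(2,3)])
    then show ?thesis
      using uv mat_1_in_rot_stab[of \<Lambda>] by (metis matrix_mul_rid)
  qed
qed simp_all

text \<open>Right multiplication by a stabilizer element multiplies \<open>z\<close> and
  \<open>w\<close> by phases or exchanges them up to phases.\<close>

lemma rot_stab_mult_right:
  assumes L: "\<Lambda> \<in> D_J1" and H: "H \<in> rot_stab \<Lambda>" and zw: "quat_of z w \<in> unit_quats"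
  obtains z' w' where "rot (quat_of z w) ** H = rot (quat_of z' w')" "quat_of z' w' \<in> unit_quats"
    "max (cmod z') (cmod w') = max (cmod z) (cmod w)" "cmod z' + cmod w' = cmod z + cmod w"
proof -
  obtain u v where uv: "H = rot (quat_of u v)" "quat_of u v \<in> unit_quats" "u = 0 \<or> v = 0"
    by (rule rot_stab_D_J1E[OF L H])
  have n: "u = 0 \<and> cmod v = 1 \<or> v = 0 \<and> cmod u = 1"
    using uv(2,3) by (auto simp: unit_quat_of abs_square_eq_1)
  show ?thesis
  proof (rule that[of "z * u - w * cnj v" "z * v + w * cnj u"])
    show "rot (quat_of z w) ** H = rot (quat_of (z * u - w * cnj v) (z * v + w * cnj u))"
      by (simp add: uv(1) rot_qmult[symmetric] qmult_quat_of)
    show "quat_of (z * u - w * cnj v) (z * v + w * cnj u) \<in> unit_quats"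
      using unit_quats_mult[OF zw uv(2)] by (simp add: qmult_quat_of)
  qed (use n in \<open>auto simp: norm_mult max.commute\<close>)
qed

text \<open>Multiplication by the phase \<open>h\<close> turns \<open>z\<close> by \<open>h\<close>
  and \<open>w\<close> by \<open>cnj h\<close>; half the difference of the arguments brings both to
  the common direction halfway between them.\<close>

lemma rot_stab_align:
  assumes L: "\<Lambda> \<in> D_J1" and zw: "quat_of z w \<in> unit_quats"
  obtains H z' w' where "H \<in> rot_stab \<Lambda>" "rot (quat_of z w) ** H = rot (quat_of z' w')"
    "quat_of z' w' \<in> unit_quats" "cmod z' + cmod w' = cmod z + cmod w" "cmod (z' + w') = cmod z + cmod w"
proof -
  define h where "h = cis ((Arg w - Arg z) / 2)"
  define s where "s = cis ((Arg z + Arg w) / 2)"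
  have h: "quat_of h 0 \<in> unit_quats" by (simp add: unit_quat_of h_def)
  have z: "z * h = of_real (cmod z) * s"
  proof -
    have "z * h = of_real (cmod z) * (cis (Arg z) * h)"
      using rcis_cmod_Arg[of z] by (metis mult.assoc rcis_def)
    also have "cis (Arg z) * h = s" by (simp add: h_def s_def cis_mult field_simps)
    finally show ?thesis .
  qed
  have w: "w * cnj h = of_real (cmod w) * s"
  proof -
    have "w * cnj h = of_real (cmod w) * (cis (Arg w) * cnj h)"
      using rcis_cmod_Arg[of w] by (metis mult.assoc rcis_def)
    also have "cis (Arg w) * cnj h = s" by (simp add: h_def s_def cis_mult cis_cnj field_simps)
    finally show ?thesis .
  qed
  show ?thesis
  proof (rule that[of "rot (quat_of h 0)" "z * h" "w * cnj h"])
    show "rot (quat_of h 0) \<in> rot_stab \<Lambda>" using rot_stab_D_J1_iff[OF L h] by simp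
    show "rot (quat_of z w) ** rot (quat_of h 0) = rot (quat_of (z * h) (w * cnj h))"
      by (simp add: rot_qmult[symmetric] qmult_quat_of)
    show "quat_of (z * h) (w * cnj h) \<in> unit_quats"
      using unit_quats_mult[OF zw h] by (simp add: qmult_quat_of)
    show "cmod (z * h) + cmod (w * cnj h) = cmod z + cmod w"
      by (simp add: norm_mult h_def)
    have "z * h + w * cnj h = of_real (cmod z + cmod w) * s"
      unfolding z w by (simp add: algebra_simps)
    also have "cmod \<dots> = cmod z + cmod w"
      unfolding norm_mult norm_of_real by (simp add: s_def)
    finally show "cmod (z * h + w * cnj h) = cmod z + cmod w" .
  qed
qed

text \<open>For the trivial coset the second stabilizer does not change \<open>max \<bar>z\<bar>
  \<bar>w\<bar>\<close>. For (13) the cost is governed by \<open>max \<bar>z + w\<bar> \<bar>w -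
  z\<bar> / sqrt 2\<close>, which is at most \<open>(\<bar>z\<bar> + \<bar>w\<bar>) / sqrt
  2\<close>, and the second stabilizer can align \<open>z\<close> and \<open>w\<close> to reach this
  bound. The remaining coset is that of (13) multiplied on the right by (23), which fixes
  \<open>\<Lambda>\<close>.\<close>

lemma d_SR_mid_mid:
  assumes k: "k > 0" and X: "(U, D) \<in> fiber X" "D \<in> D_J1" and Y: "(V, \<Lambda>) \<in> fiber Y" "\<Lambda> \<in> D_J1"
    and zw: "quat_of z w \<in> unit_quats" "rot (quat_of z w) = U\<^sup>T ** V"
  shows "d_SR k X Y = Min {stab_cost k D \<Lambda> z w (mat 1),
      sqrt (4 * k * (pi / 4 - arccos (max (cmod z) (cmod w)))\<^sup>2
        + (norm (log_Diag (matrix_inv D ** (P13 ** \<Lambda> ** P13\<^sup>T))))\<^sup>2)}" (is "_ = Min {?a1, ?a3}")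
proof (rule d_SR_eq_MinI[OF k X(1) Y(1)])
  note x = fiberD[OF X(1)] and y = fiberD[OF Y(1)]
  let ?R = "U\<^sup>T ** V" and ?m = "(cmod z + cmod w) / sqrt 2"
  have a3: "?a3 = sqrt (4 * k * (arccos ?m)\<^sup>2 + (norm (log_Diag (matrix_inv D ** (P13 ** \<Lambda> ** P13\<^sup>T))))\<^sup>2)"
    by (simp add: arccos_normalized_sum[OF zw(1)])
  have le1: "?a1 \<le> SR_cost k D \<Lambda> (G\<^sup>T ** ?R ** H) (mat 1)"
    if G: "G \<in> rot_stab D" and H: "H \<in> rot_stab \<Lambda>" for G H
  proof -
    obtain z' w' where q: "rot (quat_of z w) ** H = rot (quat_of z' w')" "quat_of z' w' \<in> unit_quats"
      "max (cmod z') (cmod w') = max (cmod z) (cmod w)" "cmod z' + cmod w' = cmod z + cmod w"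
      by (rule rot_stab_mult_right[OF Y(2) H zw(1)])
    have "?R ** H ** (mat 1)\<^sup>T = rot (quat_of z' w')" using q zw by simp
    from stab_cost_le[OF k X(2) G q(2) this]
    show ?thesis by (simp add: stab_cost_def q(3) matrix_mul_assoc)
  qed
  have le3: "?a3 \<le> SR_cost k D \<Lambda> (G\<^sup>T ** ?R ** H) P13"
    if G: "G \<in> rot_stab D" and H: "H \<in> rot_stab \<Lambda>" for G H
  proof -
    obtain z' w' where q: "rot (quat_of z w) ** H = rot (quat_of z' w')" "quat_of z' w' \<in> unit_quats"
      "max (cmod z') (cmod w') = max (cmod z) (cmod w)" "cmod z' + cmod w' = cmod z + cmod w"
      by (rule rot_stab_mult_right[OF Y(2) H zw(1)])
    let ?u = "(z' + w') / sqrt 2" and ?v = "(w' - z') / sqrt 2"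
    have RH: "?R ** H ** P13\<^sup>T = rot (quat_of ?u ?v)"
      unfolding zw(2)[symmetric] q(1) by (rule rot_mult_quarter_turn_transpose)
    have uv: "quat_of ?u ?v \<in> unit_quats" by (rule unit_add_sub[OF q(2)])
    have "cmod ?u \<le> ?m" "cmod ?v \<le> ?m"
      using norm_triangle_ineq[of z' w'] norm_triangle_ineq4[of w' z'] q(4)
      by (simp_all add: norm_divide divide_right_mono)
    then have max: "max (cmod ?u) (cmod ?v) \<le> ?m" by simp
    have m1: "?m \<le> 1"
    proof -
      have "(cmod z + cmod w)\<^sup>2 \<le> (sqrt 2)\<^sup>2"
        using two_cmod_mult_le_1[OF zw(1)] zw(1) by (simp add: unit_quat_of power2_sum)
      then have "cmod z + cmod w \<le> sqrt 2" by (rule power2_le_imp_le) simp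
      then show ?thesis by simp
    qed
    have "- 1 \<le> max (cmod ?u) (cmod ?v)" by (rule order_trans[of _ 0]) (simp_all add: le_max_iff_disj)
    then have "arccos ?m \<le> arccos (max (cmod ?u) (cmod ?v))"
      using max m1 by (intro arccos_le_arccos)
    moreover have "0 \<le> arccos ?m"
      using m1 by (intro arccos_lbound) (rule order_trans[of _ 0]; simp)
    ultimately have "(arccos ?m)\<^sup>2 \<le> (arccos (max (cmod ?u) (cmod ?v)))\<^sup>2" by (rule power_mono)
    then have "?a3 \<le> stab_cost k D \<Lambda> ?u ?v P13"
      unfolding a3 stab_cost_def using k by (intro real_sqrt_le_mono add_mono mult_left_mono) simp_all
    also have "\<dots> \<le> SR_cost k D \<Lambda> (G\<^sup>T ** (?R ** H)) P13"
      by (rule stab_cost_le[OF k X(2) G uv RH])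
    finally show ?thesis by (simp add: matrix_mul_assoc)
  qed
  show "\<exists>a\<in>{?a1, ?a3}. a \<le> SR_cost k D \<Lambda> (G\<^sup>T ** ?R ** H) S"
    if G: "G \<in> rot_stab D" and H: "H \<in> rot_stab \<Lambda>" and S: "S \<in> S3_even" for G H S
  proof -
    have shift: "SR_cost k D \<Lambda> (G\<^sup>T ** ?R ** H) (K ** Q ** J) = SR_cost k D \<Lambda> ((G ** K)\<^sup>T ** ?R ** (H ** J\<^sup>T)) Q"
      if "Q \<in> S3_even" "K \<in> S3_even" "K \<in> rot_stab D" "J \<in> S3_even" "J \<in> rot_stab \<Lambda>" for K Q J
      using SR_cost_shift[OF x(2) y(2) that(1,2,3,4,5)] by (simp add: matrix_transpose_mul matrix_mul_assoc)
    obtain \<pi> where \<pi>: "signed_perm S \<pi>" "\<pi> permutes UNIV" using S3_evenE[OF S] by blast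
    have id: "signed_perm (mat 1) id"
      by (rule signed_permI) (auto simp: mat_def permutes_id)
    note one = mat_1_in_S3_even mat_1_in_rot_stab
    consider "\<pi> 1 = 1" | "\<pi> 3 = 1" | "\<pi> 2 = 1"
      using permutes_surj[OF \<pi>(2)] by (metis exhaust_3 surjD)
    then show ?thesis
    proof cases
      case 1
      obtain K where K: "K \<in> S3_even" "K \<in> rot_stab D" "S = K ** mat 1"
        using S3_even_coset[OF S \<pi>(1) mat_1_in_S3_even id _ X(2)] 1 by auto
      have "?a1 \<le> SR_cost k D \<Lambda> (G\<^sup>T ** ?R ** H) (K ** mat 1 ** mat 1)"
        unfolding shift[OF one(1) K(1,2) one] using G H K by (intro le1 rot_stab_mult) (simp_all add: one)
      then show ?thesis using K(3) by simp
    next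
      case 2
      obtain K where K: "K \<in> S3_even" "K \<in> rot_stab D" "S = K ** P13"
        using S3_even_coset[OF S \<pi>(1) quarter_turns_in_S3_even(1) signed_perm_transpositions(1) _ X(2)] 2 by auto
      have "?a3 \<le> SR_cost k D \<Lambda> (G\<^sup>T ** ?R ** H) (K ** P13 ** mat 1)"
        unfolding shift[OF quarter_turns_in_S3_even(1) K(1,2) one] using G H K by (intro le3 rot_stab_mult) (simp_all add: one)
      then show ?thesis using K(3) by simp
    next
      case 3
      have J: "P23 \<in> S3_even" "P23 \<in> rot_stab \<Lambda>"
        using quarter_turns_in_S3_even S3_even_rot_stab_D_J1[OF Y(2) _ signed_perm_transpositions(3)] by auto
      have PJ: "P13 ** P23 \<in> S3_even"
        "signed_perm (P13 ** P23) (Transposition.transpose 1 3 \<circ> Transposition.transpose 2 3)"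
        using quarter_turns_in_S3_even S3_even_mult signed_perm_mult signed_perm_transpositions by blast+
      have "inv (Transposition.transpose 1 3 \<circ> Transposition.transpose 2 3) (1::3) = 2"
        by (rule inv_f_eq) (auto simp: inj_compose Transposition.transpose_def)
      then obtain K where K: "K \<in> S3_even" "K \<in> rot_stab D" "S = K ** (P13 ** P23)"
        using S3_even_coset[OF S \<pi>(1) PJ _ X(2)] 3 by auto
      have "?a3 \<le> SR_cost k D \<Lambda> (G\<^sup>T ** ?R ** H) (K ** P13 ** P23)"
        unfolding shift[OF quarter_turns_in_S3_even(1) K(1,2) J] using G H K J
        by (intro le3 rot_stab_mult rot_stab_transpose) simp_all
      then show ?thesis using K(3) by (simp add: matrix_mul_assoc)
    qed
  qed
  show "\<exists>G\<in>rot_stab D. \<exists>H\<in>rot_stab \<Lambda>. \<exists>S\<in>S3_even. a = SR_cost k D \<Lambda> (G\<^sup>T ** ?R ** H) S"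
    if "a \<in> {?a1, ?a3}" for a
  proof -
    from that consider "a = ?a1" | "a = ?a3" by blast
    then show ?thesis
    proof cases
      case 1
      have "?R ** (mat 1)\<^sup>T = rot (quat_of z w)" using zw by simp
      then obtain G where "G \<in> rot_stab D" "?a1 = SR_cost k D \<Lambda> (G\<^sup>T ** ?R) (mat 1)"
        by (rule stab_cost_attained[OF k X(2) zw(1)])
      then show ?thesis
        using 1 mat_1_in_rot_stab[of \<Lambda>] mat_1_in_S3_even by (metis matrix_mul_rid)
    next
      case 2
      obtain H z' w' where q: "H \<in> rot_stab \<Lambda>" "rot (quat_of z w) ** H = rot (quat_of z' w')"
        "quat_of z' w' \<in> unit_quats" "cmod z' + cmod w' = cmod z + cmod w" "cmod (z' + w') = cmod z + cmod w"
        by (rule rot_stab_align[OF Y(2) zw(1)])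
      let ?u = "(z' + w') / sqrt 2" and ?v = "(w' - z') / sqrt 2"
      have RH: "?R ** H ** P13\<^sup>T = rot (quat_of ?u ?v)"
        unfolding zw(2)[symmetric] q(2) by (rule rot_mult_quarter_turn_transpose)
      have uv: "quat_of ?u ?v \<in> unit_quats" by (rule unit_add_sub[OF q(3)])
      have "cmod (w' - z') \<le> cmod (z' + w')" using norm_triangle_ineq4[of w' z'] q(4,5) by simp
      then have "max (cmod ?u) (cmod ?v) = ?m"
        using q(5) by (simp add: norm_divide max_absorb1 divide_right_mono)
      then have "?a3 = stab_cost k D \<Lambda> ?u ?v P13" unfolding a3 stab_cost_def by simp
      moreover obtain G where "G \<in> rot_stab D" "stab_cost k D \<Lambda> ?u ?v P13 = SR_cost k D \<Lambda> (G\<^sup>T ** (?R ** H)) P13"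
        by (rule stab_cost_attained[OF k X(2) uv RH])
      ultimately show ?thesis
        using 2 q(1) quarter_turns_in_S3_even(1) by (metis matrix_mul_assoc)
    qed
  qed
qed simp_all

lemma rot_angle_mat_1: "rot_angle (mat 1) = 0"
  by (simp add: rot_angle_def trace_def mat_def sum_3)

text \<open>Every rotation commutes with the scalar matrix \<open>D\<close>, so \<open>G = U\<^sup>T
  V\<close> cancels the rotation and every matching of the eigenvalues costs the same.\<close>

lemma d_SR_bot:
  assumes k: "k > 0" and X: "(U, D) \<in> fiber X" "X \<in> S_bot" and Y: "(V, \<Lambda>) \<in> fiber Y"
  shows "d_SR k X Y = norm (log_Diag (matrix_inv D ** \<Lambda>))"
proof -
  note x = fiberD[OF X(1)] and y = fiberD[OF Y]
  obtain d where d: "D = diag d" using x by (auto simp: Diag_pos_iff)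
  have const: "d $ i = d $ j" for i j using S_bot_fiber_constant X d by blast
  have comm: "G ** D = D ** G" for G
    unfolding d using const by (simp add: vec_eq_iff matrix_mult_diag_nth diag_mult_matrix_nth mult.commute)
  have stab: "G \<in> rot_stab D \<longleftrightarrow> G \<in> SO" for G using comm by (auto simp: rot_stab_def)
  let ?a = "norm (log_Diag (matrix_inv D ** \<Lambda>))"
  have "d_SR k X Y = Min {?a}"
  proof (rule d_SR_eq_MinI[OF k X(1) Y])
    show "\<exists>a\<in>{?a}. a \<le> SR_cost k D \<Lambda> (G\<^sup>T ** (U\<^sup>T ** V) ** H) S"
      if G: "G \<in> rot_stab D" and H: "H \<in> rot_stab \<Lambda>" and S: "S \<in> S3_even" for G H S
    proof -
      have SD: "matrix_inv D ** S = S ** matrix_inv D" by (rule matrix_inv_commute[OF x(2) comm])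
      have "matrix_inv D ** (S ** \<Lambda> ** S\<^sup>T) = (matrix_inv D ** S) ** \<Lambda> ** S\<^sup>T"
        by (simp add: matrix_mul_assoc)
      also have "\<dots> = S ** (matrix_inv D ** \<Lambda>) ** S\<^sup>T" unfolding SD by (simp add: matrix_mul_assoc)
      finally have "norm (log_Diag (matrix_inv D ** (S ** \<Lambda> ** S\<^sup>T))) = ?a"
        using matrix_inv_diag_mult_in_Diag[OF x(2) y(2)] norm_log_Diag_conj[OF S] by auto
      then show ?thesis using k by (simp add: SR_cost_def real_le_rsqrt)
    qed
    show "\<exists>G\<in>rot_stab D. \<exists>H\<in>rot_stab \<Lambda>. \<exists>S\<in>S3_even. a = SR_cost k D \<Lambda> (G\<^sup>T ** (U\<^sup>T ** V) ** H) S"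
      if a: "a \<in> {?a}" for a
    proof (intro bexI)
      have UV: "U\<^sup>T ** V \<in> SO" using x y by (simp add: SO_mult SO_transpose)
      then have "rot_angle ((U\<^sup>T ** V)\<^sup>T ** (U\<^sup>T ** V) ** mat 1 ** (mat 1)\<^sup>T) = 0"
        by (simp add: SO_iff rot_angle_mat_1)
      then show "a = SR_cost k D \<Lambda> ((U\<^sup>T ** V)\<^sup>T ** (U\<^sup>T ** V) ** mat 1) (mat 1)"
        using a by (simp add: SR_cost_def)
      show "U\<^sup>T ** V \<in> rot_stab D" using UV stab by blast
    qed (simp_all add: mat_1_in_rot_stab mat_1_in_S3_even)
  qed simp_all
  then show ?thesis by simp
qed

lemma norm_log_quotient_power2:
  fixes D \<Lambda> :: "real^3^3"
  assumes "D = diag (vector [d1, d2, d3])" "\<Lambda> = diag (vector [l1, l2, l3])" "D \<in> Diag_pos" "\<Lambda> \<in> Diag_pos"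
  shows "(norm (log_Diag (matrix_inv D ** \<Lambda>)))\<^sup>2 =
     (ln l1 - ln d1)\<^sup>2 + (ln l2 - ln d2)\<^sup>2 + (ln l3 - ln d3)\<^sup>2"
proof -
  have p: "\<forall>i. (vector [d1, d2, d3] :: real^3) $ i > 0" "\<forall>i. (vector [l1, l2, l3] :: real^3) $ i > 0"
    using assms by (auto simp: Diag_pos_iff)
  have "log_Diag (matrix_inv D ** \<Lambda>) = diag (ln_vec (vector [l1, l2, l3]) - ln_vec (vector [d1, d2, d3]))"
    unfolding assms(1,2) by (rule log_Diag_quotient) (use p in blast)+
  then show ?thesis
    by (simp add: norm_diag power2_norm_eq_inner inner_vec_def sum_3 ln_vec_def vector_3)
       (simp add: power2_eq_square)
qed

lemma perm_act_vector_3: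
  "perm_act (Transposition.transpose 1 3) (diag (vector [l1, l2, l3])) = diag (vector [l3, l2, l1])"
  "perm_act (Transposition.transpose 1 2) (diag (vector [l1, l2, l3])) = diag (vector [l2, l1, l3])"
  by (simp_all add: perm_act_def diag_nth vec_eq_iff forall_3 vector_3 Transposition.transpose_def)

lemma perm_act_Diag_pos:
  assumes "\<Lambda> \<in> Diag_pos"
  shows "perm_act \<pi> \<Lambda> \<in> Diag_pos"
  using assms by (auto simp: perm_act_def Diag_pos_iff diag_nth)

lemma d_SR_top_top_formula:
  assumes k: "k > 0" and X: "(U, D) \<in> fiber X" "X \<in> S_top" and Y: "(V, \<Lambda>) \<in> fiber Y" "Y \<in> S_top"
  shows "(d_SR k X Y)\<^sup>2 =
          Min ((\<lambda>P. k / 2 * (norm (log_SO (matrix_inv U ** V ** matrix_inv P)))\<^sup>2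
                    + (norm (log_Diag (matrix_inv D ** perm_act (perm_of P) \<Lambda>)))\<^sup>2) ` S3_even)"
    (is "_ = Min (?f ` S3_even)")
proof -
  note x = fiberD[OF X(1)] and y = fiberD[OF Y(1)]
  let ?c = "SR_cost k D \<Lambda> (U\<^sup>T ** V)"
  have f: "?f P = (?c P)\<^sup>2" if P: "P \<in> S3_even" for P
  proof -
    obtain \<pi> where \<pi>: "signed_perm P \<pi>" "P \<in> SO" using S3_evenE[OF P] by blast
    have "U\<^sup>T ** V ** P\<^sup>T \<in> SO" using x y \<pi> by (simp add: SO_mult SO_transpose)
    then show ?thesis
      using k \<pi> x y by (simp add: matrix_inv_SO norm_log_SO power_mult_distrib perm_of_eq perm_act_eq_conj SR_cost_def)
  qed
  have fin: "finite (?c ` S3_even)" "?c ` S3_even \<noteq> {}" using finite_S3_even mat_1_in_S3_even by auto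
  have d: "d_SR k X Y = Min (?c ` S3_even)" by (rule d_SR_top_top[OF k X Y])
  have c0: "0 \<le> ?c P" for P using k by (simp add: SR_cost_def)
  have "Min (?f ` S3_even) = (d_SR k X Y)\<^sup>2"
  proof (rule Min_eqI)
    show "finite (?f ` S3_even)" using finite_S3_even by simp
    obtain P where P: "P \<in> S3_even" "d_SR k X Y = ?c P" using Min_in[OF fin] d by auto
    then show "(d_SR k X Y)\<^sup>2 \<in> ?f ` S3_even" using f by (metis (no_types, lifting) image_eqI)
    fix t assume "t \<in> ?f ` S3_even"
    then obtain Q where Q: "Q \<in> S3_even" "t = (?c Q)\<^sup>2" using f by auto
    have "d_SR k X Y \<le> ?c Q" using d fin Q by simp
    then show "(d_SR k X Y)\<^sup>2 \<le> t" unfolding Q(2) using P c0 by (intro power_mono) simp_all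
  qed
  then show ?thesis by simp
qed

text \<open>Replacing \<open>w\<close> by \<open>-\<i> * w\<close> reduces the transposition (12) to
  the formula for (13) and turns the real part of \<open>cnj z * w\<close> into its imaginary
  part.\<close>

lemma arccos_max_sub_i:
  assumes "quat_of z w \<in> unit_quats"
  shows "arccos (max (cmod ((z - \<i> * w) / sqrt 2)) (cmod ((w - \<i> * z) / sqrt 2)))
       = 1 / 2 * arccos (2 * \<bar>Im (cnj z * w)\<bar>)"
proof -
  have "quat_of z (- \<i> * w) \<in> unit_quats" using assms by (simp add: unit_quat_of norm_mult)
  note a = arccos_max_add_sub[OF this]
  have "w - \<i> * z = \<i> * (- \<i> * w - z)" by (simp add: algebra_simps)
  then have "cmod (w - \<i> * z) = cmod (- \<i> * w - z)" by (metis mult_1 norm_ii norm_mult)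
  then have "cmod ((w - \<i> * z) / sqrt 2) = cmod ((- \<i> * w - z) / sqrt 2)" by (simp only: norm_divide)
  moreover have "z - \<i> * w = z + - \<i> * w" by simp
  moreover have "Re (cnj z * (- \<i> * w)) = Im (cnj z * w)" by simp
  ultimately show ?thesis using a by metis
qed

lemma arccos_half_in_0_pi4:
  assumes "2 * \<bar>x\<bar> \<le> 1"
  shows "1 / 2 * arccos (2 * \<bar>x\<bar>) \<in> {0..pi / 4}"
proof -
  have "0 \<le> arccos (2 * \<bar>x\<bar>)" using assms by (intro arccos_lbound) auto
  moreover have "arccos (2 * \<bar>x\<bar>) \<le> pi / 2" using assms by (intro arccos_le_pi2) auto
  ultimately show ?thesis by simp
qed

text \<open>Exchanging two eigenvalues of \<open>\<Lambda>\<close> keeps the squares and only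
  changes the mixed products \<open>ln \<lambda>\<^sub>i * ln d\<^sub>i\<close>.\<close>

lemma power2_norm_log_differences:
  fixes D \<Lambda> :: "real^3^3"
  assumes D: "D = diag (vector [d1, d2, d2])" and L: "\<Lambda> = diag (vector [l1, l2, l3])"
    and pos: "D \<in> Diag_pos" "\<Lambda> \<in> Diag_pos"
  defines "N \<equiv> \<lambda>L. (norm (log_Diag (L ** matrix_inv D)))\<^sup>2"
  shows "N \<Lambda> - N (perm_act (Transposition.transpose 1 3) \<Lambda>) = - 2 * ln (d1 / d2) * ln (l1 / l3)"
    and "N \<Lambda> - N (perm_act (Transposition.transpose 1 2) \<Lambda>) = - 2 * ln (d1 / d2) * ln (l1 / l2)"
    and "N (perm_act (Transposition.transpose 1 3) \<Lambda>) - N (perm_act (Transposition.transpose 1 2) \<Lambda>)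
      = 2 * ln (d1 / d2) * ln (l2 / l3)"
proof -
  have p: "d1 > 0" "d2 > 0" "l1 > 0" "l2 > 0" "l3 > 0"
    using pos by (auto simp: D L Diag_pos_iff forall_3 vector_3)
  note perm = perm_act_vector_3[of l1 l2 l3, folded L]
  have N: "N \<Lambda> = (ln l1 - ln d1)\<^sup>2 + (ln l2 - ln d2)\<^sup>2 + (ln l3 - ln d2)\<^sup>2"
    "N (perm_act (Transposition.transpose 1 3) \<Lambda>) = (ln l3 - ln d1)\<^sup>2 + (ln l2 - ln d2)\<^sup>2 + (ln l1 - ln d2)\<^sup>2"
    "N (perm_act (Transposition.transpose 1 2) \<Lambda>) = (ln l2 - ln d1)\<^sup>2 + (ln l1 - ln d2)\<^sup>2 + (ln l3 - ln d2)\<^sup>2"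
    unfolding N_def
    using norm_log_quotient_power2[OF D L pos] norm_log_quotient_power2[OF D perm(1) pos(1) perm_act_Diag_pos[OF pos(2)]]
    norm_log_quotient_power2[OF D perm(2) pos(1) perm_act_Diag_pos[OF pos(2)]]
    by (simp_all add: Diag_pos_inv_commute pos perm_act_Diag_pos)
  show "N \<Lambda> - N (perm_act (Transposition.transpose 1 3) \<Lambda>) = - 2 * ln (d1 / d2) * ln (l1 / l3)"
    and "N \<Lambda> - N (perm_act (Transposition.transpose 1 2) \<Lambda>) = - 2 * ln (d1 / d2) * ln (l1 / l2)"
    and "N (perm_act (Transposition.transpose 1 3) \<Lambda>) - N (perm_act (Transposition.transpose 1 2) \<Lambda>)
      = 2 * ln (d1 / d2) * ln (l2 / l3)"
    unfolding N using p by (simp_all add: ln_div power2_eq_square algebra_simps)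
qed

lemma d_SR_mid_top_formula:
  assumes k: "k > 0" and X: "(U, D) \<in> fiber X" "D \<in> D_J1" and Y: "(V, \<Lambda>) \<in> fiber Y" "Y \<in> S_top"
    and zw: "quat_of z w \<in> unit_quats" "rot (quat_of z w) = matrix_inv U ** V"
  shows "(let \<phi> = arccos (max (cmod z) (cmod w));
               \<beta> = 1 / 2 * arccos (2 * \<bar>Re (cnj z * w)\<bar>);
               \<beta>' = 1 / 2 * arccos (2 * \<bar>Im (cnj z * w)\<bar>);
               l_id = sqrt (4 * k * \<phi>\<^sup>2 + (norm (log_Diag (\<Lambda> ** matrix_inv D)))\<^sup>2);
               l_13 = sqrt (4 * k * \<beta>\<^sup>2
                 + (norm (log_Diag (perm_act (Transposition.transpose 1 3) \<Lambda> ** matrix_inv D)))\<^sup>2);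
               l_12 = sqrt (4 * k * \<beta>'\<^sup>2
                 + (norm (log_Diag (perm_act (Transposition.transpose 1 2) \<Lambda> ** matrix_inv D)))\<^sup>2)
           in \<phi> \<in> {0..pi / 4} \<and> \<beta> \<in> {0..pi / 4} \<and> \<beta>' \<in> {0..pi / 4}
            \<and> d_SR k X Y = Min {l_id, l_13, l_12}
            \<and> (\<forall>d1 d2 l1 l2 l3.
                 D = diag (vector [d1, d2, d2]) \<and> \<Lambda> = diag (vector [l1, l2, l3]) \<longrightarrow>
                 l_id\<^sup>2 - l_13\<^sup>2 = 4 * k * (\<phi>\<^sup>2 - \<beta>\<^sup>2) - 2 * ln (d1 / d2) * ln (l1 / l3)
               \<and> l_id\<^sup>2 - l_12\<^sup>2 = 4 * k * (\<phi>\<^sup>2 - \<beta>'\<^sup>2) - 2 * ln (d1 / d2) * ln (l1 / l2)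
               \<and> l_13\<^sup>2 - l_12\<^sup>2 = 4 * k * (\<beta>\<^sup>2 - \<beta>'\<^sup>2) + 2 * ln (d1 / d2) * ln (l2 / l3)))"
proof -
  note x = fiberD[OF X(1)] and y = fiberD[OF Y(1)]
  have q: "rot (quat_of z w) = U\<^sup>T ** V" using zw(2) x by (simp add: matrix_inv_SO)
  have comm: "\<Lambda> ** matrix_inv D = matrix_inv D ** \<Lambda>"
    "perm_act \<pi> \<Lambda> ** matrix_inv D = matrix_inv D ** perm_act \<pi> \<Lambda>" for \<pi>
    using Diag_pos_inv_commute x y perm_act_Diag_pos by blast+
  then have comm_13: "perm_act (Transposition.transpose 1 3) \<Lambda> ** matrix_inv D = matrix_inv D ** (P13 ** \<Lambda> ** P13\<^sup>T)"
    and comm_12: "perm_act (Transposition.transpose 1 2) \<Lambda> ** matrix_inv D = matrix_inv D ** (P12 ** \<Lambda> ** P12\<^sup>T)"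
    by (simp_all add: perm_act_eq_conj[OF signed_perm_transpositions(1) y(2), symmetric]
        perm_act_eq_conj[OF signed_perm_transpositions(2) y(2), symmetric])
  have "\<bar>Re (cnj z * w)\<bar> \<le> cmod z * cmod w" "\<bar>Im (cnj z * w)\<bar> \<le> cmod z * cmod w"
    using abs_Re_le_cmod[of "cnj z * w"] abs_Im_le_cmod[of "cnj z * w"] by (simp_all add: norm_mult)
  then have half: "2 * \<bar>Re (cnj z * w)\<bar> \<le> 1" "2 * \<bar>Im (cnj z * w)\<bar> \<le> 1"
    using two_cmod_mult_le_1[OF zw(1)] by linarith+
  have sq: "(sqrt (4 * k * t\<^sup>2 + n\<^sup>2))\<^sup>2 = 4 * k * t\<^sup>2 + n\<^sup>2" for t n
    using k by simp
  show ?thesis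
    unfolding Let_def sq
  proof (intro conjI allI impI, goal_cases)
    case 1 show ?case using max_cmod_unit[OF zw(1)] by (intro arccos_in_0_pi4)
  next
    case 2 show ?case by (rule arccos_half_in_0_pi4[OF half(1)])
  next
    case 3 show ?case by (rule arccos_half_in_0_pi4[OF half(2)])
  next
    case 4 show ?case
      unfolding d_SR_mid_top[OF k X Y zw(1) q] stab_cost_def arccos_max_add_sub[OF zw(1)]
        arccos_max_sub_i[OF zw(1)] comm(1) comm_13 comm_12 by simp
  next
    case (5 d1 d2 l1 l2 l3)
    from power2_norm_log_differences(1)[OF conjunct1[OF 5] conjunct2[OF 5] x(2) y(2)]
    show ?case by (simp add: algebra_simps)
  next
    case (6 d1 d2 l1 l2 l3)
    from power2_norm_log_differences(2)[OF conjunct1[OF 6] conjunct2[OF 6] x(2) y(2)]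
    show ?case by (simp add: algebra_simps)
  next
    case (7 d1 d2 l1 l2 l3)
    from power2_norm_log_differences(3)[OF conjunct1[OF 7] conjunct2[OF 7] x(2) y(2)]
    show ?case by (simp add: algebra_simps)
  qed
qed

lemma d_SR_mid_mid_formula:
  assumes k: "k > 0" and X: "(U, D) \<in> fiber X" "D \<in> D_J1" and Y: "(V, \<Lambda>) \<in> fiber Y" "\<Lambda> \<in> D_J1"
    and zw: "quat_of z w \<in> unit_quats" "rot (quat_of z w) = matrix_inv U ** V"
  shows "(let \<phi> = arccos (max (cmod z) (cmod w));
               l_id = sqrt (4 * k * \<phi>\<^sup>2 + (norm (log_Diag (\<Lambda> ** matrix_inv D)))\<^sup>2);
               l_13 = sqrt (4 * k * (pi / 4 - \<phi>)\<^sup>2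
                 + (norm (log_Diag (perm_act (Transposition.transpose 1 3) \<Lambda> ** matrix_inv D)))\<^sup>2)
           in \<phi> \<in> {0..pi / 4}
            \<and> d_SR k X Y = Min {l_id, l_13}
            \<and> (\<forall>d1 d2 l1 l2.
                 D = diag (vector [d1, d2, d2]) \<and> \<Lambda> = diag (vector [l1, l2, l2]) \<longrightarrow>
                 l_id\<^sup>2 - l_13\<^sup>2 =
                   2 * k * pi * (\<phi> - pi / 8) - 2 * ln (d1 / d2) * ln (l1 / l2)))"
proof -
  note x = fiberD[OF X(1)] and y = fiberD[OF Y(1)]
  have q: "rot (quat_of z w) = U\<^sup>T ** V" using zw(2) x by (simp add: matrix_inv_SO)
  have comm: "\<Lambda> ** matrix_inv D = matrix_inv D ** \<Lambda>"
    "perm_act \<pi> \<Lambda> ** matrix_inv D = matrix_inv D ** perm_act \<pi> \<Lambda>" for \<pi>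
    using Diag_pos_inv_commute x y perm_act_Diag_pos by blast+
  then have comm_13: "perm_act (Transposition.transpose 1 3) \<Lambda> ** matrix_inv D = matrix_inv D ** (P13 ** \<Lambda> ** P13\<^sup>T)"
    by (simp add: perm_act_eq_conj[OF signed_perm_transpositions(1) y(2), symmetric])
  have sq: "(sqrt (4 * k * t\<^sup>2 + n\<^sup>2))\<^sup>2 = 4 * k * t\<^sup>2 + n\<^sup>2" for t n
    using k by simp
  show ?thesis
    unfolding Let_def sq
  proof (intro conjI allI impI, goal_cases)
    case 1 show ?case using max_cmod_unit[OF zw(1)] by (intro arccos_in_0_pi4)
  next
    case 2 show ?case
      unfolding d_SR_mid_mid[OF k X Y zw(1) q] stab_cost_def comm(1) comm_13 by simp
  next
    case (3 d1 d2 l1 l2)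
    from power2_norm_log_differences(1)[OF conjunct1[OF 3] conjunct2[OF 3] x(2) y(2)]
    show ?case by (simp add: algebra_simps power2_eq_square)
  qed
qed

theorem theorem5p4:
  fixes k :: real and X Y U V D \<Lambda> :: "real^3^3"
  assumes "k > 0"
    and "X \<in> Sym_pos" and "Y \<in> Sym_pos"
    and "(U, D) \<in> fiber X" and "(V, \<Lambda>) \<in> fiber Y"
    and "X \<in> S_mid \<Longrightarrow> D \<in> D_J1"
    and "Y \<in> S_mid \<Longrightarrow> \<Lambda> \<in> D_J1"
  shows
    "(X \<in> S_top \<and> Y \<in> S_top \<longrightarrow>
        (d_SR k X Y)\<^sup>2 =
          Min ((\<lambda>P. k / 2 * (norm (log_SO (matrix_inv U ** V ** matrix_inv P)))\<^sup>2
                    + (norm (log_Diag (matrix_inv D ** perm_act (perm_of P) \<Lambda>)))\<^sup>2) ` S3_even))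
   \<and> (X \<in> S_mid \<and> Y \<in> S_top \<longrightarrow>
        (\<forall>z w. quat_of z w \<in> unit_quats \<and> rot (quat_of z w) = matrix_inv U ** V \<longrightarrow>
          (let \<phi> = arccos (max (cmod z) (cmod w));
               \<beta> = 1 / 2 * arccos (2 * \<bar>Re (cnj z * w)\<bar>);
               \<beta>' = 1 / 2 * arccos (2 * \<bar>Im (cnj z * w)\<bar>);
               l_id = sqrt (4 * k * \<phi>\<^sup>2 + (norm (log_Diag (\<Lambda> ** matrix_inv D)))\<^sup>2);
               l_13 = sqrt (4 * k * \<beta>\<^sup>2
                 + (norm (log_Diag (perm_act (Transposition.transpose 1 3) \<Lambda> ** matrix_inv D)))\<^sup>2);
               l_12 = sqrt (4 * k * \<beta>'\<^sup>2
                 + (norm (log_Diag (perm_act (Transposition.transpose 1 2) \<Lambda> ** matrix_inv D)))\<^sup>2)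
           in \<phi> \<in> {0..pi / 4} \<and> \<beta> \<in> {0..pi / 4} \<and> \<beta>' \<in> {0..pi / 4}
            \<and> d_SR k X Y = Min {l_id, l_13, l_12}
            \<and> (\<forall>d1 d2 l1 l2 l3.
                 D = diag (vector [d1, d2, d2]) \<and> \<Lambda> = diag (vector [l1, l2, l3]) \<longrightarrow>
                 l_id\<^sup>2 - l_13\<^sup>2 = 4 * k * (\<phi>\<^sup>2 - \<beta>\<^sup>2) - 2 * ln (d1 / d2) * ln (l1 / l3)
               \<and> l_id\<^sup>2 - l_12\<^sup>2 = 4 * k * (\<phi>\<^sup>2 - \<beta>'\<^sup>2) - 2 * ln (d1 / d2) * ln (l1 / l2)
               \<and> l_13\<^sup>2 - l_12\<^sup>2 = 4 * k * (\<beta>\<^sup>2 - \<beta>'\<^sup>2) + 2 * ln (d1 / d2) * ln (l2 / l3)))))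
   \<and> (X \<in> S_mid \<and> Y \<in> S_mid \<longrightarrow>
        (\<forall>z w. quat_of z w \<in> unit_quats \<and> rot (quat_of z w) = matrix_inv U ** V \<longrightarrow>
          (let \<phi> = arccos (max (cmod z) (cmod w));
               l_id = sqrt (4 * k * \<phi>\<^sup>2 + (norm (log_Diag (\<Lambda> ** matrix_inv D)))\<^sup>2);
               l_13 = sqrt (4 * k * (pi / 4 - \<phi>)\<^sup>2
                 + (norm (log_Diag (perm_act (Transposition.transpose 1 3) \<Lambda> ** matrix_inv D)))\<^sup>2)
           in \<phi> \<in> {0..pi / 4}
            \<and> d_SR k X Y = Min {l_id, l_13}
            \<and> (\<forall>d1 d2 l1 l2.
                 D = diag (vector [d1, d2, d2]) \<and> \<Lambda> = diag (vector [l1, l2, l2]) \<longrightarrow>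
                 l_id\<^sup>2 - l_13\<^sup>2 =
                   2 * k * pi * (\<phi> - pi / 8) - 2 * ln (d1 / d2) * ln (l1 / l2)))))
   \<and> (X \<in> S_bot \<longrightarrow> d_SR k X Y = norm (log_Diag (matrix_inv D ** \<Lambda>)))"
proof (intro conjI impI allI)
  note k = \<open>k > 0\<close> and X = \<open>(U, D) \<in> fiber X\<close> and Y = \<open>(V, \<Lambda>) \<in> fiber Y\<close>
  show "(d_SR k X Y)\<^sup>2 =
          Min ((\<lambda>P. k / 2 * (norm (log_SO (matrix_inv U ** V ** matrix_inv P)))\<^sup>2
                    + (norm (log_Diag (matrix_inv D ** perm_act (perm_of P) \<Lambda>)))\<^sup>2) ` S3_even)"
    if "X \<in> S_top \<and> Y \<in> S_top"
    using that by (intro d_SR_top_top_formula[OF k X _ Y]) simp_all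
  show "d_SR k X Y = norm (log_Diag (matrix_inv D ** \<Lambda>))" if "X \<in> S_bot"
    by (rule d_SR_bot[OF k X that Y])
qed ((rule d_SR_mid_top_formula[OF assms(1,4) _ assms(5)] | rule d_SR_mid_mid_formula[OF assms(1,4) _ assms(5)]); use assms in blast)+

end
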